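(* Let $K$ be a field with $\mathrm{char}(K)\neq2$. Let $(V,c,\beta)$ be a lifted QLie algebra over $K$ with $\dim V=2$ and $\beta\neq0$, and assume that the minimal polynomial $f\in K[X]$ of $c$ has the form $f=(X+1)h$ with $h\in K[X]$, $h(-1)\neq0$. Assume $\dim(\mathrm{Im}\,\beta)=1$. Then there exist a basis $x_1,x_2$ of $V$ and an element $\gamma\in K$ such that, up to isomorphism of lifted QLie algebras, $f$, $c$, $\beta$ and $U_Q(V,c,\beta)$ are as in one, and only one, of the rows (1)–(8) of the table in the context. Moreover, conversely, if $V$ has basis $x_1,x_2$ and $c$ and $\beta$ are as in any of the rows (1)–(8), then $(V,c,\beta)$ is a lifted QLie algebra.
   Context: All vector spaces and tensor products are over $K$. A braided vector space $(V,c)$ is a vector space with a linear map $c:V\otimes V\to V\otimes V$ satisfying $c_1c_2c_1=c_2c_1c_2$ on $V^{\otimes3}$, where $c_1=c\otimes\mathrm{Id}_V$, $c_2=\mathrm{Id}_V\otimes c$. For $\beta:V\otimes V\to V$, put $\beta_1=\beta\otimes\mathrm{Id}_V$, $\beta_2=\mathrm{Id}_V\otimes\beta$. A lifted QLie algebra is a triple $(V,c,\beta)$ with $(V,c)$ a braided vector space and $\beta:V\otimes V\to V$ linear such that $c\beta_1=\beta_2c_1c_2$, $c\beta_2=\beta_1c_2c_1$, $\beta c=-\beta$, and $\beta(\beta_1-\beta_2)(z)=0$ for all $z\in V^{\otimes3}$ with $c_1(z)=-z=c_2(z)$. A morphism $(V,c_V,\beta_V)\to(W,c_W,\beta_W)$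 is a linear map $g:V\to W$ with $c_W(g\otimes g)=(g\otimes g)c_V$ and $g\beta_V=\beta_W(g\otimes g)$. With $f=(X+1)h$ the minimal polynomial of $c$, $U_Q(V,c,\beta)=T(V,c)/\big(h(c)(z)-\beta(z)\mid z\in V^{\otimes2}\big)$, the quotient of the tensor algebra $T(V,c)$ of $V$ by the two-sided ideal generated by the indicated elements. Table. Write $x_{ij}=x_i\otimes x_j$. "Standard $\beta$" means $\beta(x_{21})=x_1$, $\beta(x_{12})=-x_1$, $\beta(x_{11})=\beta(x_{22})=0$. "$\sqrt\gamma\notin K$" means that $\gamma$ is not a square in $K$. In each row $U_Q$ is $T(V,c)$ modulo the listed relations. (1) $f=X^2-1$; $c(x_{11})=x_{11}$, $c(x_{21})=x_{12}$, $c(x_{12})=x_{21}$, $c(x_{22})=x_{22}$; standard $\beta$; relation $x_2x_1-x_1x_2+x_1$. (2) $f=X^2-1$; $c(x_{11})=x_{11}$, $c(x_{21})=x_{11}+x_{12}$, $c(x_{12})=-x_{11}+x_{21}$, $c(x_{22})=x_{22}$; standard $\beta$; relation $x_1^2-x_2x_1+x_1x_2-x_1$. (3) $f=X^2-1$; $c(x_{11})=-x_{11}$, $c(x_{21})=x_{12}$, $c(x_{12})=x_{21}$, $c(x_{22})=\gamma x_{11}+x_{22}$; standard $\beta$; relations $x_1^2$ and $x_2x_1-x_1x_2+x_1$; here $\gamma=0$, or $\gamma=1$, or $\sqrt\gamma\notin K$. (4) $f=X^2-1$; $c(x_{11})=x_{11}$, $c(x_{21})=x_{12}$, $c(x_{12})=x_{21}$,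 $c(x_{22})=\gamma x_{11}-x_{22}$; $\beta(x_{22})=x_1$, $\beta(x_{11})=\beta(x_{21})=\beta(x_{12})=0$; relations $x_2x_1-x_1x_2$ and $\gamma x_1^2-2x_2^2-x_1$; here $\gamma=0$, or $\gamma=1$, or $\sqrt\gamma\notin K$. (5) $f=(X^2-1)X$; $c(x_{11})=0$, $c(x_{21})=x_{11}+x_{12}$, $c(x_{12})=x_{21}$, $c(x_{22})=x_{22}$; standard $\beta$; relation $x_1^2-x_2x_1+x_1x_2+x_1$. (6) $f=(X^2-1)X$; $c(x_{11})=0$, $c(x_{21})=\gamma^{-1}x_{12}$, $c(x_{12})=\gamma x_{21}$, $c(x_{22})=x_{22}$; $\beta(x_{21})=x_1$, $\beta(x_{12})=-\gamma x_1$, $\beta(x_{11})=\beta(x_{22})=0$; relation $-\gamma x_2x_1+x_1x_2+\gamma x_1$; here $\gamma\neq0,1$. (7) $f=(X^2-1)(X-\gamma)$; $c(x_{11})=\gamma x_{11}$, $c(x_{21})=x_{12}$, $c(x_{12})=x_{21}$, $c(x_{22})=x_{22}$; standard $\beta$; relation $(1+\gamma)(x_2x_1-x_1x_2)-x_1$; here $\gamma\neq\pm1$. (8) $f=(X^2-1)(X-1)$; $c(x_{11})=x_{11}$, $c(x_{21})=x_{12}$, $c(x_{12})=x_{21}$, $c(x_{22})=\gamma x_{11}+x_{22}$; standard $\beta$; relation $2(x_2x_1-x_1x_2)-x_1$; here $\gamma=1$ or $\sqrt\gamma\notin K$. *)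

theory Defs
  imports
    "HOL-Library.Poly_Mapping"
    "HOL-Algebra.QuotRing"
    "HOL-Computational_Algebra.Polynomial"
begin

text \<open>
  Words over an alphabet form the free monoid, written additively so that
  \<^typ>\<open>'v list \<Rightarrow>\<^sub>0 'k\<close> with the convolution product of
  \<^theory>\<open>HOL-Library.Poly_Mapping\<close> is the free associative unital algebra on \<open>'v\<close>.
\<close>

instantiation list :: (type) monoid_add
begin

definition zero_list :: "'a list" where "zero_list = []"

definition plus_list :: "'a list \<Rightarrow> 'a list \<Rightarrow> 'a list" where "plus_list = (@)"

instance by standard (simp_all add: zero_list_def plus_list_def)

end

definition free_algebra :: "('v list \<Rightarrow>\<^sub>0 'k::field) ring" where
  "free_algebra = \<lparr>carrier = UNIV, monoid.mult = (*), one = 1, ring.zero = 0, add = (+)\<rparr>"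

text \<open>
  Throughout, \<open>s\<close> is the scalar multiplication of a vector space whose underlying set is the
  whole type \<open>'v\<close> (the locale \<^locale>\<open>vector_space\<close>).  The tensor algebra is the free
  algebra on the set of vectors modulo the relations that make the inclusion of the vectors
  linear; multilinearity of longer words follows since the ideal is two-sided.
\<close>

definition linearity_relations ::
    "('k::field \<Rightarrow> 'v::ab_group_add \<Rightarrow> 'v) \<Rightarrow> ('v list \<Rightarrow>\<^sub>0 'k) set" where
  "linearity_relations s =
     {Poly_Mapping.single [v + w] 1 - Poly_Mapping.single [v] 1 - Poly_Mapping.single [w] 1 | v w. True}
     \<union> {Poly_Mapping.single [s a v] 1 - Poly_Mapping.single [v] a | a v. True}"

definition tensor_ideal ::
    "('k::field \<Rightarrow> 'v::ab_group_add \<Rightarrow> 'v) \<Rightarrow> ('v list \<Rightarrow>\<^sub>0 'k) set" where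
  "tensor_ideal s = genideal free_algebra (linearity_relations s)"

type_synonym ('v, 'k) tensor = "('v list \<Rightarrow>\<^sub>0 'k) set"

definition tensor_algebra ::
    "('k::field \<Rightarrow> 'v::ab_group_add \<Rightarrow> 'v) \<Rightarrow> ('v, 'k) tensor ring" where
  "tensor_algebra s = free_algebra Quot tensor_ideal s"

definition tensor_class ::
    "('k::field \<Rightarrow> 'v::ab_group_add \<Rightarrow> 'v) \<Rightarrow> ('v list \<Rightarrow>\<^sub>0 'k) \<Rightarrow> ('v, 'k) tensor" where
  "tensor_class s p = tensor_ideal s +>\<^bsub>free_algebra\<^esub> p"

definition tvec :: "('k::field \<Rightarrow> 'v::ab_group_add \<Rightarrow> 'v) \<Rightarrow> 'v \<Rightarrow> ('v, 'k) tensor" where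
  "tvec s v = tensor_class s (Poly_Mapping.single [v] 1)"

definition tscale ::
    "('k::field \<Rightarrow> 'v::ab_group_add \<Rightarrow> 'v) \<Rightarrow> 'k \<Rightarrow> ('v, 'k) tensor \<Rightarrow> ('v, 'k) tensor" where
  "tscale s a t = tensor_class s (Poly_Mapping.single [] a) \<otimes>\<^bsub>tensor_algebra s\<^esub> t"

text \<open>
  The tensor power \<open>V\<^sup>\<otimes>\<^sup>n\<close> is the homogeneous component of degree \<open>n\<close> of the tensor algebra.
  Hence the product of the tensor algebra is the tensor product of tensors, and
  \<open>(V \<otimes> V) \<otimes> V = V \<otimes> (V \<otimes> V)\<close> holds on the nose.
\<close>

definition tensor_power ::
    "('k::field \<Rightarrow> 'v::ab_group_add \<Rightarrow> 'v) \<Rightarrow> nat \<Rightarrow> ('v, 'k) tensor set" where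
  "tensor_power s n = {tensor_class s p | p. \<forall>w \<in> Poly_Mapping.keys p. length w = n}"

definition tensor_linear ::
    "('k::field \<Rightarrow> 'v::ab_group_add \<Rightarrow> 'v) \<Rightarrow> ('k \<Rightarrow> 'w::ab_group_add \<Rightarrow> 'w) \<Rightarrow> nat
      \<Rightarrow> (('v, 'k) tensor \<Rightarrow> ('w, 'k) tensor) \<Rightarrow> bool" where
  "tensor_linear s s' n F \<longleftrightarrow>
     (\<forall>z \<in> tensor_power s n. F z \<in> carrier (tensor_algebra s')) \<and>
     (\<forall>z \<in> tensor_power s n. \<forall>z' \<in> tensor_power s n.
        F (z \<oplus>\<^bsub>tensor_algebra s\<^esub> z') = F z \<oplus>\<^bsub>tensor_algebra s'\<^esub> F z') \<and>
     (\<forall>a. \<forall>z \<in> tensor_power s n. F (tscale s a z) = tscale s' a (F z))"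

text \<open>
  For linear \<open>F\<close> on \<open>V\<^sup>\<otimes>\<^sup>m\<close> and \<open>G\<close> on \<open>V\<^sup>\<otimes>\<^sup>n\<close>, this is the linear map
  \<open>F \<otimes> G\<close> on \<open>V\<^sup>\<otimes>\<^sup>m\<^sup>+\<^sup>n\<close>; the condition determines it there, and its values elsewhere
  are irrelevant.
\<close>

definition tensor_map ::
    "('k::field \<Rightarrow> 'v::ab_group_add \<Rightarrow> 'v) \<Rightarrow> ('k \<Rightarrow> 'w::ab_group_add \<Rightarrow> 'w) \<Rightarrow> nat \<Rightarrow> nat
      \<Rightarrow> (('v, 'k) tensor \<Rightarrow> ('w, 'k) tensor) \<Rightarrow> (('v, 'k) tensor \<Rightarrow> ('w, 'k) tensor)
      \<Rightarrow> ('v, 'k) tensor \<Rightarrow> ('w, 'k) tensor" where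
  "tensor_map s s' m n F G =
     (SOME H. tensor_linear s s' (m + n) H \<and>
        (\<forall>a \<in> tensor_power s m. \<forall>b \<in> tensor_power s n.
           H (a \<otimes>\<^bsub>tensor_algebra s\<^esub> b) = F a \<otimes>\<^bsub>tensor_algebra s'\<^esub> G b))"

text \<open>
  A map \<open>V \<rightarrow> W\<close>, regarded as a map of the degree one components via the identification
  \<^const>\<open>tvec\<close> of a space with the degree one component of its tensor algebra.
\<close>

definition degree_one_map ::
    "('k::field \<Rightarrow> 'v::ab_group_add \<Rightarrow> 'v) \<Rightarrow> ('k \<Rightarrow> 'w::ab_group_add \<Rightarrow> 'w) \<Rightarrow> ('v \<Rightarrow> 'w)
      \<Rightarrow> ('v, 'k) tensor \<Rightarrow> ('w, 'k) tensor" where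
  "degree_one_map s s' g = (\<lambda>t. tvec s' (g (the_inv (tvec s) t)))"

definition linear_T2_T2 ::
    "('k::field \<Rightarrow> 'v::ab_group_add \<Rightarrow> 'v) \<Rightarrow> (('v, 'k) tensor \<Rightarrow> ('v, 'k) tensor) \<Rightarrow> bool" where
  "linear_T2_T2 s c \<longleftrightarrow> tensor_linear s s 2 c \<and> c ` tensor_power s 2 \<subseteq> tensor_power s 2"

definition linear_T2_V ::
    "('k::field \<Rightarrow> 'v::ab_group_add \<Rightarrow> 'v) \<Rightarrow> (('v, 'k) tensor \<Rightarrow> 'v) \<Rightarrow> bool" where
  "linear_T2_V s \<beta> \<longleftrightarrow>
     (\<forall>z \<in> tensor_power s 2. \<forall>z' \<in> tensor_power s 2.
        \<beta> (z \<oplus>\<^bsub>tensor_algebra s\<^esub> z') = \<beta> z + \<beta> z') \<and>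
     (\<forall>a. \<forall>z \<in> tensor_power s 2. \<beta> (tscale s a z) = s a (\<beta> z))"

definition braided_vector_space ::
    "('k::field \<Rightarrow> 'v::ab_group_add \<Rightarrow> 'v) \<Rightarrow> (('v, 'k) tensor \<Rightarrow> ('v, 'k) tensor) \<Rightarrow> bool" where
  "braided_vector_space s c \<longleftrightarrow>
     vector_space s \<and> linear_T2_T2 s c \<and>
     (let c1 = tensor_map s s 2 1 c id; c2 = tensor_map s s 1 2 id c
      in \<forall>z \<in> tensor_power s 3. c1 (c2 (c1 z)) = c2 (c1 (c2 z)))"

definition lifted_QLie_algebra ::
    "('k::field \<Rightarrow> 'v::ab_group_add \<Rightarrow> 'v) \<Rightarrow> (('v, 'k) tensor \<Rightarrow> ('v, 'k) tensor)
      \<Rightarrow> (('v, 'k) tensor \<Rightarrow> 'v) \<Rightarrow> bool" where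
  "lifted_QLie_algebra s c \<beta> \<longleftrightarrow>
     braided_vector_space s c \<and> linear_T2_V s \<beta> \<and>
     (let c1 = tensor_map s s 2 1 c id;
          c2 = tensor_map s s 1 2 id c;
          \<beta>1 = tensor_map s s 2 1 (\<lambda>z. tvec s (\<beta> z)) id;
          \<beta>2 = tensor_map s s 1 2 id (\<lambda>z. tvec s (\<beta> z))
      in (\<forall>z \<in> tensor_power s 3. c (\<beta>1 z) = \<beta>2 (c1 (c2 z))) \<and>
         (\<forall>z \<in> tensor_power s 3. c (\<beta>2 z) = \<beta>1 (c2 (c1 z))) \<and>
         (\<forall>z \<in> tensor_power s 2. \<beta> (c z) = - \<beta> z) \<and>
         (\<forall>z \<in> tensor_power s 3.
            c1 z = \<ominus>\<^bsub>tensor_algebra s\<^esub> z \<and> c2 z = \<ominus>\<^bsub>tensor_algebra s\<^esub> z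
            \<longrightarrow> \<beta> (\<beta>1 z \<ominus>\<^bsub>tensor_algebra s\<^esub> \<beta>2 z) = 0))"

definition lifted_QLie_morphism ::
    "('k::field \<Rightarrow> 'v::ab_group_add \<Rightarrow> 'v) \<Rightarrow> (('v, 'k) tensor \<Rightarrow> ('v, 'k) tensor)
      \<Rightarrow> (('v, 'k) tensor \<Rightarrow> 'v)
      \<Rightarrow> ('k \<Rightarrow> 'w::ab_group_add \<Rightarrow> 'w) \<Rightarrow> (('w, 'k) tensor \<Rightarrow> ('w, 'k) tensor)
      \<Rightarrow> (('w, 'k) tensor \<Rightarrow> 'w) \<Rightarrow> ('v \<Rightarrow> 'w) \<Rightarrow> bool" where
  "lifted_QLie_morphism s c \<beta> s' c' \<beta>' g \<longleftrightarrow>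
     Vector_Spaces.linear s s' g \<and>
     (let gg = tensor_map s s' 1 1 (degree_one_map s s' g) (degree_one_map s s' g)
      in (\<forall>z \<in> tensor_power s 2. c' (gg z) = gg (c z)) \<and>
         (\<forall>z \<in> tensor_power s 2. g (\<beta> z) = \<beta>' (gg z)))"

text \<open>The inverse of a bijective morphism is again a morphism.\<close>

definition lifted_QLie_isomorphic ::
    "('k::field \<Rightarrow> 'v::ab_group_add \<Rightarrow> 'v) \<Rightarrow> (('v, 'k) tensor \<Rightarrow> ('v, 'k) tensor)
      \<Rightarrow> (('v, 'k) tensor \<Rightarrow> 'v)
      \<Rightarrow> ('k \<Rightarrow> 'w::ab_group_add \<Rightarrow> 'w) \<Rightarrow> (('w, 'k) tensor \<Rightarrow> ('w, 'k) tensor)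
      \<Rightarrow> (('w, 'k) tensor \<Rightarrow> 'w) \<Rightarrow> bool" where
  "lifted_QLie_isomorphic s c \<beta> s' c' \<beta>' \<longleftrightarrow>
     (\<exists>g. bij g \<and> lifted_QLie_morphism s c \<beta> s' c' \<beta>' g)"

definition poly_apply ::
    "('k::field \<Rightarrow> 'v::ab_group_add \<Rightarrow> 'v) \<Rightarrow> (('v, 'k) tensor \<Rightarrow> ('v, 'k) tensor)
      \<Rightarrow> 'k poly \<Rightarrow> ('v, 'k) tensor \<Rightarrow> ('v, 'k) tensor" where
  "poly_apply s c p z =
     (\<Oplus>\<^bsub>tensor_algebra s\<^esub> i \<in> {..degree p}. tscale s (coeff p i) ((c ^^ i) z))"

definition annihilates ::
    "('k::field \<Rightarrow> 'v::ab_group_add \<Rightarrow> 'v) \<Rightarrow> (('v, 'k) tensor \<Rightarrow> ('v, 'k) tensor)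
      \<Rightarrow> 'k poly \<Rightarrow> bool" where
  "annihilates s c p \<longleftrightarrow>
     (\<forall>z \<in> tensor_power s 2. poly_apply s c p z = \<zero>\<^bsub>tensor_algebra s\<^esub>)"

definition is_minimal_polynomial ::
    "('k::field \<Rightarrow> 'v::ab_group_add \<Rightarrow> 'v) \<Rightarrow> (('v, 'k) tensor \<Rightarrow> ('v, 'k) tensor)
      \<Rightarrow> 'k poly \<Rightarrow> bool" where
  "is_minimal_polynomial s c f \<longleftrightarrow>
     lead_coeff f = 1 \<and> annihilates s c f \<and>
     (\<forall>p. p \<noteq> 0 \<and> annihilates s c p \<longrightarrow> degree f \<le> degree p)"

text \<open>Meaningful when the minimal polynomial of \<open>c\<close> is divisible by \<open>X + 1\<close>\<close>

definition U_Q ::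
    "('k::field \<Rightarrow> 'v::ab_group_add \<Rightarrow> 'v) \<Rightarrow> (('v, 'k) tensor \<Rightarrow> ('v, 'k) tensor)
      \<Rightarrow> (('v, 'k) tensor \<Rightarrow> 'v) \<Rightarrow> ('v, 'k) tensor set ring" where
  "U_Q s c \<beta> =
     (let h = (THE h. is_minimal_polynomial s c ([:1, 1:] * h))
      in tensor_algebra s Quot genideal (tensor_algebra s)
           {poly_apply s c h z \<ominus>\<^bsub>tensor_algebra s\<^esub> tvec s (\<beta> z) | z. z \<in> tensor_power s 2})"

definition basis_pair :: "('k::field \<Rightarrow> 'v::ab_group_add \<Rightarrow> 'v) \<Rightarrow> 'v \<Rightarrow> 'v \<Rightarrow> bool" where
  "basis_pair s x1 x2 \<longleftrightarrow>
     x1 \<noteq> x2 \<and> \<not> module.dependent s {x1, x2} \<and> module.span s {x1, x2} = UNIV"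

text \<open>The parameter \<open>\<gamma>\<close> plays no role in rows \<open>R1\<close>, \<open>R2\<close> and \<open>R5\<close>.\<close>

datatype row = R1 | R2 | R3 | R4 | R5 | R6 | R7 | R8

definition row_parameter :: "row \<Rightarrow> 'k::field \<Rightarrow> bool" where
  "row_parameter r \<gamma> =
     (let nonsquare = (\<nexists>\<delta>. \<delta> ^ 2 = \<gamma>)
      in case r of
           R1 \<Rightarrow> True
         | R2 \<Rightarrow> True
         | R3 \<Rightarrow> \<gamma> = 0 \<or> \<gamma> = 1 \<or> nonsquare
         | R4 \<Rightarrow> \<gamma> = 0 \<or> \<gamma> = 1 \<or> nonsquare
         | R5 \<Rightarrow> True
         | R6 \<Rightarrow> \<gamma> \<noteq> 0 \<and> \<gamma> \<noteq> 1
         | R7 \<Rightarrow> \<gamma> \<noteq> 1 \<and> \<gamma> \<noteq> - 1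
         | R8 \<Rightarrow> \<gamma> = 1 \<or> nonsquare)"

definition row_polynomial :: "row \<Rightarrow> 'k::field \<Rightarrow> 'k poly" where
  "row_polynomial r \<gamma> =
     (let X = [:0, 1:]
      in case r of
           R1 \<Rightarrow> X ^ 2 - 1
         | R2 \<Rightarrow> X ^ 2 - 1
         | R3 \<Rightarrow> X ^ 2 - 1
         | R4 \<Rightarrow> X ^ 2 - 1
         | R5 \<Rightarrow> (X ^ 2 - 1) * X
         | R6 \<Rightarrow> (X ^ 2 - 1) * X
         | R7 \<Rightarrow> (X ^ 2 - 1) * (X - [:\<gamma>:])
         | R8 \<Rightarrow> (X ^ 2 - 1) * (X - 1))"

definition row_braiding ::
    "row \<Rightarrow> 'k \<Rightarrow> ('k::field \<Rightarrow> 'v::ab_group_add \<Rightarrow> 'v) \<Rightarrow> 'v \<Rightarrow> 'v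
      \<Rightarrow> (('v, 'k) tensor \<Rightarrow> ('v, 'k) tensor) \<Rightarrow> bool" where
  "row_braiding r \<gamma> s x1 x2 c =
     (let T = tensor_algebra s;
          x11 = tvec s x1 \<otimes>\<^bsub>T\<^esub> tvec s x1;
          x12 = tvec s x1 \<otimes>\<^bsub>T\<^esub> tvec s x2;
          x21 = tvec s x2 \<otimes>\<^bsub>T\<^esub> tvec s x1;
          x22 = tvec s x2 \<otimes>\<^bsub>T\<^esub> tvec s x2
      in case r of
           R1 \<Rightarrow> c x11 = x11 \<and> c x21 = x12 \<and> c x12 = x21 \<and> c x22 = x22
         | R2 \<Rightarrow> c x11 = x11 \<and> c x21 = x11 \<oplus>\<^bsub>T\<^esub> x12 \<and> c x12 = \<ominus>\<^bsub>T\<^esub> x11 \<oplus>\<^bsub>T\<^esub> x21 \<and> c x22 = x22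
         | R3 \<Rightarrow> c x11 = \<ominus>\<^bsub>T\<^esub> x11 \<and> c x21 = x12 \<and> c x12 = x21 \<and> c x22 = tscale s \<gamma> x11 \<oplus>\<^bsub>T\<^esub> x22
         | R4 \<Rightarrow> c x11 = x11 \<and> c x21 = x12 \<and> c x12 = x21 \<and> c x22 = tscale s \<gamma> x11 \<ominus>\<^bsub>T\<^esub> x22
         | R5 \<Rightarrow> c x11 = \<zero>\<^bsub>T\<^esub> \<and> c x21 = x11 \<oplus>\<^bsub>T\<^esub> x12 \<and> c x12 = x21 \<and> c x22 = x22
         | R6 \<Rightarrow> c x11 = \<zero>\<^bsub>T\<^esub> \<and> c x21 = tscale s (inverse \<gamma>) x12 \<and> c x12 = tscale s \<gamma> x21 \<and> c x22 = x22
         | R7 \<Rightarrow> c x11 = tscale s \<gamma> x11 \<and> c x21 = x12 \<and> c x12 = x21 \<and> c x22 = x22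
         | R8 \<Rightarrow> c x11 = x11 \<and> c x21 = x12 \<and> c x12 = x21 \<and> c x22 = tscale s \<gamma> x11 \<oplus>\<^bsub>T\<^esub> x22)"

definition row_bracket ::
    "row \<Rightarrow> 'k \<Rightarrow> ('k::field \<Rightarrow> 'v::ab_group_add \<Rightarrow> 'v) \<Rightarrow> 'v \<Rightarrow> 'v
      \<Rightarrow> (('v, 'k) tensor \<Rightarrow> 'v) \<Rightarrow> bool" where
  "row_bracket r \<gamma> s x1 x2 \<beta> =
     (let T = tensor_algebra s;
          x11 = tvec s x1 \<otimes>\<^bsub>T\<^esub> tvec s x1;
          x12 = tvec s x1 \<otimes>\<^bsub>T\<^esub> tvec s x2;
          x21 = tvec s x2 \<otimes>\<^bsub>T\<^esub> tvec s x1;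
          x22 = tvec s x2 \<otimes>\<^bsub>T\<^esub> tvec s x2;
          standard = (\<beta> x21 = x1 \<and> \<beta> x12 = - x1 \<and> \<beta> x11 = 0 \<and> \<beta> x22 = 0)
      in case r of
           R1 \<Rightarrow> standard
         | R2 \<Rightarrow> standard
         | R3 \<Rightarrow> standard
         | R4 \<Rightarrow> \<beta> x22 = x1 \<and> \<beta> x11 = 0 \<and> \<beta> x21 = 0 \<and> \<beta> x12 = 0
         | R5 \<Rightarrow> standard
         | R6 \<Rightarrow> \<beta> x21 = x1 \<and> \<beta> x12 = - s \<gamma> x1 \<and> \<beta> x11 = 0 \<and> \<beta> x22 = 0
         | R7 \<Rightarrow> standard
         | R8 \<Rightarrow> standard)"

definition row_relations ::
    "row \<Rightarrow> 'k \<Rightarrow> ('k::field \<Rightarrow> 'v::ab_group_add \<Rightarrow> 'v) \<Rightarrow> 'v \<Rightarrow> 'v \<Rightarrow> ('v, 'k) tensor set" where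
  "row_relations r \<gamma> s v1 v2 =
     (let T = tensor_algebra s;
          x1 = tvec s v1;
          x2 = tvec s v2
      in case r of
           R1 \<Rightarrow> {x2 \<otimes>\<^bsub>T\<^esub> x1 \<ominus>\<^bsub>T\<^esub> x1 \<otimes>\<^bsub>T\<^esub> x2 \<oplus>\<^bsub>T\<^esub> x1}
         | R2 \<Rightarrow> {x1 \<otimes>\<^bsub>T\<^esub> x1 \<ominus>\<^bsub>T\<^esub> x2 \<otimes>\<^bsub>T\<^esub> x1 \<oplus>\<^bsub>T\<^esub> x1 \<otimes>\<^bsub>T\<^esub> x2 \<ominus>\<^bsub>T\<^esub> x1}
         | R3 \<Rightarrow> {x1 \<otimes>\<^bsub>T\<^esub> x1, x2 \<otimes>\<^bsub>T\<^esub> x1 \<ominus>\<^bsub>T\<^esub> x1 \<otimes>\<^bsub>T\<^esub> x2 \<oplus>\<^bsub>T\<^esub> x1}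
         | R4 \<Rightarrow> {x2 \<otimes>\<^bsub>T\<^esub> x1 \<ominus>\<^bsub>T\<^esub> x1 \<otimes>\<^bsub>T\<^esub> x2,
                  tscale s \<gamma> (x1 \<otimes>\<^bsub>T\<^esub> x1) \<ominus>\<^bsub>T\<^esub> tscale s 2 (x2 \<otimes>\<^bsub>T\<^esub> x2) \<ominus>\<^bsub>T\<^esub> x1}
         | R5 \<Rightarrow> {x1 \<otimes>\<^bsub>T\<^esub> x1 \<ominus>\<^bsub>T\<^esub> x2 \<otimes>\<^bsub>T\<^esub> x1 \<oplus>\<^bsub>T\<^esub> x1 \<otimes>\<^bsub>T\<^esub> x2 \<oplus>\<^bsub>T\<^esub> x1}
         | R6 \<Rightarrow> {\<ominus>\<^bsub>T\<^esub> tscale s \<gamma> (x2 \<otimes>\<^bsub>T\<^esub> x1) \<oplus>\<^bsub>T\<^esub> x1 \<otimes>\<^bsub>T\<^esub> x2 \<oplus>\<^bsub>T\<^esub> tscale s \<gamma> x1}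
         | R7 \<Rightarrow> {tscale s (1 + \<gamma>) (x2 \<otimes>\<^bsub>T\<^esub> x1 \<ominus>\<^bsub>T\<^esub> x1 \<otimes>\<^bsub>T\<^esub> x2) \<ominus>\<^bsub>T\<^esub> x1}
         | R8 \<Rightarrow> {tscale s 2 (x2 \<otimes>\<^bsub>T\<^esub> x1 \<ominus>\<^bsub>T\<^esub> x1 \<otimes>\<^bsub>T\<^esub> x2) \<ominus>\<^bsub>T\<^esub> x1})"

definition as_in_row ::
    "row \<Rightarrow> ('k::field \<Rightarrow> 'v::ab_group_add \<Rightarrow> 'v) \<Rightarrow> (('v, 'k) tensor \<Rightarrow> ('v, 'k) tensor)
      \<Rightarrow> (('v, 'k) tensor \<Rightarrow> 'v) \<Rightarrow> bool" where
  "as_in_row r s c \<beta> \<longleftrightarrow>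
     (\<exists>x1 x2 \<gamma>. basis_pair s x1 x2 \<and> row_parameter r \<gamma> \<and>
        is_minimal_polynomial s c (row_polynomial r \<gamma>) \<and>
        row_braiding r \<gamma> s x1 x2 c \<and> row_bracket r \<gamma> s x1 x2 \<beta> \<and>
        U_Q s c \<beta> =
          tensor_algebra s Quot genideal (tensor_algebra s) (row_relations r \<gamma> s x1 x2))"

end

theory Submission
  imports Defs
begin

text \<open>
  A basis \<open>x1, x2\<close> of \<open>V\<close> identifies the tensor algebra with the noncommutative polynomials in two
  letters, so \<open>c\<close> and \<open>\<beta>\<close> become arrays of scalars and every axiom a system of polynomial equations.
  Choose \<open>x1\<close> spanning \<open>Im \<beta>\<close> and write \<open>\<beta> = b x1\<close>. The compatibilities of \<open>c\<close> with \<open>\<beta>\<close> force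
  \<open>c (x1 \<otimes> v) \<in> V \<otimes> x1\<close> and \<open>c (v \<otimes> x1) \<in> x1 \<otimes> V\<close>, which leaves the scalars
  \<open>c x11 = a x11\<close>, \<open>c x12 = p x11 + q x21\<close>, \<open>c x21 = r x11 + t x12\<close> together with the four coefficients of
  \<open>c x22\<close>; moreover \<open>b x11 = 0\<close>.
  If \<open>b x21 \<noteq> 0\<close>, then \<open>q t = 1\<close>; for \<open>q \<noteq> 1\<close> everything else vanishes after replacing \<open>x2\<close> by
  \<open>x2 + \<nu> x1\<close> (row 6), and for \<open>q = 1\<close> the braid equation splits into \<open>a = -1\<close> (row 3), \<open>a = 1\<close>
  (rows 1, 2, 8), \<open>a = 0\<close> (rows 5, 7) and the remaining \<open>a\<close> (row 7). If \<open>b x21 = 0\<close>, only row 4 survives.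
  The hypothesis \<open>h (-1) \<noteq> 0\<close> says that the eigenvalue \<open>-1\<close> of \<open>c\<close> is semisimple; it is needed for
  \<open>a = -1\<close> and in row 4. The rows are distinguished by how these scalars change under
  \<open>x1 \<mapsto> \<kappa> x1\<close>, \<open>x2 \<mapsto> \<mu> x2 + \<nu> x1\<close>, the only changes of basis that preserve \<open>Im \<beta>\<close>.
\<close>

section \<open>The free algebra and substitution of letters\<close>

text \<open>The obstacle is the representation. A tensor is a coset of the free algebra on all
  vectors, and \<open>tensor_map\<close> is a choice operator that says nothing until a map with the
  required property has been exhibited. One fact resolves both: the tensor ideal is exactly the
  kernel of the substitution that writes each vector in the two basis letters. Cosets thus become
  noncommutative polynomials in two letters, and a linear map can be prescribed freely on monomials.
  The alternatives for \<gamma> in rows 3, 4 and 8 are square classes. Replacing x1 by \<delta> x1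
  divides the x11 coefficient of c x22 by \<delta>^2. In row 4 the condition \<beta> x22 = x1
  couples the scaling of x1 by \<delta>^2 to that of x2 by \<delta>, with the same effect on that
  coefficient. Uniqueness of the row across different spaces is reduced to one space by pulling a
  basis back along the isomorphism.\<close>

text \<open>The step adds a monomial instead of overwriting a coefficient, so additive maps pass
  through it.\<close>

lemma poly_mapping_induct_single:
  fixes p :: "'a \<Rightarrow>\<^sub>0 'b::ab_group_add"
  assumes "P 0" and "\<And>w a p. P p \<Longrightarrow> P (Poly_Mapping.single w a + p)"
  shows "P p"
proof (induction p rule: update_induct)
  case const
  show ?case by (rule assms)
next
  case (update p w a)
  have "Poly_Mapping.update w a p = Poly_Mapping.single w a + p"
    using update(1) by (intro poly_mapping_eqI)
      (auto simp: lookup_update lookup_add lookup_single when_def in_keys_iff)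
  then show ?case using assms(2) update by simp
qed

abbreviation scal :: "'k::field \<Rightarrow> 'a list \<Rightarrow>\<^sub>0 'k" where
  "scal a \<equiv> Poly_Mapping.single [] a"

lemma single_Nil_one: "scal 1 = 1"
  by (metis single_one zero_list_def)

lemma lookup_scal_mult [simp]: "Poly_Mapping.lookup (scal a * p) w = a * Poly_Mapping.lookup p w"
proof -
  have "scal a * p = Poly_Mapping.map ((*) a) p"
    by (metis mult_map_scale_conv_mult zero_list_def)
  then show ?thesis by (simp add: Poly_Mapping.map.rep_eq when_def)
qed

lemma mult_single_list:
  "Poly_Mapping.single u a * Poly_Mapping.single v b = Poly_Mapping.single (u @ v) (a * b :: 'k::field)"
  by (simp add: mult_single plus_list_def)

lemma scal_central: "scal a * p = p * scal a"
  by (induction p rule: poly_mapping_induct_single)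
     (simp_all add: distrib_left distrib_right mult_single_list mult.commute)

text \<open>This is the universal property of the free algebra: the algebra homomorphism that sends
  each letter \<open>x\<close> to \<open>e x\<close>, hence each word to the product of the images
  of its letters.\<close>

definition word_subst :: "('a \<Rightarrow> 'b list \<Rightarrow>\<^sub>0 'k::field) \<Rightarrow> ('a list \<Rightarrow>\<^sub>0 'k) \<Rightarrow> ('b list \<Rightarrow>\<^sub>0 'k)" where
  "word_subst e p = (\<Sum>u \<in> Poly_Mapping.keys p. scal (Poly_Mapping.lookup p u) * prod_list (map e u))"

lemma word_subst_superset:
  assumes "finite A" "Poly_Mapping.keys p \<subseteq> A"
  shows "word_subst e p = (\<Sum>u \<in> A. scal (Poly_Mapping.lookup p u) * prod_list (map e u))"
  unfolding word_subst_def using assms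
  by (intro sum.mono_neutral_left) (auto simp: in_keys_iff)

lemma word_subst_add: "word_subst e (p + q) = word_subst e p + word_subst e q"
proof -
  let ?A = "Poly_Mapping.keys p \<union> Poly_Mapping.keys q"
  have "Poly_Mapping.keys (p + q) \<subseteq> ?A" by (rule keys_add)
  then have "word_subst e (p + q) = (\<Sum>u \<in> ?A. scal (Poly_Mapping.lookup (p + q) u) * prod_list (map e u))"
    by (intro word_subst_superset) auto
  also have "\<dots> = (\<Sum>u \<in> ?A. scal (Poly_Mapping.lookup p u) * prod_list (map e u)) +
      (\<Sum>u \<in> ?A. scal (Poly_Mapping.lookup q u) * prod_list (map e u))"
    by (simp add: lookup_add single_add distrib_right sum.distrib)
  also have "\<dots> = word_subst e p + word_subst e q"
    using word_subst_superset[of ?A p e] word_subst_superset[of ?A q e] by auto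
  finally show ?thesis .
qed

lemma word_subst_single: "word_subst e (Poly_Mapping.single u a) = scal a * prod_list (map e u)"
  by (subst word_subst_superset[where A = "{u}"]) auto

lemma word_subst_zero [simp]: "word_subst e 0 = 0"
  by (simp add: word_subst_def)

lemma word_subst_minus: "word_subst e (p - q) = word_subst e p - word_subst e q"
  using word_subst_add[of e "p - q" q] by (simp add: algebra_simps)

text \<open>By additivity in both arguments two monomials suffice. There the only point is that the
  scalar of the second has to move past the image of the first word.\<close>

lemma word_subst_mult: "word_subst e (p * q) = word_subst e p * word_subst e q"
proof (induction p rule: poly_mapping_induct_single)
  case (2 u a p)
  have "word_subst e (Poly_Mapping.single u a * q) = word_subst e (Poly_Mapping.single u a) * word_subst e q"
  proof (induction q rule: poly_mapping_induct_single)
    case (2 v b q)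
    have "scal a * (prod_list (map e u) * scal b) = scal a * (scal b * prod_list (map e u))"
      by (simp add: scal_central)
    then have "word_subst e (Poly_Mapping.single u a * Poly_Mapping.single v b)
        = word_subst e (Poly_Mapping.single u a) * word_subst e (Poly_Mapping.single v b)"
      unfolding mult_single_list word_subst_single
      by (metis (no_types, lifting) append_Nil map_append mult.assoc mult_single_list prod_list.append)
    then show ?case using 2 by (simp add: distrib_left word_subst_add)
  qed simp
  then show ?case using 2 by (simp add: distrib_right word_subst_add)
qed simp

lemma word_subst_prod_list: "word_subst e (prod_list (map f u)) = prod_list (map (\<lambda>x. word_subst e (f x)) u)"
proof (induction u)
  case Nil
  have "word_subst e (scal 1) = scal 1" by (simp add: word_subst_single)
  then show ?case by (simp add: single_Nil_one)
qed (simp add: word_subst_mult)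

lemma word_subst_word_subst:
  "word_subst e (word_subst f p) = word_subst (\<lambda>x. word_subst e (f x)) p"
  by (induction p rule: poly_mapping_induct_single)
     (simp_all add: word_subst_add word_subst_single word_subst_mult word_subst_prod_list)

lemma prod_list_letters: "prod_list (map (\<lambda>x. Poly_Mapping.single [x] 1) u) = Poly_Mapping.single u (1::'k::field)"
  by (induction u) (simp_all add: mult_single_list single_Nil_one)

lemma word_subst_letters: "word_subst (\<lambda>x. Poly_Mapping.single [x] 1) p = p"
  by (induction p rule: poly_mapping_induct_single)
     (simp_all add: word_subst_add word_subst_single prod_list_letters mult_single_list)

section \<open>The free algebra as a ring and the tensor algebra as its quotient\<close>

lemma free_algebra_simps [simp]:
  "carrier (free_algebra :: ('v list \<Rightarrow>\<^sub>0 'k::field) ring) = UNIV"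
  "p \<otimes>\<^bsub>free_algebra\<^esub> q = p * q"
  "p \<oplus>\<^bsub>free_algebra\<^esub> q = p + q"
  "\<zero>\<^bsub>free_algebra\<^esub> = (0 :: 'v list \<Rightarrow>\<^sub>0 'k::field)"
  "\<one>\<^bsub>free_algebra\<^esub> = (1 :: 'v list \<Rightarrow>\<^sub>0 'k::field)"
  by (simp_all add: free_algebra_def)

lemma ring_free_algebra: "ring (free_algebra :: ('v list \<Rightarrow>\<^sub>0 'k::field) ring)"
proof (rule ringI)
  show "abelian_group (free_algebra :: ('v list \<Rightarrow>\<^sub>0 'k::field) ring)"
  proof (rule abelian_groupI)
    fix x :: "'v list \<Rightarrow>\<^sub>0 'k"
    show "\<exists>y\<in>carrier free_algebra. y \<oplus>\<^bsub>free_algebra\<^esub> x = \<zero>\<^bsub>free_algebra\<^esub>"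
      by (rule bexI[of _ "- x"]) auto
  qed (auto simp: algebra_simps)
  show "Group.monoid (free_algebra :: ('v list \<Rightarrow>\<^sub>0 'k::field) ring)"
    by (rule monoidI) (auto simp: algebra_simps)
qed (auto simp: algebra_simps)

lemma free_algebra_uminus [simp]:
  "\<ominus>\<^bsub>free_algebra\<^esub> p = - (p :: 'v list \<Rightarrow>\<^sub>0 'k::field)"
proof -
  interpret ring "free_algebra :: ('v list \<Rightarrow>\<^sub>0 'k::field) ring" by (rule ring_free_algebra)
  show ?thesis by (rule minus_equality) auto
qed

lemma free_algebra_minus [simp]:
  "p \<ominus>\<^bsub>free_algebra\<^esub> q = p - (q :: 'v list \<Rightarrow>\<^sub>0 'k::field)"
  by (simp add: a_minus_def)

lemma ideal_tensor_ideal: "ideal (tensor_ideal s) free_algebra"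
  unfolding tensor_ideal_def
  by (rule ring.genideal_ideal[OF ring_free_algebra]) simp

lemma ring_tensor_algebra: "ring (tensor_algebra s)"
  unfolding tensor_algebra_def by (rule ideal.quotient_is_ring[OF ideal_tensor_ideal])

lemma tensor_class_hom: "tensor_class s \<in> ring_hom free_algebra (tensor_algebra s)"
  unfolding tensor_algebra_def tensor_class_def[abs_def] by (rule ideal.rcos_ring_hom[OF ideal_tensor_ideal])

lemma carrier_tensor_algebra: "carrier (tensor_algebra s) = range (tensor_class s)"
  unfolding tensor_algebra_def tensor_class_def[abs_def] FactRing_def A_RCOSETS_def RCOSETS_def
  by (auto simp: a_r_coset_def)

lemma tensor_class_in_carrier [simp, intro]: "tensor_class s p \<in> carrier (tensor_algebra s)"
  by (simp add: carrier_tensor_algebra)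

lemma tensor_class_add: "tensor_class s (p + q) = tensor_class s p \<oplus>\<^bsub>tensor_algebra s\<^esub> tensor_class s q"
  using ring_hom_add[OF tensor_class_hom, of p q s] by simp

lemma tensor_class_mult: "tensor_class s (p * q) = tensor_class s p \<otimes>\<^bsub>tensor_algebra s\<^esub> tensor_class s q"
  using ring_hom_mult[OF tensor_class_hom, of p q s] by simp

lemma tensor_class_zero: "tensor_class s 0 = \<zero>\<^bsub>tensor_algebra s\<^esub>"
  using ring_hom_zero[OF tensor_class_hom ring_free_algebra ring_tensor_algebra, of s] by simp

lemma tensor_class_eq_iff: "tensor_class s p = tensor_class s q \<longleftrightarrow> p - q \<in> tensor_ideal s"
proof -
  interpret ideal "tensor_ideal s" free_algebra by (rule ideal_tensor_ideal)
  have "tensor_class s p = tensor_class s q \<longleftrightarrow> p \<in> tensor_ideal s +>\<^bsub>free_algebra\<^esub> q"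
    unfolding tensor_class_def
    by (metis UNIV_I a_repr_independence' a_rcos_self free_algebra_simps(1))
  also have "\<dots> \<longleftrightarrow> p - q \<in> tensor_ideal s"
    using a_rcos_module_minus[OF ring_free_algebra, of q p] by simp
  finally show ?thesis .
qed

section \<open>Coordinates on the tensor algebra of a plane\<close>

text \<open>
  A vector space with a fixed ordered basis. Words over \<^typ>\<open>bool\<close> index the monomials in the basis:
  \<^const>\<open>False\<close> stands for \<open>x1\<close> and \<^const>\<open>True\<close> for \<open>x2\<close>.
\<close>

locale planar = vector_space s
  for s :: "'k::field \<Rightarrow> 'v::ab_group_add \<Rightarrow> 'v" +
  fixes x1 x2 :: 'v
  assumes basis: "basis_pair s x1 x2"
begin

abbreviation "T \<equiv> tensor_algebra s"

definition vec :: "bool \<Rightarrow> 'v" where "vec i = (if i then x2 else x1)"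

definition coord :: "bool \<Rightarrow> 'v \<Rightarrow> 'k" where
  "coord i v = representation {x1, x2} v (vec i)"

lemma vec_simps [simp]: "vec False = x1" "vec True = x2"
  by (simp_all add: vec_def)

lemma basis_independent: "independent {x1, x2}" and basis_span: "span {x1, x2} = UNIV"
  and basis_neq: "x1 \<noteq> x2"
  using basis by (simp_all add: basis_pair_def)

lemma coord_add: "coord i (v + w) = coord i v + coord i w"
  unfolding coord_def using basis_independent basis_span by (simp add: representation_add)

lemma coord_scale: "coord i (s a v) = a * coord i v"
  unfolding coord_def using basis_independent basis_span by (simp add: representation_scale)

lemma coord_vec: "coord i (vec j) = (if i = j then 1 else 0)"
  unfolding coord_def using basis_independent basis_neq
  by (auto simp: representation_basis vec_def)

lemma coord_expand: "v = s (coord False v) x1 + s (coord True v) x2"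
proof -
  have "(\<Sum>b\<in>{x1, x2}. s (representation {x1, x2} v b) b) = v"
    using basis_independent basis_span by (intro sum_representation_eq) auto
  then show ?thesis using basis_neq by (simp add: coord_def)
qed

lemma coord_eqI: "coord False v = coord False w \<Longrightarrow> coord True v = coord True w \<Longrightarrow> v = w"
  by (metis coord_expand)

lemma coord_x [simp]: "coord False x1 = 1" "coord True x1 = 0" "coord False x2 = 0" "coord True x2 = 1"
  using coord_vec[of _ False] coord_vec[of _ True] by auto

lemma coord_zero [simp]: "coord i 0 = 0"
  using coord_add[of i 0 0] by (metis add.right_neutral add_left_cancel)

lemma coord_minus: "coord i (- v) = - coord i v"
  using coord_add[of i v "- v"] by (simp add: eq_neg_iff_add_eq_0 add.commute)

text \<open>A linear form in the two basis letters. Substituting it for the letter \<open>v\<close>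
  imposes precisely the linearity relations.\<close>

definition vpoly :: "'v \<Rightarrow> bool list \<Rightarrow>\<^sub>0 'k" where
  "vpoly v = Poly_Mapping.single [False] (coord False v) + Poly_Mapping.single [True] (coord True v)"

definition to_words :: "('v list \<Rightarrow>\<^sub>0 'k) \<Rightarrow> (bool list \<Rightarrow>\<^sub>0 'k)" where
  "to_words = word_subst vpoly"

definition from_words :: "(bool list \<Rightarrow>\<^sub>0 'k) \<Rightarrow> ('v list \<Rightarrow>\<^sub>0 'k)" where
  "from_words = word_subst (\<lambda>i. Poly_Mapping.single [vec i] 1)"

lemma vpoly_vec: "vpoly (vec i) = Poly_Mapping.single [i] 1"
  by (cases i) (simp_all add: vpoly_def)

lemma vpoly_add: "vpoly (v + w) = vpoly v + vpoly w"
  by (simp add: vpoly_def coord_add single_add)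

lemma vpoly_scale: "vpoly (s a v) = scal a * vpoly v"
  by (simp add: vpoly_def coord_scale distrib_left mult_single_list)

lemma to_words_from_words: "to_words (from_words g) = g"
proof -
  have "to_words (from_words g) = word_subst (\<lambda>i. Poly_Mapping.single [i] 1) g"
    unfolding to_words_def from_words_def word_subst_word_subst
    by (simp add: word_subst_single vpoly_vec single_Nil_one)
  then show ?thesis by (simp add: word_subst_letters)
qed

lemma to_words_single: "to_words (Poly_Mapping.single [v] 1) = vpoly v"
  by (simp add: to_words_def word_subst_single single_Nil_one)

text \<open>Half of the identification of the tensor ideal with a kernel: once the linearity
  relations lie in this ideal, so does everything they generate.\<close>

lemma ideal_ker_to_words: "ideal {p. to_words p = 0} free_algebra"
proof (rule idealI[OF ring_free_algebra])
  show "subgroup {p. to_words p = 0} (add_monoid free_algebra)"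
  proof (rule group.subgroupI)
    show "Group.group (add_monoid (free_algebra :: ('v list \<Rightarrow>\<^sub>0 'k) ring))"
      by (rule abelian_group.a_group[OF ring.is_abelian_group[OF ring_free_algebra]])
    show "inv\<^bsub>add_monoid free_algebra\<^esub> p \<in> {p. to_words p = 0}" if "p \<in> {p. to_words p = 0}" for p
      using that word_subst_minus[of vpoly 0 p] free_algebra_uminus[of p]
      by (simp add: to_words_def a_inv_def)
  qed (auto simp: to_words_def word_subst_add intro!: exI[of _ 0])
qed (auto simp: to_words_def word_subst_mult)

lemma linearity_relations_vanish: "linearity_relations s \<subseteq> {p. to_words p = 0}"
proof -
  have "to_words (Poly_Mapping.single [s a v] 1 - Poly_Mapping.single [v] a) = 0" for a v
    unfolding to_words_def word_subst_minus word_subst_single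
    by (simp add: vpoly_scale single_Nil_one)
  moreover have "to_words (Poly_Mapping.single [v + w] 1 - Poly_Mapping.single [v] 1 - Poly_Mapping.single [w] 1) = 0" for v w
    unfolding to_words_def word_subst_minus word_subst_single
    by (simp add: vpoly_add single_Nil_one)
  ultimately show ?thesis
    unfolding linearity_relations_def by auto
qed

lemma tensor_ideal_vanish: "p \<in> tensor_ideal s \<Longrightarrow> to_words p = 0"
  using ring.genideal_minimal[OF ring_free_algebra ideal_ker_to_words linearity_relations_vanish]
  by (auto simp: tensor_ideal_def)

lemma linearity_relations_mem: "linearity_relations s \<subseteq> tensor_ideal s"
  unfolding tensor_ideal_def by (rule ring.genideal_self[OF ring_free_algebra]) simp

lemma class_add_vec:
  "tensor_class s (Poly_Mapping.single [v + w] 1) = tensor_class s (Poly_Mapping.single [v] 1 + Poly_Mapping.single [w] 1)"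
  unfolding tensor_class_eq_iff
  by (rule subsetD[OF linearity_relations_mem])
     (force simp: linearity_relations_def diff_diff_eq)

lemma class_scale_vec:
  "tensor_class s (Poly_Mapping.single [s a v] 1) = tensor_class s (Poly_Mapping.single [v] a)"
  unfolding tensor_class_eq_iff
  by (rule subsetD[OF linearity_relations_mem]) (force simp: linearity_relations_def)

lemma class_vpoly: "tensor_class s (from_words (vpoly v)) = tensor_class s (Poly_Mapping.single [v] 1)"
proof -
  have "tensor_class s (Poly_Mapping.single [v] 1)
      = tensor_class s (Poly_Mapping.single [s (coord False v) x1 + s (coord True v) x2] 1)"
    by (metis coord_expand)
  also have "\<dots> = tensor_class s (Poly_Mapping.single [x1] (coord False v) + Poly_Mapping.single [x2] (coord True v))"
    by (simp add: class_add_vec class_scale_vec tensor_class_add)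
  also have "\<dots> = tensor_class s (from_words (vpoly v))"
    by (simp add: from_words_def vpoly_def word_subst_add word_subst_single mult_single_list)
  finally show ?thesis by simp
qed

text \<open>The other half of the identification. Both sides are multiplicative, so it is enough to
  compare them on single letters, where \<open>class_vpoly\<close> applies. A polynomial killed by
  \<open>to_words\<close> therefore has class zero.\<close>

lemma class_from_to_words: "tensor_class s (from_words (to_words p)) = tensor_class s p"
proof (induction p rule: poly_mapping_induct_single)
  case 1
  then show ?case by (simp add: to_words_def from_words_def)
next
  case (2 u a p)
  have "tensor_class s (from_words (prod_list (map vpoly u))) = tensor_class s (Poly_Mapping.single u 1)" for u
  proof (induction u)
    case Nil
    have "from_words (scal 1) = scal 1"
      unfolding from_words_def word_subst_single by simp
    then show ?case by (simp add: single_Nil_one)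
  next
    case (Cons v u)
    have "tensor_class s (from_words (prod_list (map vpoly (v # u))))
        = tensor_class s (from_words (vpoly v)) \<otimes>\<^bsub>T\<^esub> tensor_class s (from_words (prod_list (map vpoly u)))"
      by (simp add: from_words_def word_subst_mult tensor_class_mult)
    also have "\<dots> = tensor_class s (Poly_Mapping.single [v] 1 * Poly_Mapping.single u 1)"
      by (simp add: class_vpoly Cons tensor_class_mult)
    finally show ?case by (simp add: mult_single_list)
  qed
  then have "tensor_class s (from_words (to_words (Poly_Mapping.single u a))) = tensor_class s (Poly_Mapping.single u a)"
    unfolding to_words_def word_subst_single from_words_def word_subst_mult
    by (simp add: word_subst_single tensor_class_mult)
       (simp add: mult_single_list flip: tensor_class_mult)
  then show ?case using 2
    by (simp add: to_words_def from_words_def word_subst_add tensor_class_add)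
qed

lemma tensor_ideal_iff: "p \<in> tensor_ideal s \<longleftrightarrow> to_words p = 0"
proof
  assume "to_words p = 0"
  then have "tensor_class s p = tensor_class s 0"
    using class_from_to_words[of p] by (simp add: from_words_def)
  then show "p \<in> tensor_ideal s" by (simp add: tensor_class_eq_iff)
qed (rule tensor_ideal_vanish)

lemma class_eq_iff: "tensor_class s p = tensor_class s q \<longleftrightarrow> to_words p = to_words q"
  by (simp add: tensor_class_eq_iff tensor_ideal_iff to_words_def word_subst_minus)

text \<open>The chosen representative does not matter, since congruent polynomials have the same
  image under \<open>to_words\<close>. On the carrier of the tensor algebra this is the inverse of
  \<open>of_words\<close>, and it turns identities of tensors into identities of
  polynomials.\<close>

definition words :: "('v, 'k) tensor \<Rightarrow> bool list \<Rightarrow>\<^sub>0 'k" where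
  "words z = to_words (SOME p. z = tensor_class s p)"

definition of_words :: "(bool list \<Rightarrow>\<^sub>0 'k) \<Rightarrow> ('v, 'k) tensor" where
  "of_words g = tensor_class s (from_words g)"

lemma words_class [simp]: "words (tensor_class s p) = to_words p"
proof -
  have "tensor_class s p = tensor_class s (SOME q. tensor_class s p = tensor_class s q)"
    by (rule someI[of "\<lambda>q. tensor_class s p = tensor_class s q" p]) simp
  then show ?thesis unfolding words_def by (metis class_eq_iff)
qed

lemma words_of_words [simp]: "words (of_words g) = g"
  by (simp add: of_words_def to_words_from_words)

lemma of_words_closed [simp, intro]: "of_words g \<in> carrier T"
  by (simp add: of_words_def)

lemma of_words_words [simp]: "z \<in> carrier T \<Longrightarrow> of_words (words z) = z"
  by (auto simp: carrier_tensor_algebra of_words_def class_from_to_words)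

lemma words_inj: "z \<in> carrier T \<Longrightarrow> z' \<in> carrier T \<Longrightarrow> words z = words z' \<Longrightarrow> z = z'"
  by (metis of_words_words)

lemma words_add [simp]: "z \<in> carrier T \<Longrightarrow> z' \<in> carrier T \<Longrightarrow> words (z \<oplus>\<^bsub>T\<^esub> z') = words z + words z'"
  by (auto simp: carrier_tensor_algebra to_words_def word_subst_add simp flip: tensor_class_add)

lemma words_mult [simp]: "z \<in> carrier T \<Longrightarrow> z' \<in> carrier T \<Longrightarrow> words (z \<otimes>\<^bsub>T\<^esub> z') = words z * words z'"
  by (auto simp: carrier_tensor_algebra to_words_def word_subst_mult simp flip: tensor_class_mult)

lemma words_zero [simp]: "words \<zero>\<^bsub>T\<^esub> = 0"
  by (simp add: to_words_def flip: tensor_class_zero)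

sublocale T: ring T by (rule ring_tensor_algebra)

lemma words_uminus [simp]: "z \<in> carrier T \<Longrightarrow> words (\<ominus>\<^bsub>T\<^esub> z) = - words z"
  by (metis T.a_inv_closed T.r_neg add_eq_0_iff words_add words_zero)

lemma words_minus [simp]: "z \<in> carrier T \<Longrightarrow> z' \<in> carrier T \<Longrightarrow> words (z \<ominus>\<^bsub>T\<^esub> z') = words z - words z'"
  by (simp add: a_minus_def)

lemma tvec_closed [simp, intro]: "tvec s v \<in> carrier T"
  by (simp add: tvec_def)

lemma words_tvec [simp]: "words (tvec s v) = vpoly v"
  by (simp add: tvec_def to_words_single)

lemma tscale_closed [simp, intro]: "z \<in> carrier T \<Longrightarrow> tscale s a z \<in> carrier T"
  by (simp add: tscale_def)

lemma words_tscale [simp]: "z \<in> carrier T \<Longrightarrow> words (tscale s a z) = scal a * words z"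
  by (simp add: tscale_def) (simp add: to_words_def word_subst_single)

lemma words_finsum:
  "finite A \<Longrightarrow> (\<And>i. i \<in> A \<Longrightarrow> f i \<in> carrier T) \<Longrightarrow> words (finsum T f A) = (\<Sum>i\<in>A. words (f i))"
  by (induction A rule: finite_induct) (auto simp: Pi_def)

section \<open>The grading by word length\<close>

definition homog :: "nat \<Rightarrow> (bool list \<Rightarrow>\<^sub>0 'k) \<Rightarrow> bool" where
  "homog n g \<longleftrightarrow> (\<forall>w. length w \<noteq> n \<longrightarrow> Poly_Mapping.lookup g w = 0)"

lemma homog_zero [simp]: "homog n 0" by (simp add: homog_def)
lemma homog_add: "homog n g \<Longrightarrow> homog n h \<Longrightarrow> homog n (g + h)" by (simp add: homog_def lookup_add)
lemma homog_minus: "homog n g \<Longrightarrow> homog n h \<Longrightarrow> homog n (g - h)" by (simp add: homog_def lookup_minus)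
lemma homog_uminus: "homog n g \<Longrightarrow> homog n (- g)" by (simp add: homog_def)
lemma homog_scal: "homog n g \<Longrightarrow> homog n (scal a * g)" by (simp add: homog_def)
lemma homog_single: "length w = n \<Longrightarrow> homog n (Poly_Mapping.single w a)"
  by (auto simp: homog_def lookup_single when_def)
lemma homog_sum: "(\<And>i. i \<in> A \<Longrightarrow> homog n (f i)) \<Longrightarrow> homog n (sum f A)"
  by (auto simp: homog_def lookup_sum)

lemma homog_mult:
  assumes "homog m g" "homog n h"
  shows "homog (m + n) (g * h)"
proof -
  have "length w = m + n" if w: "w \<in> Poly_Mapping.keys (g * h)" for w
  proof -
    obtain u v where "u \<in> Poly_Mapping.keys g" "v \<in> Poly_Mapping.keys h" "w = u + v"
      using subsetD[OF keys_mult w] by auto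
    then show ?thesis using assms by (auto simp: homog_def in_keys_iff plus_list_def)
  qed
  then show ?thesis by (auto simp: homog_def in_keys_iff)
qed

lemma homog_vpoly: "homog 1 (vpoly v)"
  by (simp add: vpoly_def homog_add homog_single)

lemma homog_prod_vpoly: "homog (length u) (prod_list (map vpoly u))"
proof (induction u)
  case Nil
  show ?case by (simp add: homog_single flip: single_Nil_one)
next
  case (Cons v u)
  then show ?case using homog_mult[OF homog_vpoly[of v], of "length u"] by simp
qed

text \<open>Forward, each \<open>vpoly v\<close> is homogeneous of degree one, so the substitution
  preserves degree. Backward, the representative \<open>from_words (words z)\<close> only contains
  words of the lengths occurring in \<open>words z\<close>.\<close>

lemma mem_tensor_power_iff: "z \<in> tensor_power s n \<longleftrightarrow> z \<in> carrier T \<and> homog n (words z)"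
proof
  assume "z \<in> tensor_power s n"
  then obtain p where p: "z = tensor_class s p" "\<forall>w\<in>Poly_Mapping.keys p. length w = n"
    by (auto simp: tensor_power_def)
  have "homog n (to_words p)"
    unfolding to_words_def word_subst_def
    using p(2) homog_prod_vpoly by (intro homog_sum homog_scal) auto
  then show "z \<in> carrier T \<and> homog n (words z)" using p by simp
next
  assume z: "z \<in> carrier T \<and> homog n (words z)"
  define p where "p = from_words (words z)"
  have "p = (\<Sum>u\<in>Poly_Mapping.keys (words z). Poly_Mapping.single (map vec u) (Poly_Mapping.lookup (words z) u))"
  proof -
    have "prod_list (map (\<lambda>i. Poly_Mapping.single [vec i] 1) u) = Poly_Mapping.single (map vec u) (1::'k)" for u
      by (induction u) (simp_all add: mult_single_list single_Nil_one)
    then show ?thesis by (simp add: p_def from_words_def word_subst_def mult_single_list)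
  qed
  then have "Poly_Mapping.keys p \<subseteq> (\<Union>u\<in>Poly_Mapping.keys (words z). {map vec u})"
    by (auto dest!: subsetD[OF keys_sum] split: if_splits)
  then have "\<forall>w\<in>Poly_Mapping.keys p. length w = n"
    using z by (force simp: homog_def in_keys_iff)
  moreover have "z = tensor_class s p"
    using z by (metis of_words_def of_words_words p_def)
  ultimately show "z \<in> tensor_power s n" by (auto simp: tensor_power_def)
qed

end

section \<open>Tensor products of linear maps\<close>

abbreviation words_of_length :: "nat \<Rightarrow> bool list set" where
  "words_of_length n \<equiv> {w. length w = n}"

lemma finite_words_of_length [simp]: "finite (words_of_length n)"
  using finite_lists_length_eq[of "UNIV :: bool set" n] by simp

lemma words_of_length_Suc: "words_of_length (Suc n) = (#) False ` words_of_length n \<union> (#) True ` words_of_length n"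
proof (intro equalityI subsetI)
  fix w assume "w \<in> words_of_length (Suc n)"
  then show "w \<in> (#) False ` words_of_length n \<union> (#) True ` words_of_length n"
    by (cases w; cases "hd w") auto
qed auto

lemma sum_words_Suc: "sum f (words_of_length (Suc n)) =
    (\<Sum>w\<in>words_of_length n. f (False # w)) + (\<Sum>w\<in>words_of_length n. f (True # w))"
proof -
  have "sum f (words_of_length (Suc n)) =
     sum f ((#) False ` words_of_length n) + sum f ((#) True ` words_of_length n)"
    unfolding words_of_length_Suc by (rule sum.union_disjoint) auto
  then show ?thesis by (simp add: sum.reindex)
qed

lemma sum_words_0: "sum f (words_of_length 0) = f []"
  by simp

text \<open>Cutting a word after \<open>m\<close> letters is a bijection onto pairs of words; this
  separates the two factors of a tensor product of maps.\<close>

lemma sum_words_split: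
  "(\<Sum>w\<in>words_of_length (m + n). f (take m w) (drop m w)) =
   (\<Sum>u\<in>words_of_length m. \<Sum>v\<in>words_of_length n. f u v)"
proof -
  have "bij_betw (\<lambda>(u, v). u @ v) (words_of_length m \<times> words_of_length n) (words_of_length (m + n))"
    by (rule bij_betw_byWitness[where f' = "\<lambda>w. (take m w, drop m w)"]) auto
  then have "(\<Sum>w\<in>words_of_length (m + n). f (take m w) (drop m w)) =
     (\<Sum>p\<in>words_of_length m \<times> words_of_length n. (\<lambda>w. f (take m w) (drop m w)) ((\<lambda>(u, v). u @ v) p))"
    by (rule sum.reindex_bij_betw[symmetric])
  also have "\<dots> = (\<Sum>p\<in>words_of_length m \<times> words_of_length n. (\<lambda>(u,v). f u v) p)"
    by (rule sum.cong) auto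
  finally show ?thesis by (simp add: sum.cartesian_product)
qed

context planar
begin

definition mono :: "bool list \<Rightarrow> ('v, 'k) tensor" where
  "mono w = of_words (Poly_Mapping.single w 1)"

definition co :: "bool list \<Rightarrow> ('v, 'k) tensor \<Rightarrow> 'k" where
  "co w z = Poly_Mapping.lookup (words z) w"

lemma homog_expand:
  assumes "homog n g"
  shows "g = (\<Sum>w\<in>words_of_length n. scal (Poly_Mapping.lookup g w) * Poly_Mapping.single w 1)"
proof (rule poly_mapping_eqI)
  fix v
  show "Poly_Mapping.lookup g v =
     Poly_Mapping.lookup (\<Sum>w\<in>words_of_length n. scal (Poly_Mapping.lookup g w) * Poly_Mapping.single w 1) v"
    using assms by (simp add: lookup_sum lookup_single when_def homog_def mult_single_list del: lookup_scal_mult)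
qed

text \<open>A word of length \<open>m + n\<close> has only one factorisation into words of lengths
  \<open>m\<close> and \<open>n\<close>, so a single term of the convolution survives.\<close>

lemma lookup_mult_homog:
  assumes "homog m g" "homog n h" "length w = m + n"
  shows "Poly_Mapping.lookup (g * h) w = Poly_Mapping.lookup g (take m w) * Poly_Mapping.lookup h (drop m w)"
proof -
  let ?l = Poly_Mapping.lookup
  have "g * h = (\<Sum>u\<in>words_of_length m. scal (?l g u) * Poly_Mapping.single u 1) *
      (\<Sum>v\<in>words_of_length n. scal (?l h v) * Poly_Mapping.single v 1)"
    using assms by (intro arg_cong2[where f = "(*)"] homog_expand)
  also have "\<dots> = (\<Sum>u\<in>words_of_length m. \<Sum>v\<in>words_of_length n. Poly_Mapping.single (u @ v) (?l g u * ?l h v))"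
    by (simp add: sum_product mult_single_list)
  finally have "?l (g * h) w = (\<Sum>u\<in>words_of_length m. \<Sum>v\<in>words_of_length n. if u @ v = w then ?l g u * ?l h v else 0)"
    by (simp add: lookup_sum lookup_single when_def)
  also have "\<dots> = (\<Sum>u\<in>words_of_length m. \<Sum>v\<in>words_of_length n.
      if v = drop m w then (if u = take m w then ?l g u * ?l h v else 0) else 0)"
    by (intro sum.cong refl) auto
  also have "\<dots> = ?l g (take m w) * ?l h (drop m w)"
    using assms(3) by simp
  finally show ?thesis .
qed

lemma mono_power [simp]: "length w = n \<Longrightarrow> mono w \<in> tensor_power s n"
  by (simp add: mono_def mem_tensor_power_iff homog_single)

lemma words_mono [simp]: "words (mono w) = Poly_Mapping.single w 1"
  by (simp add: mono_def)

lemma mono_closed [simp]: "mono w \<in> carrier T"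
  by (simp add: mono_def)

lemma mono_append: "mono (u @ v) = mono u \<otimes>\<^bsub>T\<^esub> mono v"
  by (rule words_inj) (auto simp: mult_single_list)

lemma power_closed: "z \<in> tensor_power s n \<Longrightarrow> z \<in> carrier T"
  by (simp add: mem_tensor_power_iff)

lemma power_homog: "z \<in> tensor_power s n \<Longrightarrow> homog n (words z)"
  by (simp add: mem_tensor_power_iff)

lemma power_zero [simp]: "\<zero>\<^bsub>T\<^esub> \<in> tensor_power s n"
  by (simp add: mem_tensor_power_iff)

lemma power_add [simp]: "z \<in> tensor_power s n \<Longrightarrow> z' \<in> tensor_power s n \<Longrightarrow> z \<oplus>\<^bsub>T\<^esub> z' \<in> tensor_power s n"
  by (simp add: mem_tensor_power_iff homog_add)

lemma power_minus [simp]: "z \<in> tensor_power s n \<Longrightarrow> z' \<in> tensor_power s n \<Longrightarrow> z \<ominus>\<^bsub>T\<^esub> z' \<in> tensor_power s n"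
  by (simp add: mem_tensor_power_iff homog_minus)

lemma power_uminus [simp]: "z \<in> tensor_power s n \<Longrightarrow> \<ominus>\<^bsub>T\<^esub> z \<in> tensor_power s n"
  by (simp add: mem_tensor_power_iff homog_uminus)

lemma power_tscale [simp]: "z \<in> tensor_power s n \<Longrightarrow> tscale s a z \<in> tensor_power s n"
  by (simp add: mem_tensor_power_iff homog_scal)

lemma power_mult: "z \<in> tensor_power s m \<Longrightarrow> z' \<in> tensor_power s n \<Longrightarrow> z \<otimes>\<^bsub>T\<^esub> z' \<in> tensor_power s (m + n)"
  by (simp add: mem_tensor_power_iff homog_mult)

lemma tvec_power [simp]: "tvec s v \<in> tensor_power s (Suc 0)"
  using homog_vpoly[of v] by (simp add: mem_tensor_power_iff)

lemma tvec_mult_power [simp]: "tvec s v \<otimes>\<^bsub>T\<^esub> tvec s w \<in> tensor_power s 2"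
  using power_mult[OF tvec_power tvec_power, of v w] by (simp add: numeral_2_eq_2)

lemma co_simps [simp]:
  "z \<in> carrier T \<Longrightarrow> z' \<in> carrier T \<Longrightarrow> co w (z \<oplus>\<^bsub>T\<^esub> z') = co w z + co w z'"
  "z \<in> carrier T \<Longrightarrow> z' \<in> carrier T \<Longrightarrow> co w (z \<ominus>\<^bsub>T\<^esub> z') = co w z - co w z'"
  "z \<in> carrier T \<Longrightarrow> co w (\<ominus>\<^bsub>T\<^esub> z) = - co w z"
  "z \<in> carrier T \<Longrightarrow> co w (tscale s a z) = a * co w z"
  "co w \<zero>\<^bsub>T\<^esub> = 0"
  "co w (mono v) = (if v = w then 1 else 0)"
  by (simp_all add: co_def lookup_add lookup_minus lookup_single when_def)

lemma co_tvec_mult: "co [i, j] (tvec s v \<otimes>\<^bsub>T\<^esub> tvec s w) = coord i v * coord j w"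
  using lookup_mult_homog[OF homog_vpoly homog_vpoly, of "[i, j]" v w]
  by (simp add: co_def) (cases i; cases j; simp add: vpoly_def lookup_add lookup_single when_def)

lemma co_tvec: "co [i] (tvec s v) = coord i v"
  by (cases i) (simp_all add: co_def vpoly_def lookup_add lookup_single when_def)

lemma homog_eqI:
  assumes "homog n g" "homog n h" "\<And>w. length w = n \<Longrightarrow> Poly_Mapping.lookup g w = Poly_Mapping.lookup h w"
  shows "g = h"
  using assms by (intro poly_mapping_eqI) (metis homog_def)

lemma power_eqI:
  assumes "z \<in> tensor_power s n" "z' \<in> tensor_power s n" "\<And>w. length w = n \<Longrightarrow> co w z = co w z'"
  shows "z = z'"
  using assms by (intro words_inj homog_eqI[of n]) (auto simp: mem_tensor_power_iff co_def)

lemma power1_eq_tvec: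
  assumes "z \<in> tensor_power s 1"
  shows "z = tvec s (s (co [False] z) x1 + s (co [True] z) x2)"
proof (rule power_eqI[OF assms])
  fix w :: "bool list" assume "length w = 1"
  then obtain i where "w = [i]" by (auto simp: length_Suc_conv)
  then show "co w z = co w (tvec s (s (co [False] z) x1 + s (co [True] z) x2))"
    by (cases i) (simp_all add: co_tvec coord_add coord_scale)
qed simp

lemma tvec_inj: "tvec s v = tvec s w \<longleftrightarrow> v = w"
  by (metis co_tvec coord_eqI)

lemma the_inv_tvec [simp]: "the_inv (tvec s) (tvec s v) = v"
  by (rule the_inv_f_f) (auto simp: inj_def tvec_inj)

lemma tvec_add: "tvec s (v + w) = tvec s v \<oplus>\<^bsub>T\<^esub> tvec s w"
  by (rule words_inj) (auto simp: vpoly_add)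

lemma tvec_scale: "tvec s (s a v) = tscale s a (tvec s v)"
  by (rule words_inj) (auto simp: vpoly_scale)

end

text \<open>Two spaces are allowed so that the same results serve endomorphisms such as
  \<open>c\<close> tensored with the identity and also the square of an isomorphism between
  different spaces.\<close>

locale planar_pair = V: planar s x1 x2 + W: planar s' y1 y2
  for s :: "'k::field \<Rightarrow> 'v::ab_group_add \<Rightarrow> 'v" and x1 x2
  and s' :: "'k \<Rightarrow> 'w::ab_group_add \<Rightarrow> 'w" and y1 y2
begin

lemma linear_closed: "tensor_linear s s' n F \<Longrightarrow> z \<in> tensor_power s n \<Longrightarrow> F z \<in> carrier W.T"
  by (simp add: tensor_linear_def)

lemma linear_add: "tensor_linear s s' n F \<Longrightarrow> z \<in> tensor_power s n \<Longrightarrow> z' \<in> tensor_power s n \<Longrightarrow>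
    F (z \<oplus>\<^bsub>V.T\<^esub> z') = F z \<oplus>\<^bsub>W.T\<^esub> F z'"
  by (simp add: tensor_linear_def)

lemma linear_tscale: "tensor_linear s s' n F \<Longrightarrow> z \<in> tensor_power s n \<Longrightarrow>
    F (tscale s a z) = tscale s' a (F z)"
  by (simp add: tensor_linear_def)

lemma linear_zero: "tensor_linear s s' n F \<Longrightarrow> F \<zero>\<^bsub>V.T\<^esub> = \<zero>\<^bsub>W.T\<^esub>"
  using linear_add[of n F "\<zero>\<^bsub>V.T\<^esub>" "\<zero>\<^bsub>V.T\<^esub>"] linear_closed[of n F "\<zero>\<^bsub>V.T\<^esub>"]
  by (metis V.T.l_zero V.T.zero_closed V.power_zero W.T.add.r_cancel_one')

lemma linear_words:
  assumes F: "tensor_linear s s' n F" and z: "z \<in> tensor_power s n"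
  shows "W.words (F z) = (\<Sum>w\<in>words_of_length n. scal (V.co w z) * W.words (F (V.mono w)))"
proof -
  \<comment> \<open>The sum is restricted to a subset \<open>A\<close> of the words so that
    linearity can be used one monomial at a time.\<close>
  have *: "W.words (F (V.of_words (\<Sum>w\<in>A. scal (f w) * Poly_Mapping.single w 1))) =
     (\<Sum>w\<in>A. scal (f w) * W.words (F (V.mono w)))"
    if "finite A" "A \<subseteq> words_of_length n" for A f
    using that
  proof (induction A rule: finite_induct)
    case empty
    have "V.of_words 0 = \<zero>\<^bsub>V.T\<^esub>" by (rule V.words_inj) auto
    then show ?case using linear_zero[OF F] by simp
  next
    case (insert w A)
    let ?S = "\<Sum>w\<in>A. scal (f w) * Poly_Mapping.single w 1"
    have S: "V.of_words ?S \<in> tensor_power s n"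
      using insert.prems by (auto simp: V.mem_tensor_power_iff intro!: V.homog_sum V.homog_scal V.homog_single)
    have w: "V.mono w \<in> tensor_power s n" using insert.prems by simp
    have "V.of_words (\<Sum>w\<in>insert w A. scal (f w) * Poly_Mapping.single w 1) =
        tscale s (f w) (V.mono w) \<oplus>\<^bsub>V.T\<^esub> V.of_words ?S"
      using insert.hyps by (intro V.words_inj) auto
    moreover have "F \<dots> = tscale s' (f w) (F (V.mono w)) \<oplus>\<^bsub>W.T\<^esub> F (V.of_words ?S)"
      using w S by (simp add: linear_add[OF F] linear_tscale[OF F])
    ultimately show ?case
      using insert w S by (simp add: linear_closed[OF F])
  qed
  have "z = V.of_words (\<Sum>w\<in>words_of_length n. scal (V.co w z) * Poly_Mapping.single w 1)"
    using arg_cong[OF V.homog_expand[OF V.power_homog[OF z]], of V.of_words] V.power_closed[OF z]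
    unfolding V.co_def by simp
  then show ?thesis using *[of "words_of_length n" "\<lambda>w. V.co w z"] by simp
qed

text \<open>The definition of \<open>tensor_map\<close> by choice becomes usable only through
  existence. The witness \<open>H\<close> is forced on monomials: cut the word after
  \<open>m\<close> letters, apply \<open>F\<close> to the first piece and \<open>G\<close> to the
  second, and extend linearly.\<close>

lemma tensor_map_spec:
  assumes F: "tensor_linear s s' m F" and G: "tensor_linear s s' n G"
  shows "tensor_linear s s' (m + n) (tensor_map s s' m n F G)"
    and "a \<in> tensor_power s m \<Longrightarrow> b \<in> tensor_power s n \<Longrightarrow>
      tensor_map s s' m n F G (a \<otimes>\<^bsub>V.T\<^esub> b) = F a \<otimes>\<^bsub>W.T\<^esub> G b"
proof -
  define H where "H z = W.of_words (\<Sum>w\<in>words_of_length (m + n).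
     scal (V.co w z) * (W.words (F (V.mono (take m w))) * W.words (G (V.mono (drop m w)))))" for z
  have "tensor_linear s s' (m + n) H"
    unfolding tensor_linear_def
  proof (intro conjI ballI allI)
    fix z z' assume "z \<in> tensor_power s (m + n)" "z' \<in> tensor_power s (m + n)"
    then show "H (z \<oplus>\<^bsub>V.T\<^esub> z') = H z \<oplus>\<^bsub>W.T\<^esub> H z'"
      by (intro W.words_inj)
         (simp_all add: H_def V.power_closed single_add distrib_right sum.distrib)
  next
    fix a z assume "z \<in> tensor_power s (m + n)"
    moreover have "scal (a * b) * p = scal a * (scal b * p)" for b :: 'k and p :: "bool list \<Rightarrow>\<^sub>0 'k"
      by (metis mult_single_list append_Nil mult.assoc)
    ultimately show "H (tscale s a z) = tscale s' a (H z)"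
      by (intro W.words_inj)
         (simp_all add: H_def V.power_closed sum_distrib_left)
  qed (simp add: H_def)
  moreover have "H (a \<otimes>\<^bsub>V.T\<^esub> b) = F a \<otimes>\<^bsub>W.T\<^esub> G b"
    if a: "a \<in> tensor_power s m" and b: "b \<in> tensor_power s n" for a b
  proof (rule W.words_inj)
    have 1: "V.co w (a \<otimes>\<^bsub>V.T\<^esub> b) = V.co (take m w) a * V.co (drop m w) b" if "length w = m + n" for w
      using a b that by (simp add: V.co_def V.power_closed V.lookup_mult_homog[OF V.power_homog V.power_homog])
    have 2: "scal (x * y) * (p * q) = (scal x * p) * (scal y * q)" for x y :: 'k and p q :: "bool list \<Rightarrow>\<^sub>0 'k"
    proof -
      have "(scal x * p) * (scal y * q) = scal x * (p * scal y) * q" by (simp only: mult.assoc)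
      also have "\<dots> = (scal x * scal y) * (p * q)" by (simp only: mult.assoc scal_central[of y p, symmetric])
      finally show ?thesis by (simp add: mult_single_list)
    qed
    have "W.words (H (a \<otimes>\<^bsub>V.T\<^esub> b)) = (\<Sum>w\<in>words_of_length (m + n).
        (scal (V.co (take m w) a) * W.words (F (V.mono (take m w)))) *
        (scal (V.co (drop m w) b) * W.words (G (V.mono (drop m w)))))"
      by (simp add: H_def 1 2)
    also have "\<dots> = W.words (F a) * W.words (G b)"
      by (subst sum_words_split) (simp add: linear_words[OF F a] linear_words[OF G b] sum_product)
    finally show "W.words (H (a \<otimes>\<^bsub>V.T\<^esub> b)) = W.words (F a \<otimes>\<^bsub>W.T\<^esub> G b)"
      using a b by (simp add: linear_closed[OF F] linear_closed[OF G])
    show "F a \<otimes>\<^bsub>W.T\<^esub> G b \<in> carrier W.T"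
      using a b by (simp add: linear_closed[OF F] linear_closed[OF G])
  qed (simp add: H_def)
  ultimately have "\<exists>H. tensor_linear s s' (m + n) H \<and>
        (\<forall>a \<in> tensor_power s m. \<forall>b \<in> tensor_power s n.
           H (a \<otimes>\<^bsub>V.T\<^esub> b) = F a \<otimes>\<^bsub>W.T\<^esub> G b)"
    by blast
  from someI_ex[OF this]
  show "tensor_linear s s' (m + n) (tensor_map s s' m n F G)"
    and "a \<in> tensor_power s m \<Longrightarrow> b \<in> tensor_power s n \<Longrightarrow>
      tensor_map s s' m n F G (a \<otimes>\<^bsub>V.T\<^esub> b) = F a \<otimes>\<^bsub>W.T\<^esub> G b"
    unfolding tensor_map_def by blast+
qed

lemma tensor_map_words:
  assumes F: "tensor_linear s s' m F" and G: "tensor_linear s s' n G" and z: "z \<in> tensor_power s (m + n)"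
  shows "W.words (tensor_map s s' m n F G z) =
    (\<Sum>w\<in>words_of_length (m + n). scal (V.co w z) * (W.words (F (V.mono (take m w))) * W.words (G (V.mono (drop m w)))))"
proof -
  have "W.words (tensor_map s s' m n F G (V.mono w)) =
      W.words (F (V.mono (take m w))) * W.words (G (V.mono (drop m w)))"
    if "length w = m + n" for w
    using that tensor_map_spec(2)[OF F G, of "V.mono (take m w)" "V.mono (drop m w)"]
    by (simp add: linear_closed[OF F] linear_closed[OF G] flip: V.mono_append)
  then show ?thesis
    unfolding linear_words[OF tensor_map_spec(1)[OF F G] z] by simp
qed

text \<open>For maps that respect degrees, the image of each monomial is a product of homogeneous
  factors, so its coordinates are products of coordinates. All matrices of \<open>c1\<close>,
  \<open>c2\<close>, \<open>\<beta>1\<close> and \<open>\<beta>2\<close> are read off from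
  this.\<close>

lemma tensor_map_homog:
  assumes F: "tensor_linear s s' m F" "F ` tensor_power s m \<subseteq> tensor_power s' m'"
    and G: "tensor_linear s s' n G" "G ` tensor_power s n \<subseteq> tensor_power s' n'"
    and z: "z \<in> tensor_power s (m + n)"
  shows "tensor_map s s' m n F G z \<in> tensor_power s' (m' + n')"
    and "length w = m' + n' \<Longrightarrow> W.co w (tensor_map s s' m n F G z) =
     (\<Sum>v\<in>words_of_length (m + n). V.co v z * (W.co (take m' w) (F (V.mono (take m v)))
        * W.co (drop m' w) (G (V.mono (drop m v)))))"
proof -
  have h: "W.homog m' (W.words (F (V.mono (take m v))))" "W.homog n' (W.words (G (V.mono (drop m v))))"
    if "length v = m + n" for v
    using that F(2) G(2) by (auto intro!: W.power_homog simp: image_subset_iff)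
  show "tensor_map s s' m n F G z \<in> tensor_power s' (m' + n')"
    using h linear_closed[OF tensor_map_spec(1)[OF F(1) G(1)] z]
    by (auto simp: W.mem_tensor_power_iff tensor_map_words[OF F(1) G(1) z]
          intro!: W.homog_sum W.homog_scal W.homog_mult)
  show "W.co w (tensor_map s s' m n F G z) =
     (\<Sum>v\<in>words_of_length (m + n). V.co v z * (W.co (take m' w) (F (V.mono (take m v)))
        * W.co (drop m' w) (G (V.mono (drop m v)))))" if "length w = m' + n'"
    using that h unfolding W.co_def tensor_map_words[OF F(1) G(1) z] lookup_sum
    by (intro sum.cong refl) (simp add: W.lookup_mult_homog[of m' _ n'])
qed

end

section \<open>Braidings and brackets in coordinates\<close>

lemma nat_sums: "(1::nat) + 1 = 2" "(1::nat) + 2 = 3" "(2::nat) + 1 = 3"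
  by simp_all

lemma sum_words_2: "sum f (words_of_length 2) =
    f [False, False] + f [False, True] + f [True, False] + f [True, True]"
  by (simp only: numeral_2_eq_2 sum_words_Suc sum_words_0 add.assoc)

lemma sum_words_3: "sum f (words_of_length 3) =
    f [False, False, False] + f [False, False, True] + f [False, True, False] + f [False, True, True] +
    f [True, False, False] + f [True, False, True] + f [True, True, False] + f [True, True, True]"
  by (simp only: numeral_3_eq_3 sum_words_Suc sum_words_0 add.assoc)

context planar
begin

lemma power2_eq_iff:
  assumes "z \<in> tensor_power s 2" "z' \<in> tensor_power s 2"
  shows "z = z' \<longleftrightarrow> co [False, False] z = co [False, False] z' \<and> co [False, True] z = co [False, True] z'
     \<and> co [True, False] z = co [True, False] z' \<and> co [True, True] z = co [True, True] z'"
proof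
  assume *: "co [False, False] z = co [False, False] z' \<and> co [False, True] z = co [False, True] z'
     \<and> co [True, False] z = co [True, False] z' \<and> co [True, True] z = co [True, True] z'"
  show "z = z'"
  proof (rule power_eqI[OF assms])
    fix w :: "bool list" assume "length w = 2"
    then obtain i j where "w = [i, j]" by (auto simp: numeral_2_eq_2 length_Suc_conv)
    then show "co w z = co w z'" using * by (cases i; cases j) auto
  qed
qed simp

lemma power3_eq_iff:
  assumes "z \<in> tensor_power s 3" "z' \<in> tensor_power s 3"
  shows "z = z' \<longleftrightarrow> (\<forall>i j k. co [i, j, k] z = co [i, j, k] z')"
proof
  assume *: "\<forall>i j k. co [i, j, k] z = co [i, j, k] z'"
  show "z = z'"
  proof (rule power_eqI[OF assms])
    fix w :: "bool list" assume "length w = 3"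
    then obtain i j k where "w = [i, j, k]" by (auto simp: numeral_3_eq_3 length_Suc_conv)
    then show "co w z = co w z'" using * by auto
  qed
qed simp

lemma co_power_other: "z \<in> tensor_power s n \<Longrightarrow> length w \<noteq> n \<Longrightarrow> co w z = 0"
  by (auto simp: mem_tensor_power_iff homog_def co_def)

lemma power2_closed [simp]: "z \<in> tensor_power s 2 \<Longrightarrow> z \<in> carrier T"
  and power3_closed [simp]: "z \<in> tensor_power s 3 \<Longrightarrow> z \<in> carrier T"
  by (simp_all add: power_closed)

lemma pair_self: "planar_pair s x1 x2 s x1 x2"
  by unfold_locales

end

locale planar_maps = planar s x1 x2
  for s :: "'k::field \<Rightarrow> 'v::ab_group_add \<Rightarrow> 'v" and x1 x2 +
  fixes c :: "('v, 'k) tensor \<Rightarrow> ('v, 'k) tensor" and \<beta> :: "('v, 'k) tensor \<Rightarrow> 'v"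
  assumes lin_c: "linear_T2_T2 s c" and lin_\<beta>: "linear_T2_V s \<beta>"
begin

sublocale self: planar_pair s x1 x2 s x1 x2 by (rule pair_self)

definition C :: "bool \<Rightarrow> bool \<Rightarrow> bool \<Rightarrow> bool \<Rightarrow> 'k" where
  "C i j k l = co [i, j] (c (mono [k, l]))"

definition B :: "bool \<Rightarrow> bool \<Rightarrow> bool \<Rightarrow> 'k" where
  "B i k l = coord i (\<beta> (mono [k, l]))"

definition "c1 = tensor_map s s 2 1 c id"
definition "c2 = tensor_map s s 1 2 id c"
definition "\<beta>1 = tensor_map s s 2 1 (\<lambda>z. tvec s (\<beta> z)) id"
definition "\<beta>2 = tensor_map s s 1 2 id (\<lambda>z. tvec s (\<beta> z))"

lemma c_linear: "tensor_linear s s 2 c" and c_power [simp]: "z \<in> tensor_power s 2 \<Longrightarrow> c z \<in> tensor_power s 2"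
  using lin_c by (auto simp: linear_T2_T2_def)

lemma \<beta>_add: "z \<in> tensor_power s 2 \<Longrightarrow> z' \<in> tensor_power s 2 \<Longrightarrow> \<beta> (z \<oplus>\<^bsub>T\<^esub> z') = \<beta> z + \<beta> z'"
  and \<beta>_tscale: "z \<in> tensor_power s 2 \<Longrightarrow> \<beta> (tscale s a z) = s a (\<beta> z)"
  using lin_\<beta> by (auto simp: linear_T2_V_def)

lemma \<beta>_linear: "tensor_linear s s 2 (\<lambda>z. tvec s (\<beta> z))"
  unfolding tensor_linear_def by (simp add: \<beta>_add \<beta>_tscale tvec_add tvec_scale)

lemma id_linear: "tensor_linear s s n id"
  unfolding tensor_linear_def by (simp add: power_closed)

lemma co_c:
  assumes "z \<in> tensor_power s 2"
  shows "co [i, j] (c z) = co [False, False] z * C i j False False + co [False, True] z * C i j False True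
    + co [True, False] z * C i j True False + co [True, True] z * C i j True True"
proof -
  have "co [i, j] (c z) = (\<Sum>w\<in>words_of_length 2. co w z * co [i, j] (c (mono w)))"
    by (simp add: self.linear_words[OF c_linear assms] co_def[of _ "c _"] lookup_sum)
  then show ?thesis unfolding sum_words_2 C_def .
qed

lemma coord_\<beta>:
  assumes "z \<in> tensor_power s 2"
  shows "coord i (\<beta> z) = co [False, False] z * B i False False + co [False, True] z * B i False True
    + co [True, False] z * B i True False + co [True, True] z * B i True True"
proof -
  have "co [i] (tvec s (\<beta> z)) = (\<Sum>w\<in>words_of_length 2. co w z * co [i] (tvec s (\<beta> (mono w))))"
    using self.linear_words[OF \<beta>_linear assms] by (simp add: co_def[of _ "tvec _ _"] lookup_sum)
  then show ?thesis unfolding sum_words_2 B_def co_tvec .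
qed

lemma c1_power [simp]: "z \<in> tensor_power s 3 \<Longrightarrow> c1 z \<in> tensor_power s 3"
  unfolding c1_def
  using self.tensor_map_homog(1)[OF c_linear _ id_linear, of 2 1 1 z, unfolded nat_sums] by (simp add: image_subset_iff)

lemma c2_power [simp]: "z \<in> tensor_power s 3 \<Longrightarrow> c2 z \<in> tensor_power s 3"
  unfolding c2_def
  using self.tensor_map_homog(1)[OF id_linear _ c_linear, of 1 1 2 z, unfolded nat_sums] by (simp add: image_subset_iff)

lemma \<beta>1_power [simp]: "z \<in> tensor_power s 3 \<Longrightarrow> \<beta>1 z \<in> tensor_power s 2"
  unfolding \<beta>1_def
  using self.tensor_map_homog(1)[OF \<beta>_linear _ id_linear, of 1 1 1 z, unfolded nat_sums] by (simp add: image_subset_iff)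

lemma \<beta>2_power [simp]: "z \<in> tensor_power s 3 \<Longrightarrow> \<beta>2 z \<in> tensor_power s 2"
  unfolding \<beta>2_def
  using self.tensor_map_homog(1)[OF id_linear _ \<beta>_linear, of 1 1 1 z, unfolded nat_sums] by (simp add: image_subset_iff)

lemma co_c1:
  assumes "z \<in> tensor_power s 3"
  shows "co [i, j, k] (c1 z) = co [False, False, k] z * C i j False False + co [False, True, k] z * C i j False True
    + co [True, False, k] z * C i j True False + co [True, True, k] z * C i j True True"
  unfolding c1_def
  using self.tensor_map_homog(2)[OF c_linear _ id_linear, of 2 1 1 z "[i, j, k]", unfolded nat_sums] assms
  by (cases k) (simp_all add: image_subset_iff sum_words_3 C_def)

lemma co_c2:
  assumes "z \<in> tensor_power s 3"
  shows "co [i, j, k] (c2 z) = co [i, False, False] z * C j k False False + co [i, False, True] z * C j k False True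
    + co [i, True, False] z * C j k True False + co [i, True, True] z * C j k True True"
  unfolding c2_def
  using self.tensor_map_homog(2)[OF id_linear _ c_linear, of 1 1 2 z "[i, j, k]", unfolded nat_sums] assms
  by (cases i) (simp_all add: image_subset_iff sum_words_3 C_def)

lemma co_\<beta>1:
  assumes "z \<in> tensor_power s 3"
  shows "co [i, k] (\<beta>1 z) = co [False, False, k] z * B i False False + co [False, True, k] z * B i False True
    + co [True, False, k] z * B i True False + co [True, True, k] z * B i True True"
  unfolding \<beta>1_def
  using self.tensor_map_homog(2)[OF \<beta>_linear _ id_linear, of 1 1 1 z "[i, k]", unfolded nat_sums] assms
  by (cases k) (simp_all add: image_subset_iff sum_words_3 B_def co_tvec)

lemma co_\<beta>2:
  assumes "z \<in> tensor_power s 3"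
  shows "co [i, k] (\<beta>2 z) = co [i, False, False] z * B k False False + co [i, False, True] z * B k False True
    + co [i, True, False] z * B k True False + co [i, True, True] z * B k True True"
  unfolding \<beta>2_def
  using self.tensor_map_homog(2)[OF id_linear _ \<beta>_linear, of 1 1 1 z "[i, k]", unfolded nat_sums] assms
  by (cases i) (simp_all add: image_subset_iff sum_words_3 B_def co_tvec)

lemmas co_formulas = co_c1 co_c2 co_\<beta>1 co_\<beta>2 co_c coord_\<beta>

lemma lifted_QLie_algebra_iff:
  "lifted_QLie_algebra s c \<beta> \<longleftrightarrow>
     (\<forall>z \<in> tensor_power s 3. c1 (c2 (c1 z)) = c2 (c1 (c2 z))) \<and>
     (\<forall>z \<in> tensor_power s 3. c (\<beta>1 z) = \<beta>2 (c1 (c2 z))) \<and>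
     (\<forall>z \<in> tensor_power s 3. c (\<beta>2 z) = \<beta>1 (c2 (c1 z))) \<and>
     (\<forall>z \<in> tensor_power s 2. \<beta> (c z) = - \<beta> z) \<and>
     (\<forall>z \<in> tensor_power s 3.
        c1 z = \<ominus>\<^bsub>T\<^esub> z \<and> c2 z = \<ominus>\<^bsub>T\<^esub> z \<longrightarrow> \<beta> (\<beta>1 z \<ominus>\<^bsub>T\<^esub> \<beta>2 z) = 0)"
  unfolding lifted_QLie_algebra_def braided_vector_space_def Let_def c1_def c2_def \<beta>1_def \<beta>2_def
  using lin_c lin_\<beta> vector_space_axioms by auto

section \<open>Polynomials in the braiding\<close>

lemma funpow_c_power [simp]: "z \<in> tensor_power s 2 \<Longrightarrow> (c ^^ n) z \<in> tensor_power s 2"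
  by (induction n) auto

text \<open>An arbitrary bound \<open>n\<close> in place of the degree lets polynomials of different
  degrees be added termwise.\<close>

lemma words_poly_apply_superset:
  assumes "z \<in> tensor_power s 2" "degree p \<le> n"
  shows "words (poly_apply s c p z) = (\<Sum>i\<le>n. scal (coeff p i) * words ((c ^^ i) z))"
proof -
  have "words (poly_apply s c p z) = (\<Sum>i\<le>degree p. scal (coeff p i) * words ((c ^^ i) z))"
    unfolding poly_apply_def using assms by (subst words_finsum) auto
  also have "\<dots> = (\<Sum>i\<le>n. scal (coeff p i) * words ((c ^^ i) z))"
    using assms(2) by (intro sum.mono_neutral_left) (auto simp: coeff_eq_0)
  finally show ?thesis .
qed

lemma poly_apply_power [simp]: "z \<in> tensor_power s 2 \<Longrightarrow> poly_apply s c p z \<in> tensor_power s 2"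
proof -
  assume z: "z \<in> tensor_power s 2"
  have "poly_apply s c p z \<in> carrier T"
    unfolding poly_apply_def using z by (intro T.finsum_closed) auto
  moreover have "homog 2 (words (poly_apply s c p z))"
    unfolding words_poly_apply_superset[OF z order_refl]
    using z by (intro homog_sum homog_scal power_homog) simp
  ultimately show ?thesis by (simp only: mem_tensor_power_iff)
qed

lemma co_poly_apply:
  assumes "z \<in> tensor_power s 2" "degree p \<le> n"
  shows "co w (poly_apply s c p z) = (\<Sum>i\<le>n. coeff p i * co w ((c ^^ i) z))"
  by (simp add: co_def words_poly_apply_superset[OF assms] lookup_sum)

lemma co_poly_apply_0 [simp]: "z \<in> tensor_power s 2 \<Longrightarrow> co w (poly_apply s c 0 z) = 0"
  by (simp add: co_poly_apply[where n = 0])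

text \<open>Horner's scheme: with it an explicit coefficient list is evaluated at \<open>c\<close>
  by rewriting alone.\<close>

lemma co_poly_apply_pCons:
  assumes z: "z \<in> tensor_power s 2"
  shows "co w (poly_apply s c (pCons a p) z) = a * co w z + co w (poly_apply s c p (c z))"
proof -
  have "co w (poly_apply s c (pCons a p) z) = (\<Sum>i\<le>Suc (degree p). coeff (pCons a p) i * co w ((c ^^ i) z))"
    by (rule co_poly_apply[OF z]) (simp add: degree_pCons_le)
  also have "\<dots> = a * co w z + (\<Sum>i\<le>degree p. coeff p i * co w ((c ^^ i) (c z)))"
    by (subst sum.atMost_Suc_shift) (simp add: funpow_Suc_right del: funpow.simps(2))
  also have "(\<Sum>i\<le>degree p. coeff p i * co w ((c ^^ i) (c z))) = co w (poly_apply s c p (c z))"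
    using z by (simp add: co_poly_apply[OF _ order_refl])
  finally show ?thesis .
qed

lemma co_poly_apply_add:
  assumes z: "z \<in> tensor_power s 2"
  shows "co w (poly_apply s c (p + q) z) = co w (poly_apply s c p z) + co w (poly_apply s c q z)"
  using co_poly_apply[OF z, of p "max (degree p) (degree q)" w]
    co_poly_apply[OF z, of q "max (degree p) (degree q)" w]
    co_poly_apply[OF z, of "p + q" "max (degree p) (degree q)" w]
  by (simp add: degree_add_le distrib_right sum.distrib)

lemma co_poly_apply_smult:
  assumes z: "z \<in> tensor_power s 2"
  shows "co w (poly_apply s c (smult a p) z) = a * co w (poly_apply s c p z)"
  using co_poly_apply[OF z, of p "degree p" w] co_poly_apply[OF z, of "smult a p" "degree p" w]
  by (simp add: degree_smult_le sum_distrib_left mult.assoc)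

lemma c_add: "z \<in> tensor_power s 2 \<Longrightarrow> z' \<in> tensor_power s 2 \<Longrightarrow> c (z \<oplus>\<^bsub>T\<^esub> z') = c z \<oplus>\<^bsub>T\<^esub> c z'"
  by (rule self.linear_add[OF c_linear])

lemma c_tscale: "z \<in> tensor_power s 2 \<Longrightarrow> c (tscale s a z) = tscale s a (c z)"
  by (rule self.linear_tscale[OF c_linear])

lemma co_poly_apply_add_arg:
  "z \<in> tensor_power s 2 \<Longrightarrow> z' \<in> tensor_power s 2 \<Longrightarrow>
    co w (poly_apply s c p (z \<oplus>\<^bsub>T\<^esub> z')) = co w (poly_apply s c p z) + co w (poly_apply s c p z')"
  by (induction p arbitrary: z z')
     (simp_all add: co_poly_apply_pCons c_add algebra_simps)

lemma co_poly_apply_tscale_arg: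
  "z \<in> tensor_power s 2 \<Longrightarrow>
    co w (poly_apply s c p (tscale s a z)) = a * co w (poly_apply s c p z)"
  by (induction p arbitrary: z)
     (simp_all add: co_poly_apply_pCons c_tscale algebra_simps)

lemma co_poly_apply_eigen:
  assumes "z \<in> tensor_power s 2" "c z = tscale s a z"
  shows "co w (poly_apply s c p z) = poly p a * co w z"
  by (induction p) (use assms in \<open>simp_all add: co_poly_apply_pCons co_poly_apply_tscale_arg algebra_simps\<close>)

lemma annihilates_iff: "annihilates s c p \<longleftrightarrow>
    (\<forall>z\<in>tensor_power s 2. \<forall>i j. co [i, j] (poly_apply s c p z) = 0)"
proof -
  have "(\<forall>i j. co [i, j] z = 0) \<longleftrightarrow> z = \<zero>\<^bsub>T\<^esub>" if "z \<in> tensor_power s 2" for z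
    unfolding power2_eq_iff[OF that power_zero] by (metis (full_types) co_simps(5))
  then show ?thesis unfolding annihilates_def by simp
qed

lemma annihilates_root:
  assumes "annihilates s c p" "z \<in> tensor_power s 2" "c z = tscale s a z" "z \<noteq> \<zero>\<^bsub>T\<^esub>"
  shows "poly p a = 0"
proof (rule ccontr)
  assume "poly p a \<noteq> 0"
  moreover have "poly p a * co [i, j] z = 0" for i j
    using assms(1,2) co_poly_apply_eigen[OF assms(2,3), of "[i, j]" p] unfolding annihilates_iff by metis
  ultimately show False
    using assms(4) by (auto simp: power2_eq_iff[OF assms(2) power_zero])
qed

text \<open>Two monic annihilating polynomials of the same least degree have a difference that
  annihilates \<open>c\<close> and has smaller degree, so it is zero.\<close>

lemma minimal_polynomial_unique:
  assumes f: "is_minimal_polynomial s c f" and g: "is_minimal_polynomial s c g"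
  shows "f = g"
proof (rule ccontr)
  assume "f \<noteq> g"
  have f0: "f \<noteq> 0" "g \<noteq> 0" using f g by (auto simp: is_minimal_polynomial_def)
  then have deg: "degree f = degree g"
    using f g unfolding is_minimal_polynomial_def by (meson order_antisym)
  define p where p: "p = f + smult (- 1) g"
  have "annihilates s c p"
    unfolding annihilates_iff
  proof (intro ballI allI)
    fix z i j assume z: "z \<in> tensor_power s 2"
    have "co [i, j] (poly_apply s c f z) = 0" "co [i, j] (poly_apply s c g z) = 0"
      using f g z unfolding is_minimal_polynomial_def annihilates_iff by blast+
    then show "co [i, j] (poly_apply s c p z) = 0"
      unfolding p co_poly_apply_add[OF z] co_poly_apply_smult[OF z] by simp
  qed
  moreover have "p \<noteq> 0" using \<open>f \<noteq> g\<close> by (simp add: p)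
  ultimately have "degree f \<le> degree p" using f unfolding is_minimal_polynomial_def by blast
  moreover have "coeff p (degree f) = 0"
    using f g deg by (simp add: p is_minimal_polynomial_def)
  moreover have "degree p \<le> degree f"
    using deg by (auto simp: p intro!: degree_diff_le)
  ultimately show False using \<open>p \<noteq> 0\<close> by (metis leading_coeff_0_iff order_antisym)
qed

text \<open>Here y = (c + 1) z, so 0 = f(c) z = h(c) y. As y satisfies c y = - y, the right side is
  h(-1) y, and h(-1) is invertible.\<close>

lemma eigen_minus_one_semisimple:
  assumes f: "is_minimal_polynomial s c ([:1, 1:] * h)" and h: "poly h (- 1) \<noteq> 0"
    and z: "z \<in> tensor_power s 2" and y: "y = c z \<oplus>\<^bsub>T\<^esub> z" and cy: "c y = \<ominus>\<^bsub>T\<^esub> y"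
  shows "y = \<zero>\<^bsub>T\<^esub>"
proof -
  have yp: "y \<in> tensor_power s 2" using z y by simp
  have "[:1, 1:] * h = h + pCons 0 h" by simp
  then have "co [i, j] (poly_apply s c (h + pCons 0 h) z) = 0" for i j
    using f z by (auto simp: is_minimal_polynomial_def annihilates_iff)
  then have 0: "co [i, j] (poly_apply s c h y) = 0" for i j
    using z by (simp add: y co_poly_apply_add co_poly_apply_pCons co_poly_apply_add_arg algebra_simps)
  have "c y = tscale s (- 1) y"
    using cy yp by (simp add: power2_eq_iff)
  from co_poly_apply_eigen[OF yp this] 0 h show ?thesis
    by (simp add: power2_eq_iff[OF yp power_zero])
qed

end

section \<open>Normal forms\<close>

lemma all_bool_iff: "(\<forall>i::bool. P i) \<longleftrightarrow> P False \<and> P True"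
  by (metis (full_types))

definition quad ::
    "('k::field \<Rightarrow> 'v::ab_group_add \<Rightarrow> 'v) \<Rightarrow> 'v \<Rightarrow> 'v \<Rightarrow> 'k \<Rightarrow> 'k \<Rightarrow> 'k \<Rightarrow> 'k \<Rightarrow> ('v, 'k) tensor" where
  "quad s x1 x2 a b c d =
     (let T = tensor_algebra s in
      tscale s a (tvec s x1 \<otimes>\<^bsub>T\<^esub> tvec s x1) \<oplus>\<^bsub>T\<^esub>
      tscale s b (tvec s x1 \<otimes>\<^bsub>T\<^esub> tvec s x2) \<oplus>\<^bsub>T\<^esub>
      tscale s c (tvec s x2 \<otimes>\<^bsub>T\<^esub> tvec s x1) \<oplus>\<^bsub>T\<^esub>
      tscale s d (tvec s x2 \<otimes>\<^bsub>T\<^esub> tvec s x2))"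

text \<open>All eight rows are instances, so a row becomes a tuple of twelve scalars and a single
  base change formula covers every case.\<close>

definition normal_form ::
    "('k::field \<Rightarrow> 'v::ab_group_add \<Rightarrow> 'v) \<Rightarrow> (('v, 'k) tensor \<Rightarrow> ('v, 'k) tensor)
      \<Rightarrow> (('v, 'k) tensor \<Rightarrow> 'v) \<Rightarrow> 'v \<Rightarrow> 'v
      \<Rightarrow> 'k \<Rightarrow> 'k \<Rightarrow> 'k \<Rightarrow> 'k \<Rightarrow> 'k \<Rightarrow> 'k \<Rightarrow> 'k \<Rightarrow> 'k \<Rightarrow> 'k \<Rightarrow> 'k \<Rightarrow> 'k \<Rightarrow> 'k \<Rightarrow> bool" where
  "normal_form s c \<beta> x1 x2 a p q r t d11 d12 d21 m b12 b21 e \<longleftrightarrow>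
     (let T = tensor_algebra s;
          x11 = tvec s x1 \<otimes>\<^bsub>T\<^esub> tvec s x1;
          x12 = tvec s x1 \<otimes>\<^bsub>T\<^esub> tvec s x2;
          x21 = tvec s x2 \<otimes>\<^bsub>T\<^esub> tvec s x1;
          x22 = tvec s x2 \<otimes>\<^bsub>T\<^esub> tvec s x2
      in c x11 = quad s x1 x2 a 0 0 0 \<and> c x12 = quad s x1 x2 p 0 q 0 \<and>
         c x21 = quad s x1 x2 r t 0 0 \<and> c x22 = quad s x1 x2 d11 d12 d21 m \<and>
         \<beta> x11 = 0 \<and> \<beta> x12 = s b12 x1 \<and> \<beta> x21 = s b21 x1 \<and> \<beta> x22 = s e x1)"

definition row_form ::
    "row \<Rightarrow> 'k \<Rightarrow> ('k::field \<Rightarrow> 'v::ab_group_add \<Rightarrow> 'v) \<Rightarrow> (('v, 'k) tensor \<Rightarrow> ('v, 'k) tensor)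
      \<Rightarrow> (('v, 'k) tensor \<Rightarrow> 'v) \<Rightarrow> 'v \<Rightarrow> 'v \<Rightarrow> bool" where
  "row_form w \<gamma> s c \<beta> x1 x2 =
     (let N = normal_form s c \<beta> x1 x2 in
      case w of
        R1 \<Rightarrow> N 1 0 1 0 1 0 0 0 1 (- 1) 1 0
      | R2 \<Rightarrow> N 1 (- 1) 1 1 1 0 0 0 1 (- 1) 1 0
      | R3 \<Rightarrow> N (- 1) 0 1 0 1 \<gamma> 0 0 1 (- 1) 1 0
      | R4 \<Rightarrow> N 1 0 1 0 1 \<gamma> 0 0 (- 1) 0 0 1
      | R5 \<Rightarrow> N 0 0 1 1 1 0 0 0 1 (- 1) 1 0
      | R6 \<Rightarrow> N 0 0 \<gamma> 0 (inverse \<gamma>) 0 0 0 1 (- \<gamma>) 1 0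
      | R7 \<Rightarrow> N \<gamma> 0 1 0 1 0 0 0 1 (- 1) 1 0
      | R8 \<Rightarrow> N 1 0 1 0 1 \<gamma> 0 0 1 (- 1) 1 0)"

context planar
begin

lemma quad_power [simp]: "quad s v w a b c d \<in> tensor_power s 2"
  by (simp add: quad_def Let_def)

lemma co_quad: "co [i, j] (quad s v w a b c d) =
    a * (coord i v * coord j v) + b * (coord i v * coord j w) + c * (coord i w * coord j v) + d * (coord i w * coord j w)"
  by (simp add: quad_def Let_def co_tvec_mult)

lemma vector_eq_iff: "v = w \<longleftrightarrow> coord False v = coord False w \<and> coord True v = coord True w"
  using coord_eqI by blast

lemma mono_tvec: "mono [i, j] = tvec s (vec i) \<otimes>\<^bsub>T\<^esub> tvec s (vec j)"
  by (simp add: power2_eq_iff co_tvec_mult coord_vec)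

end

context planar_maps
begin

lemma normal_form_iff:
  "normal_form s c \<beta> x1 x2 a p q r t d11 d12 d21 m b12 b21 e \<longleftrightarrow>
    C False False False False = a \<and> C False True False False = 0 \<and> C True False False False = 0 \<and> C True True False False = 0 \<and>
    C False False False True = p \<and> C False True False True = 0 \<and> C True False False True = q \<and> C True True False True = 0 \<and>
    C False False True False = r \<and> C False True True False = t \<and> C True False True False = 0 \<and> C True True True False = 0 \<and>
    C False False True True = d11 \<and> C False True True True = d12 \<and> C True False True True = d21 \<and> C True True True True = m \<and>
    B False False False = 0 \<and> B True False False = 0 \<and> B False False True = b12 \<and> B True False True = 0 \<and>
    B False True False = b21 \<and> B True True False = 0 \<and> B False True True = e \<and> B True True True = 0"
  unfolding normal_form_def Let_def C_def B_def mono_tvec vec_simps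
  by (simp add: power2_eq_iff co_quad vector_eq_iff coord_scale conj_assoc)

lemma normal_form_coeffs:
  assumes "normal_form s c \<beta> x1 x2 a p q r t d11 d12 d21 m b12 b21 e"
  shows "C False False False False = a" "C False True False False = 0" "C True False False False = 0" "C True True False False = 0"
    "C False False False True = p" "C False True False True = 0" "C True False False True = q" "C True True False True = 0"
    "C False False True False = r" "C False True True False = t" "C True False True False = 0" "C True True True False = 0"
    "C False False True True = d11" "C False True True True = d12" "C True False True True = d21" "C True True True True = m"
    "B False False False = 0" "B True False False = 0" "B False False True = b12" "B True False True = 0"
    "B False True False = b21" "B True True False = 0" "B False True True = e" "B True True True = 0"
  using assms unfolding normal_form_iff by auto

lemma row_form_iff:
  "row_braiding w \<gamma> s x1 x2 c \<and> row_bracket w \<gamma> s x1 x2 \<beta> \<longleftrightarrow> row_form w \<gamma> s c \<beta> x1 x2"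
  unfolding row_form_def row_braiding_def row_bracket_def Let_def normal_form_def
  by (cases w) (simp_all add: power2_eq_iff co_quad vector_eq_iff coord_scale co_tvec_mult coord_minus conj_ac)

text \<open>Expand \<open>c\<close> and \<beta> on the new basis vectors and compare coefficients.
  The values \<open>d12'\<close> and \<open>d21'\<close> come first because the new x12 and x21 each
  contain \<kappa> \<nu> x11, which has to be subtracted in \<open>d11'\<close>.\<close>

lemma normal_form_change_basis:
  assumes "normal_form s c \<beta> x1 x2 a p q r t d11 d12 d21 m b12 b21 e"
    and "\<kappa> \<noteq> 0" "\<mu> \<noteq> 0"
    and "d12' = (\<mu> * d12 + \<nu> * (t - m)) / \<kappa>" "d21' = (\<mu> * d21 + \<nu> * (q - m)) / \<kappa>"
    and "d11' = (\<mu>\<^sup>2 * d11 + \<mu> * \<nu> * (p + r) + \<nu>\<^sup>2 * (a - m) - \<kappa> * \<nu> * (d12' + d21')) / \<kappa>\<^sup>2"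
    and "p' = (\<mu> * p + \<nu> * (a - q)) / \<kappa>" "r' = (\<mu> * r + \<nu> * (a - t)) / \<kappa>"
    and "b12' = \<mu> * b12" "b21' = \<mu> * b21" "e' = (\<mu>\<^sup>2 * e + \<mu> * \<nu> * (b12 + b21)) / \<kappa>"
  shows "normal_form s c \<beta> (s \<kappa> x1) (s \<mu> x2 + s \<nu> x1) a p' q r' t d11' d12' d21' m b12' b21' e'"
proof -
  note nf = assms(1)[unfolded normal_form_iff]
  have "co [i, j] (c (tvec s v \<otimes>\<^bsub>T\<^esub> tvec s w)) =
     coord False v * coord False w * C i j False False + coord False v * coord True w * C i j False True
    + coord True v * coord False w * C i j True False + coord True v * coord True w * C i j True True" for i j v w
    by (simp add: co_c co_tvec_mult)
  moreover have "coord i (\<beta> (tvec s v \<otimes>\<^bsub>T\<^esub> tvec s w)) =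
     coord False v * coord False w * B i False False + coord False v * coord True w * B i False True
    + coord True v * coord False w * B i True False + coord True v * coord True w * B i True True" for i v w
    by (simp add: coord_\<beta> co_tvec_mult)
  ultimately show ?thesis
    unfolding normal_form_def Let_def
    using assms(2-)
    by (simp add: power2_eq_iff co_quad vector_eq_iff coord_scale coord_add nf)
       (simp add: field_simps power2_eq_square)
qed

text \<open>
  Since \<open>\<beta>\<close> vanishes on \<open>x1 \<otimes> x1\<close> in every normal form, only two coordinates of the eigenvector equations
  \<open>c\<^sub>1 z = - z = c\<^sub>2 z\<close> enter the last axiom.
\<close>

lemma lifted_QLie_algebraI:
  assumes "\<And>z i j k. z \<in> tensor_power s 3 \<Longrightarrow> co [i, j, k] (c1 (c2 (c1 z))) = co [i, j, k] (c2 (c1 (c2 z)))"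
    and "\<And>z i j. z \<in> tensor_power s 3 \<Longrightarrow> co [i, j] (c (\<beta>1 z)) = co [i, j] (\<beta>2 (c1 (c2 z)))"
    and "\<And>z i j. z \<in> tensor_power s 3 \<Longrightarrow> co [i, j] (c (\<beta>2 z)) = co [i, j] (\<beta>1 (c2 (c1 z)))"
    and "\<And>z i. z \<in> tensor_power s 2 \<Longrightarrow> coord i (\<beta> (c z)) = - coord i (\<beta> z)"
    and "\<And>z i. z \<in> tensor_power s 3 \<Longrightarrow>
      co [False, True, True] (c1 z) = - co [False, True, True] z \<Longrightarrow>
      co [True, True, False] (c2 z) = - co [True, True, False] z \<Longrightarrow> coord i (\<beta> (\<beta>1 z \<ominus>\<^bsub>T\<^esub> \<beta>2 z)) = 0"
  shows "lifted_QLie_algebra s c \<beta>"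
  unfolding lifted_QLie_algebra_iff
proof (intro conjI ballI impI)
  fix z assume z: "z \<in> tensor_power s 3"
  show "c1 (c2 (c1 z)) = c2 (c1 (c2 z))" using z assms(1) by (simp add: power3_eq_iff)
  show "c (\<beta>1 z) = \<beta>2 (c1 (c2 z))" using z assms(2) by (simp add: power2_eq_iff)
  show "c (\<beta>2 z) = \<beta>1 (c2 (c1 z))" using z assms(3) by (simp add: power2_eq_iff)
  show "\<beta> (\<beta>1 z \<ominus>\<^bsub>T\<^esub> \<beta>2 z) = 0" if "c1 z = \<ominus>\<^bsub>T\<^esub> z \<and> c2 z = \<ominus>\<^bsub>T\<^esub> z"
    using z assms(5)[OF z] that by (simp add: vector_eq_iff)
next
  fix z assume z: "z \<in> tensor_power s 2"
  show "\<beta> (c z) = - \<beta> z" using z assms(4) by (simp add: vector_eq_iff coord_minus)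
qed

text \<open>All axioms but the last are finite checks on coordinates. For the last, the eigenvector
  equations express the coordinates of z at x122 and x221 as -t and -q times the one at x212. The
  value of \<beta>(\<beta>1 - \<beta>2) then cancels because t b12^2 = q b21^2 and e (b12 - b21) = 0
  in every row.\<close>

lemma row_form_lifted_QLie_algebra:
  assumes "row_form w \<gamma> s c \<beta> x1 x2" "row_parameter w \<gamma>"
  shows "lifted_QLie_algebra s c \<beta>"
proof -
  have \<gamma>: "\<gamma> \<noteq> 0" if "w = R6" using assms(2) that by (simp add: row_parameter_def)
  show ?thesis
  proof (cases w)
    case R1
    then have nf: "normal_form s c \<beta> x1 x2 1 0 1 0 1 0 0 0 1 (- 1) 1 0"
      using assms by (simp add: row_form_def Let_def)
    show ?thesis
    proof (rule lifted_QLie_algebraI)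
      fix z i j k assume "z \<in> tensor_power s 3"
      then show "co [i, j, k] (c1 (c2 (c1 z))) = co [i, j, k] (c2 (c1 (c2 z)))"
        by (cases i; cases j; cases k) (simp_all add: co_formulas normal_form_coeffs[OF nf] algebra_simps)
    next
      fix z i j assume "z \<in> tensor_power s 3"
      then show "co [i, j] (c (\<beta>1 z)) = co [i, j] (\<beta>2 (c1 (c2 z)))" "co [i, j] (c (\<beta>2 z)) = co [i, j] (\<beta>1 (c2 (c1 z)))"
        by (cases i; cases j; simp add: co_formulas normal_form_coeffs[OF nf] algebra_simps)+
    next
      fix z i assume "z \<in> tensor_power s 2"
      then show "coord i (\<beta> (c z)) = - coord i (\<beta> z)"
        by (cases i) (simp_all add: co_formulas normal_form_coeffs[OF nf] algebra_simps)
    next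
      fix z i assume "z \<in> tensor_power s 3"
        "co [False, True, True] (c1 z) = - co [False, True, True] z"
        "co [True, True, False] (c2 z) = - co [True, True, False] z"
      then show "coord i (\<beta> (\<beta>1 z \<ominus>\<^bsub>T\<^esub> \<beta>2 z)) = 0"
        by (cases i) (simp_all add: co_formulas normal_form_coeffs[OF nf] algebra_simps)
    qed
  next
    case R2
    then have nf: "normal_form s c \<beta> x1 x2 1 (- 1) 1 1 1 0 0 0 1 (- 1) 1 0"
      using assms by (simp add: row_form_def Let_def)
    show ?thesis
    proof (rule lifted_QLie_algebraI)
      fix z i j k assume "z \<in> tensor_power s 3"
      then show "co [i, j, k] (c1 (c2 (c1 z))) = co [i, j, k] (c2 (c1 (c2 z)))"
        by (cases i; cases j; cases k) (simp_all add: co_formulas normal_form_coeffs[OF nf] algebra_simps)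
    next
      fix z i j assume "z \<in> tensor_power s 3"
      then show "co [i, j] (c (\<beta>1 z)) = co [i, j] (\<beta>2 (c1 (c2 z)))" "co [i, j] (c (\<beta>2 z)) = co [i, j] (\<beta>1 (c2 (c1 z)))"
        by (cases i; cases j; simp add: co_formulas normal_form_coeffs[OF nf] algebra_simps)+
    next
      fix z i assume "z \<in> tensor_power s 2"
      then show "coord i (\<beta> (c z)) = - coord i (\<beta> z)"
        by (cases i) (simp_all add: co_formulas normal_form_coeffs[OF nf] algebra_simps)
    next
      fix z i assume "z \<in> tensor_power s 3"
        "co [False, True, True] (c1 z) = - co [False, True, True] z"
        "co [True, True, False] (c2 z) = - co [True, True, False] z"
      then show "coord i (\<beta> (\<beta>1 z \<ominus>\<^bsub>T\<^esub> \<beta>2 z)) = 0"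
        by (cases i) (simp_all add: co_formulas normal_form_coeffs[OF nf] algebra_simps)
    qed
  next
    case R3
    then have nf: "normal_form s c \<beta> x1 x2 (- 1) 0 1 0 1 \<gamma> 0 0 1 (- 1) 1 0"
      using assms by (simp add: row_form_def Let_def)
    show ?thesis
    proof (rule lifted_QLie_algebraI)
      fix z i j k assume "z \<in> tensor_power s 3"
      then show "co [i, j, k] (c1 (c2 (c1 z))) = co [i, j, k] (c2 (c1 (c2 z)))"
        by (cases i; cases j; cases k) (simp_all add: co_formulas normal_form_coeffs[OF nf] algebra_simps)
    next
      fix z i j assume "z \<in> tensor_power s 3"
      then show "co [i, j] (c (\<beta>1 z)) = co [i, j] (\<beta>2 (c1 (c2 z)))" "co [i, j] (c (\<beta>2 z)) = co [i, j] (\<beta>1 (c2 (c1 z)))"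
        by (cases i; cases j; simp add: co_formulas normal_form_coeffs[OF nf] algebra_simps)+
    next
      fix z i assume "z \<in> tensor_power s 2"
      then show "coord i (\<beta> (c z)) = - coord i (\<beta> z)"
        by (cases i) (simp_all add: co_formulas normal_form_coeffs[OF nf] algebra_simps)
    next
      fix z i assume "z \<in> tensor_power s 3"
        "co [False, True, True] (c1 z) = - co [False, True, True] z"
        "co [True, True, False] (c2 z) = - co [True, True, False] z"
      then show "coord i (\<beta> (\<beta>1 z \<ominus>\<^bsub>T\<^esub> \<beta>2 z)) = 0"
        by (cases i) (simp_all add: co_formulas normal_form_coeffs[OF nf] algebra_simps)
    qed
  next
    case R4
    then have nf: "normal_form s c \<beta> x1 x2 1 0 1 0 1 \<gamma> 0 0 (- 1) 0 0 1"
      using assms by (simp add: row_form_def Let_def)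
    show ?thesis
    proof (rule lifted_QLie_algebraI)
      fix z i j k assume "z \<in> tensor_power s 3"
      then show "co [i, j, k] (c1 (c2 (c1 z))) = co [i, j, k] (c2 (c1 (c2 z)))"
        by (cases i; cases j; cases k) (simp_all add: co_formulas normal_form_coeffs[OF nf] algebra_simps)
    next
      fix z i j assume "z \<in> tensor_power s 3"
      then show "co [i, j] (c (\<beta>1 z)) = co [i, j] (\<beta>2 (c1 (c2 z)))" "co [i, j] (c (\<beta>2 z)) = co [i, j] (\<beta>1 (c2 (c1 z)))"
        by (cases i; cases j; simp add: co_formulas normal_form_coeffs[OF nf] algebra_simps)+
    next
      fix z i assume "z \<in> tensor_power s 2"
      then show "coord i (\<beta> (c z)) = - coord i (\<beta> z)"
        by (cases i) (simp_all add: co_formulas normal_form_coeffs[OF nf] algebra_simps)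
    next
      fix z i assume "z \<in> tensor_power s 3"
        "co [False, True, True] (c1 z) = - co [False, True, True] z"
        "co [True, True, False] (c2 z) = - co [True, True, False] z"
      then show "coord i (\<beta> (\<beta>1 z \<ominus>\<^bsub>T\<^esub> \<beta>2 z)) = 0"
        by (cases i) (simp_all add: co_formulas normal_form_coeffs[OF nf] algebra_simps)
    qed
  next
    case R5
    then have nf: "normal_form s c \<beta> x1 x2 0 0 1 1 1 0 0 0 1 (- 1) 1 0"
      using assms by (simp add: row_form_def Let_def)
    show ?thesis
    proof (rule lifted_QLie_algebraI)
      fix z i j k assume "z \<in> tensor_power s 3"
      then show "co [i, j, k] (c1 (c2 (c1 z))) = co [i, j, k] (c2 (c1 (c2 z)))"
        by (cases i; cases j; cases k) (simp_all add: co_formulas normal_form_coeffs[OF nf] algebra_simps)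
    next
      fix z i j assume "z \<in> tensor_power s 3"
      then show "co [i, j] (c (\<beta>1 z)) = co [i, j] (\<beta>2 (c1 (c2 z)))" "co [i, j] (c (\<beta>2 z)) = co [i, j] (\<beta>1 (c2 (c1 z)))"
        by (cases i; cases j; simp add: co_formulas normal_form_coeffs[OF nf] algebra_simps)+
    next
      fix z i assume "z \<in> tensor_power s 2"
      then show "coord i (\<beta> (c z)) = - coord i (\<beta> z)"
        by (cases i) (simp_all add: co_formulas normal_form_coeffs[OF nf] algebra_simps)
    next
      fix z i assume "z \<in> tensor_power s 3"
        "co [False, True, True] (c1 z) = - co [False, True, True] z"
        "co [True, True, False] (c2 z) = - co [True, True, False] z"
      then show "coord i (\<beta> (\<beta>1 z \<ominus>\<^bsub>T\<^esub> \<beta>2 z)) = 0"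
        by (cases i) (simp_all add: co_formulas normal_form_coeffs[OF nf] algebra_simps)
    qed
  next
    case R6
    then have nf: "normal_form s c \<beta> x1 x2 0 0 \<gamma> 0 (inverse \<gamma>) 0 0 0 1 (- \<gamma>) 1 0"
      using assms by (simp add: row_form_def Let_def)
    have \<gamma>': "\<gamma> * inverse \<gamma> = 1" "\<gamma> \<noteq> 0" using \<gamma>[OF R6] by simp_all
    show ?thesis
    proof (rule lifted_QLie_algebraI)
      fix z i j k assume "z \<in> tensor_power s 3"
      then show "co [i, j, k] (c1 (c2 (c1 z))) = co [i, j, k] (c2 (c1 (c2 z)))"
        by (cases i; cases j; cases k) (simp_all add: co_formulas normal_form_coeffs[OF nf] \<gamma>' algebra_simps)
    next
      fix z i j assume "z \<in> tensor_power s 3"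
      then show "co [i, j] (c (\<beta>1 z)) = co [i, j] (\<beta>2 (c1 (c2 z)))" "co [i, j] (c (\<beta>2 z)) = co [i, j] (\<beta>1 (c2 (c1 z)))"
        by (cases i; cases j; simp add: co_formulas normal_form_coeffs[OF nf] \<gamma>' algebra_simps)+
    next
      fix z i assume "z \<in> tensor_power s 2"
      then show "coord i (\<beta> (c z)) = - coord i (\<beta> z)"
        by (cases i) (simp_all add: co_formulas normal_form_coeffs[OF nf] \<gamma>' algebra_simps)
    next
      fix z i assume "z \<in> tensor_power s 3"
        "co [False, True, True] (c1 z) = - co [False, True, True] z"
        "co [True, True, False] (c2 z) = - co [True, True, False] z"
      \<comment> \<open>The two eigenvector coordinates are solved explicitly, so that only inverses
        of \<gamma> remain to be cleared.\<close>
      then have z: "z \<in> tensor_power s 3"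
        and e: "co [False, True, True] z = - (inverse \<gamma> * co [True, False, True] z)"
          "co [True, True, False] z = - (\<gamma> * co [True, False, True] z)"
        by (simp_all add: co_formulas normal_form_coeffs[OF nf] mult.commute)
      show "coord i (\<beta> (\<beta>1 z \<ominus>\<^bsub>T\<^esub> \<beta>2 z)) = 0"
        using z \<gamma>' by (cases i) (simp_all add: co_formulas normal_form_coeffs[OF nf] e field_simps)
    qed
  next
    case R7
    then have nf: "normal_form s c \<beta> x1 x2 \<gamma> 0 1 0 1 0 0 0 1 (- 1) 1 0"
      using assms by (simp add: row_form_def Let_def)
    show ?thesis
    proof (rule lifted_QLie_algebraI)
      fix z i j k assume "z \<in> tensor_power s 3"
      then show "co [i, j, k] (c1 (c2 (c1 z))) = co [i, j, k] (c2 (c1 (c2 z)))"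
        by (cases i; cases j; cases k) (simp_all add: co_formulas normal_form_coeffs[OF nf] algebra_simps)
    next
      fix z i j assume "z \<in> tensor_power s 3"
      then show "co [i, j] (c (\<beta>1 z)) = co [i, j] (\<beta>2 (c1 (c2 z)))" "co [i, j] (c (\<beta>2 z)) = co [i, j] (\<beta>1 (c2 (c1 z)))"
        by (cases i; cases j; simp add: co_formulas normal_form_coeffs[OF nf] algebra_simps)+
    next
      fix z i assume "z \<in> tensor_power s 2"
      then show "coord i (\<beta> (c z)) = - coord i (\<beta> z)"
        by (cases i) (simp_all add: co_formulas normal_form_coeffs[OF nf] algebra_simps)
    next
      fix z i assume "z \<in> tensor_power s 3"
        "co [False, True, True] (c1 z) = - co [False, True, True] z"
        "co [True, True, False] (c2 z) = - co [True, True, False] z"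
      then show "coord i (\<beta> (\<beta>1 z \<ominus>\<^bsub>T\<^esub> \<beta>2 z)) = 0"
        by (cases i) (simp_all add: co_formulas normal_form_coeffs[OF nf] algebra_simps)
    qed
  next
    case R8
    then have nf: "normal_form s c \<beta> x1 x2 1 0 1 0 1 \<gamma> 0 0 1 (- 1) 1 0"
      using assms by (simp add: row_form_def Let_def)
    show ?thesis
    proof (rule lifted_QLie_algebraI)
      fix z i j k assume "z \<in> tensor_power s 3"
      then show "co [i, j, k] (c1 (c2 (c1 z))) = co [i, j, k] (c2 (c1 (c2 z)))"
        by (cases i; cases j; cases k) (simp_all add: co_formulas normal_form_coeffs[OF nf] algebra_simps)
    next
      fix z i j assume "z \<in> tensor_power s 3"
      then show "co [i, j] (c (\<beta>1 z)) = co [i, j] (\<beta>2 (c1 (c2 z)))" "co [i, j] (c (\<beta>2 z)) = co [i, j] (\<beta>1 (c2 (c1 z)))"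
        by (cases i; cases j; simp add: co_formulas normal_form_coeffs[OF nf] algebra_simps)+
    next
      fix z i assume "z \<in> tensor_power s 2"
      then show "coord i (\<beta> (c z)) = - coord i (\<beta> z)"
        by (cases i) (simp_all add: co_formulas normal_form_coeffs[OF nf] algebra_simps)
    next
      fix z i assume "z \<in> tensor_power s 3"
        "co [False, True, True] (c1 z) = - co [False, True, True] z"
        "co [True, True, False] (c2 z) = - co [True, True, False] z"
      then show "coord i (\<beta> (\<beta>1 z \<ominus>\<^bsub>T\<^esub> \<beta>2 z)) = 0"
        by (cases i) (simp_all add: co_formulas normal_form_coeffs[OF nf] algebra_simps)
    qed
  qed
qed

end

section \<open>Minimal polynomials and enveloping algebras of the rows\<close>

lemma degree_ge_two_roots:
  fixes p :: "'k::field poly"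
  assumes "p \<noteq> 0" "poly p a = 0" "poly p b = 0" "a \<noteq> b"
  shows "2 \<le> degree p"
proof -
  have "card {a, b} \<le> card {x. poly p x = 0}"
    using assms by (intro card_mono poly_roots_finite) auto
  also have "\<dots> \<le> degree p" using assms(1) by (rule card_poly_roots_bound)
  finally show ?thesis using assms(4) by simp
qed

lemma degree_ge_three_roots:
  fixes p :: "'k::field poly"
  assumes "p \<noteq> 0" "poly p a = 0" "poly p b = 0" "poly p c = 0" "a \<noteq> b" "a \<noteq> c" "b \<noteq> c"
  shows "3 \<le> degree p"
proof -
  have "card {a, b, c} \<le> card {x. poly p x = 0}"
    using assms by (intro card_mono poly_roots_finite) auto
  also have "\<dots> \<le> degree p" using assms(1) by (rule card_poly_roots_bound)
  finally show ?thesis using assms(5-7) by simp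
qed

lemma row_polynomial_coeffs:
  "row_polynomial R1 \<gamma> = [:-1, 0, 1:]" "row_polynomial R2 \<gamma> = [:-1, 0, 1:]"
  "row_polynomial R3 \<gamma> = [:-1, 0, 1:]" "row_polynomial R4 \<gamma> = [:-1, 0, 1:]"
  "row_polynomial R5 \<gamma> = [:0, -1, 0, 1:]" "row_polynomial R6 \<gamma> = [:0, -1, 0, 1:]"
  "row_polynomial R7 \<gamma> = [:\<gamma>, -1, -\<gamma>, 1:]" "row_polynomial R8 \<gamma> = [:1, -1, -1, 1:]"
  by (simp_all add: row_polynomial_def power2_eq_square one_pCons)

text \<open>This is the polynomial \<open>h\<close> of each row, the quotient of its minimal
  polynomial by X + 1. In row 7 it is (X - 1)(X - \<gamma>), in row 8 it is (X - 1)^2.\<close>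

definition row_cofactor :: "row \<Rightarrow> 'k::field \<Rightarrow> 'k poly" where
  "row_cofactor w \<gamma> = (case w of
      R1 \<Rightarrow> [:-1, 1:] | R2 \<Rightarrow> [:-1, 1:] | R3 \<Rightarrow> [:-1, 1:] | R4 \<Rightarrow> [:-1, 1:]
    | R5 \<Rightarrow> [:0, -1, 1:] | R6 \<Rightarrow> [:0, -1, 1:]
    | R7 \<Rightarrow> [:\<gamma>, - (1 + \<gamma>), 1:] | R8 \<Rightarrow> [:1, -2, 1:])"

lemma row_polynomial_factor: "row_polynomial w \<gamma> = [:1, 1:] * row_cofactor w \<gamma>"
  by (cases w) (simp_all add: row_polynomial_coeffs row_cofactor_def)

context planar_maps
begin

lemma annihilates_root_quad:
  assumes "annihilates s c p"
    and "\<forall>i j. co [i, j] (c (quad s x1 x2 z11 z12 z21 z22)) = a * co [i, j] (quad s x1 x2 z11 z12 z21 z22)"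
    and "z11 \<noteq> 0 \<or> z12 \<noteq> 0 \<or> z21 \<noteq> 0 \<or> z22 \<noteq> 0"
  shows "poly p a = 0"
  using assms(2,3) by (intro annihilates_root[OF assms(1) quad_power]) (auto simp: power2_eq_iff co_quad)

lemma row_form_annihilates:
  assumes "row_form w \<gamma> s c \<beta> x1 x2" "row_parameter w \<gamma>"
  shows "annihilates s c (row_polynomial w \<gamma>)"
  unfolding annihilates_iff
proof (intro ballI allI)
  fix z i j assume z: "z \<in> tensor_power s 2"
  have \<gamma>: "w = R6 \<Longrightarrow> \<gamma> * inverse \<gamma> = 1" "w = R6 \<Longrightarrow> \<gamma> \<noteq> 0" using assms(2) by (auto simp: row_parameter_def)
  show "co [i, j] (poly_apply s c (row_polynomial w \<gamma>) z) = 0"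
    using assms(1) z \<gamma> unfolding row_form_def Let_def
    by (cases w; cases i; cases j)
       (simp_all add: row_polynomial_coeffs co_poly_apply_pCons co_c normal_form_coeffs algebra_simps)
qed

text \<open>Every eigenvalue of \<open>c\<close> is a root of an annihilating polynomial. Except in
  row 8, explicit eigenvectors provide as many distinct eigenvalues as the degree requires.\<close>

lemma row_form_degree_bound:
  assumes "row_form w \<gamma> s c \<beta> x1 x2" "row_parameter w \<gamma>" "(2::'k) \<noteq> 0"
    and p: "p \<noteq> 0" "annihilates s c p"
  shows "degree (row_polynomial w \<gamma>) \<le> degree p"
proof -
  have one: "(1::'k) \<noteq> - 1" using assms(3) by (metis add.right_inverse one_add_one)
  note root = annihilates_root_quad[OF p(2)]
  show ?thesis
  proof (cases w)
    case R1
    then have nf: "normal_form s c \<beta> x1 x2 1 0 1 0 1 0 0 0 1 (- 1) 1 0"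
      using assms by (simp add: row_form_def Let_def)
    \<comment> \<open>The four numbers given to \<open>root\<close>, here and below, are the
      coefficients of an eigenvector at x11, x12, x21, x22; this one is x12 - x21.\<close>
    have "poly p (- 1) = 0"
      by (rule root[of 0 1 "-1" 0]) (simp_all add: all_bool_iff co_c normal_form_coeffs[OF nf] co_quad)
    have "poly p (1) = 0"
      by (rule root[of 1 0 0 0]) (simp_all add: all_bool_iff co_c normal_form_coeffs[OF nf] co_quad)
    then show ?thesis
      using R1 one p(1) degree_ge_two_roots[of p "- 1" 1] \<open>poly p (- 1) = 0\<close>
      by (simp add: row_polynomial_coeffs)
  next
    case R2
    then have nf: "normal_form s c \<beta> x1 x2 1 (- 1) 1 1 1 0 0 0 1 (- 1) 1 0"
      using assms by (simp add: row_form_def Let_def)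
    have "poly p (- 1) = 0"
      by (rule root[of 1 1 "-1" 0]) (simp_all add: all_bool_iff co_c normal_form_coeffs[OF nf] co_quad)
    have "poly p (1) = 0"
      by (rule root[of 1 0 0 0]) (simp_all add: all_bool_iff co_c normal_form_coeffs[OF nf] co_quad)
    then show ?thesis
      using R2 one p(1) degree_ge_two_roots[of p "- 1" 1] \<open>poly p (- 1) = 0\<close>
      by (simp add: row_polynomial_coeffs)
  next
    case R3
    then have nf: "normal_form s c \<beta> x1 x2 (- 1) 0 1 0 1 \<gamma> 0 0 1 (- 1) 1 0"
      using assms by (simp add: row_form_def Let_def)
    have "poly p (- 1) = 0"
      by (rule root[of 1 0 0 0]) (simp_all add: all_bool_iff co_c normal_form_coeffs[OF nf] co_quad)
    have "poly p (1) = 0"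
      by (rule root[of 0 1 1 0]) (simp_all add: all_bool_iff co_c normal_form_coeffs[OF nf] co_quad)
    then show ?thesis
      using R3 one p(1) degree_ge_two_roots[of p "- 1" 1] \<open>poly p (- 1) = 0\<close>
      by (simp add: row_polynomial_coeffs)
  next
    case R4
    then have nf: "normal_form s c \<beta> x1 x2 1 0 1 0 1 \<gamma> 0 0 (- 1) 0 0 1"
      using assms by (simp add: row_form_def Let_def)
    have "poly p (- 1) = 0"
      by (rule root[of 0 1 "-1" 0]) (simp_all add: all_bool_iff co_c normal_form_coeffs[OF nf] co_quad)
    have "poly p (1) = 0"
      by (rule root[of 1 0 0 0]) (simp_all add: all_bool_iff co_c normal_form_coeffs[OF nf] co_quad)
    then show ?thesis
      using R4 one p(1) degree_ge_two_roots[of p "- 1" 1] \<open>poly p (- 1) = 0\<close>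
      by (simp add: row_polynomial_coeffs)
  next
    case R5
    then have nf: "normal_form s c \<beta> x1 x2 0 0 1 1 1 0 0 0 1 (- 1) 1 0"
      using assms by (simp add: row_form_def Let_def)
    have "poly p (- 1) = 0"
      by (rule root[of "-1" "-1" 1 0]) (simp_all add: all_bool_iff co_c normal_form_coeffs[OF nf] co_quad)
    have "poly p (1) = 0"
      by (rule root[of 0 0 0 1]) (simp_all add: all_bool_iff co_c normal_form_coeffs[OF nf] co_quad)
    have "poly p (0) = 0"
      by (rule root[of 1 0 0 0]) (simp_all add: all_bool_iff co_c normal_form_coeffs[OF nf] co_quad)
    then show ?thesis
      using R5 one p(1) degree_ge_three_roots[of p "- 1" 1 0] \<open>poly p 1 = 0\<close> \<open>poly p (- 1) = 0\<close>
      by (simp add: row_polynomial_coeffs)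
  next
    case R6
    then have nf: "normal_form s c \<beta> x1 x2 0 0 \<gamma> 0 (inverse \<gamma>) 0 0 0 1 (- \<gamma>) 1 0"
      using assms by (simp add: row_form_def Let_def)
    have "\<gamma> \<noteq> 0" using assms(2) R6 by (simp add: row_parameter_def)
    have "poly p (- 1) = 0"
      by (rule root[of 0 1 "-\<gamma>" 0]) (simp_all add: all_bool_iff co_c normal_form_coeffs[OF nf] co_quad \<open>\<gamma> \<noteq> 0\<close>)
    have "poly p (1) = 0"
      by (rule root[of 0 0 0 1]) (simp_all add: all_bool_iff co_c normal_form_coeffs[OF nf] co_quad \<open>\<gamma> \<noteq> 0\<close>)
    have "poly p (0) = 0"
      by (rule root[of 1 0 0 0]) (simp_all add: all_bool_iff co_c normal_form_coeffs[OF nf] co_quad \<open>\<gamma> \<noteq> 0\<close>)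
    then show ?thesis
      using R6 one p(1) degree_ge_three_roots[of p "- 1" 1 0] \<open>poly p 1 = 0\<close> \<open>poly p (- 1) = 0\<close>
      by (simp add: row_polynomial_coeffs)
  next
    case R7
    then have nf: "normal_form s c \<beta> x1 x2 \<gamma> 0 1 0 1 0 0 0 1 (- 1) 1 0"
      using assms by (simp add: row_form_def Let_def)
    have "poly p (- 1) = 0"
      by (rule root[of 0 1 "-1" 0]) (simp_all add: all_bool_iff co_c normal_form_coeffs[OF nf] co_quad)
    have "poly p (1) = 0"
      by (rule root[of 0 0 0 1]) (simp_all add: all_bool_iff co_c normal_form_coeffs[OF nf] co_quad)
    have "poly p (\<gamma>) = 0"
      by (rule root[of 1 0 0 0]) (simp_all add: all_bool_iff co_c normal_form_coeffs[OF nf] co_quad)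
    moreover have "\<gamma> \<noteq> 1" "\<gamma> \<noteq> - 1" using assms(2) R7 by (simp_all add: row_parameter_def)
    ultimately show ?thesis
      using R7 one p(1) degree_ge_three_roots[of p "- 1" 1 \<gamma>] \<open>poly p 1 = 0\<close> \<open>poly p (- 1) = 0\<close>
      by (auto simp: row_polynomial_coeffs)
  next
    case R8
    then have nf: "normal_form s c \<beta> x1 x2 1 0 1 0 1 \<gamma> 0 0 1 (- 1) 1 0"
      using assms by (simp add: row_form_def Let_def)
    have "poly p (- 1) = 0"
      by (rule root[of 0 1 "-1" 0]) (simp_all add: all_bool_iff co_c normal_form_coeffs[OF nf] co_quad)
    have "poly p (1) = 0"
      by (rule root[of 1 0 0 0]) (simp_all add: all_bool_iff co_c normal_form_coeffs[OF nf] co_quad)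
    \<comment> \<open>The two roots 1 and -1 do not exclude degree two. A polynomial of degree at
      most two with these roots is a multiple of X^2 - 1, and (c^2 - 1) x22 = 2 \<gamma> x11 is not
      zero.\<close>
    show ?thesis
    proof (rule ccontr)
      assume "\<not> ?thesis"
      then have deg: "degree p \<le> 2" using R8 by (simp add: row_polynomial_coeffs)
      obtain u v x where q: "p = [:u, v, x:]"
      proof
        show "p = [:coeff p 0, coeff p 1, coeff p 2:]"
        proof (rule poly_eqI)
          fix n
          show "coeff p n = coeff [:coeff p 0, coeff p 1, coeff p 2:] n"
            using deg by (cases n; cases "n - 1"; cases "n - 2")
              (auto simp: coeff_pCons numeral_2_eq_2 coeff_eq_0 split: nat.splits)
        qed
      qed
      have uvx: "u + v + x = 0" "u - v + x = 0"
        using \<open>poly p 1 = 0\<close> \<open>poly p (- 1) = 0\<close> by (simp_all add: q algebra_simps)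
      moreover have "2 * v = (u + v + x) - (u - v + x)" by simp
      ultimately have "2 * v = 0" by simp
      then have v: "v = 0" using assms(3) by simp
      have "co [False, False] (poly_apply s c p (quad s x1 x2 0 0 0 1)) = 0"
        using p(2) by (simp add: annihilates_iff)
      then have "2 * (x * \<gamma>) = 0"
        by (simp add: q v co_poly_apply_pCons co_c normal_form_coeffs[OF nf] co_quad algebra_simps)
      moreover have "\<gamma> \<noteq> 0"
        using assms(2) R8 by (auto simp: row_parameter_def Let_def)
      ultimately have "x = 0" using assms(3) by simp
      then show False using p(1) uvx v q by simp
    qed
  qed
qed

lemma row_form_minimal_polynomial:
  assumes "row_form w \<gamma> s c \<beta> x1 x2" "row_parameter w \<gamma>" "(2::'k) \<noteq> 0"
  shows "is_minimal_polynomial s c (row_polynomial w \<gamma>)"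
  unfolding is_minimal_polynomial_def
  using row_form_annihilates[OF assms(1,2)] row_form_degree_bound[OF assms]
  by (cases w) (simp_all add: row_polynomial_coeffs)

text \<open>The description of \<open>h\<close> in \<open>U_Q\<close> is resolved by uniqueness of
  the minimal polynomial and cancellation of the factor X + 1.\<close>

lemma U_Q_eq:
  assumes "is_minimal_polynomial s c ([:1, 1:] * h)"
  shows "U_Q s c \<beta> = T Quot genideal T {poly_apply s c h z \<ominus>\<^bsub>T\<^esub> tvec s (\<beta> z) | z. z \<in> tensor_power s 2}"
proof -
  have "(THE h. is_minimal_polynomial s c ([:1, 1:] * h)) = h"
  proof (rule the_equality)
    show "is_minimal_polynomial s c ([:1, 1:] * h)" by (rule assms)
  next
    fix h' assume "is_minimal_polynomial s c ([:1, 1:] * h')"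
    then have "[:1, 1:] * h' = [:1, 1:] * h" by (rule minimal_polynomial_unique[OF _ assms])
    then show "h' = h" by (simp only: mult_cancel_left) simp
  qed
  then show ?thesis by (simp add: U_Q_def Let_def)
qed

end

section \<open>Generators of the defining ideals of the enveloping algebras\<close>

context planar
begin

lemma tscale_ideal: "ideal I T \<Longrightarrow> z \<in> I \<Longrightarrow> tscale s a z \<in> I"
  unfolding tscale_def by (rule ideal.I_l_closed) auto

text \<open>Two coefficients are enough, since no row has more than two relations; a row with one
  relation uses it twice.\<close>

lemma genideal_eqI:
  assumes "S \<subseteq> carrier T" "S' \<subseteq> S" "\<And>z. z \<in> S \<Longrightarrow> \<exists>r\<in>S'. \<exists>r'\<in>S'. \<exists>k k'. z = tscale s k r \<oplus>\<^bsub>T\<^esub> tscale s k' r'"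
  shows "genideal T S = genideal T S'"
proof
  have S': "S' \<subseteq> carrier T" using assms by auto
  have id: "ideal (genideal T S') T" by (rule T.genideal_ideal[OF S'])
  show "genideal T S \<subseteq> genideal T S'"
  proof (rule T.genideal_minimal[OF id subsetI])
    fix z assume "z \<in> S"
    then obtain r r' k k' where "r \<in> S'" "r' \<in> S'" "z = tscale s k r \<oplus>\<^bsub>T\<^esub> tscale s k' r'"
      using assms(3) by blast
    then show "z \<in> genideal T S'"
      using T.genideal_self[OF S'] tscale_ideal[OF id]
      by (auto intro!: additive_subgroup.a_closed[OF ideal.axioms(1)[OF id]])
  qed
  show "genideal T S' \<subseteq> genideal T S"
    by (rule T.subset_Idl_subset[OF assms(1,2)])
qed

text \<open>The relations mix degrees one and two, so they are compared in both degrees at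
  once.\<close>

lemma mixed_eqI:
  assumes "z \<in> carrier T" "z' \<in> carrier T"
    and "\<And>w. length w \<noteq> 1 \<Longrightarrow> length w \<noteq> 2 \<Longrightarrow> co w z = co w z'"
    and "\<forall>i. co [i] z = co [i] z'" "\<forall>i j. co [i, j] z = co [i, j] z'"
  shows "z = z'"
proof (rule words_inj[OF assms(1,2)], rule poly_mapping_eqI)
  fix w
  show "Poly_Mapping.lookup (words z) w = Poly_Mapping.lookup (words z') w"
    using assms(3)[of w] assms(4,5) unfolding co_def[symmetric]
    by (cases w; cases "tl w"; cases "tl (tl w)") auto
qed

lemma co_tvec_other [simp]: "length w \<noteq> Suc 0 \<Longrightarrow> co w (tvec s v) = 0"
  using co_power_other[OF tvec_power] .

lemma co_power2_other [simp]: "z \<in> tensor_power s 2 \<Longrightarrow> length w \<noteq> 2 \<Longrightarrow> co w z = 0"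
  by (rule co_power_other)

end

context planar_maps
begin

text \<open>Write L z = h(c) z - \<beta> z. Since L is linear, it suffices to find \<open>q1\<close>
  and \<open>q2\<close> for which L takes the tabulated relations as values and to express every L z
  through these two. The coefficients \<open>k\<close> and \<open>k'\<close> are read off from the
  coordinates of z.\<close>

lemma row_form_U_Q:
  assumes "row_form w \<gamma> s c \<beta> x1 x2" "row_parameter w \<gamma>" "(2::'k) \<noteq> 0"
  shows "U_Q s c \<beta> = T Quot genideal T (row_relations w \<gamma> s x1 x2)"
proof -
  define L where "L z = poly_apply s c (row_cofactor w \<gamma>) z \<ominus>\<^bsub>T\<^esub> tvec s (\<beta> z)" for z
  have Lc [simp]: "z \<in> tensor_power s 2 \<Longrightarrow> L z \<in> carrier T" for z by (simp add: L_def)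
  define S where "S = {L z | z. z \<in> tensor_power s 2}"
  have L0: "co w (L z) = 0" if "length w \<noteq> 1" "length w \<noteq> 2" "z \<in> tensor_power s 2" for w z
    using that by (simp add: L_def)
  have L1: "co [i] (L z) = - coord i (\<beta> z)" if "z \<in> tensor_power s 2" for i z
    using that by (simp add: L_def co_tvec)
  have L2: "co [i, j] (L z) = co [i, j] (poly_apply s c (row_cofactor w \<gamma>) z)" if "z \<in> tensor_power s 2" for i j z
    using that by (simp add: L_def)
  have main: ?thesis
    if q: "row_relations w \<gamma> s x1 x2 = {L q1, L q2}" "q1 \<in> tensor_power s 2" "q2 \<in> tensor_power s 2"
      and k: "\<And>z. z \<in> tensor_power s 2 \<Longrightarrow> L z = tscale s (k z) (L q1) \<oplus>\<^bsub>T\<^esub> tscale s (k' z) (L q2)"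
    for q1 q2 k k'
  proof -
    have "genideal T S = genideal T (row_relations w \<gamma> s x1 x2)"
    proof (rule genideal_eqI)
      show "S \<subseteq> carrier T" by (auto simp: S_def)
      show "row_relations w \<gamma> s x1 x2 \<subseteq> S" using q by (auto simp: S_def)
      fix y assume "y \<in> S"
      then obtain z where "z \<in> tensor_power s 2" "y = L z" by (auto simp: S_def)
      then have "y = tscale s (k z) (L q1) \<oplus>\<^bsub>T\<^esub> tscale s (k' z) (L q2)" using k by simp
      then show "\<exists>r\<in>row_relations w \<gamma> s x1 x2. \<exists>r'\<in>row_relations w \<gamma> s x1 x2. \<exists>k k'. y = tscale s k r \<oplus>\<^bsub>T\<^esub> tscale s k' r'"
        unfolding q(1) by blast
    qed
    moreover have "U_Q s c \<beta> = T Quot genideal T S"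
      unfolding S_def L_def
      using row_form_minimal_polynomial[OF assms] by (intro U_Q_eq) (simp only: row_polynomial_factor)
    ultimately show ?thesis by simp
  qed
  show ?thesis
  proof (cases w)
    case R1
    then have nf: "normal_form s c \<beta> x1 x2 1 0 1 0 1 0 0 0 1 (- 1) 1 0"
      using assms by (simp add: row_form_def Let_def)
    note calc = L1 L2 R1 row_cofactor_def co_poly_apply_pCons co_c coord_\<beta> normal_form_coeffs[OF nf]
      co_quad co_tvec co_tvec_mult all_bool_iff
    have rel0: "tvec s x2 \<otimes>\<^bsub>T\<^esub> tvec s x1 \<ominus>\<^bsub>T\<^esub> tvec s x1 \<otimes>\<^bsub>T\<^esub> tvec s x2 \<oplus>\<^bsub>T\<^esub> tvec s x1 = L (quad s x1 x2 0 1 0 0)"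
      by (rule mixed_eqI) (simp_all add: L0 calc)
    show ?thesis
    proof (rule main[of "quad s x1 x2 0 1 0 0" "quad s x1 x2 0 1 0 0" "\<lambda>z. co [False, True] z - co [True, False] z" "\<lambda>z. 0"])
      show "row_relations w \<gamma> s x1 x2 = {L (quad s x1 x2 0 1 0 0), L (quad s x1 x2 0 1 0 0)}"
        by (simp add: R1 row_relations_def Let_def rel0)
    next
      fix z assume z: "z \<in> tensor_power s 2"
      show "L z = tscale s (co [False, True] z - co [True, False] z) (L (quad s x1 x2 0 1 0 0)) \<oplus>\<^bsub>T\<^esub> tscale s 0 (L (quad s x1 x2 0 1 0 0))"
        using z by (intro mixed_eqI) (simp_all add: L0 calc algebra_simps)
    qed simp_all
  next
    case R2
    then have nf: "normal_form s c \<beta> x1 x2 1 (- 1) 1 1 1 0 0 0 1 (- 1) 1 0"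
      using assms by (simp add: row_form_def Let_def)
    note calc = L1 L2 R2 row_cofactor_def co_poly_apply_pCons co_c coord_\<beta> normal_form_coeffs[OF nf]
      co_quad co_tvec co_tvec_mult all_bool_iff
    have rel0: "tvec s x1 \<otimes>\<^bsub>T\<^esub> tvec s x1 \<ominus>\<^bsub>T\<^esub> tvec s x2 \<otimes>\<^bsub>T\<^esub> tvec s x1 \<oplus>\<^bsub>T\<^esub> tvec s x1 \<otimes>\<^bsub>T\<^esub> tvec s x2 \<ominus>\<^bsub>T\<^esub> tvec s x1 = L (quad s x1 x2 0 0 1 0)"
      by (rule mixed_eqI) (simp_all add: L0 calc)
    show ?thesis
    proof (rule main[of "quad s x1 x2 0 0 1 0" "quad s x1 x2 0 0 1 0" "\<lambda>z. co [True, False] z - co [False, True] z" "\<lambda>z. 0"])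
      show "row_relations w \<gamma> s x1 x2 = {L (quad s x1 x2 0 0 1 0), L (quad s x1 x2 0 0 1 0)}"
        by (simp add: R2 row_relations_def Let_def rel0)
    next
      fix z assume z: "z \<in> tensor_power s 2"
      show "L z = tscale s (co [True, False] z - co [False, True] z) (L (quad s x1 x2 0 0 1 0)) \<oplus>\<^bsub>T\<^esub> tscale s 0 (L (quad s x1 x2 0 0 1 0))"
        using z by (intro mixed_eqI) (simp_all add: L0 calc algebra_simps)
    qed simp_all
  next
    case R3
    then have nf: "normal_form s c \<beta> x1 x2 (- 1) 0 1 0 1 \<gamma> 0 0 1 (- 1) 1 0"
      using assms by (simp add: row_form_def Let_def)
    note calc = L1 L2 R3 row_cofactor_def co_poly_apply_pCons co_c coord_\<beta> normal_form_coeffs[OF nf]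
      co_quad co_tvec co_tvec_mult all_bool_iff
    \<comment> \<open>Here h = X - 1 and c x11 = - x11, so h(c) x11 = - 2 x11; the factor -1/2
      recovers x11 itself.\<close>
    have rel0: "tvec s x1 \<otimes>\<^bsub>T\<^esub> tvec s x1 = L (quad s x1 x2 (- inverse 2) 0 0 0)"
      by (rule mixed_eqI) (simp_all add: L0 calc assms(3))
    have rel1: "tvec s x2 \<otimes>\<^bsub>T\<^esub> tvec s x1 \<ominus>\<^bsub>T\<^esub> tvec s x1 \<otimes>\<^bsub>T\<^esub> tvec s x2 \<oplus>\<^bsub>T\<^esub> tvec s x1 = L (quad s x1 x2 0 1 0 0)"
      by (rule mixed_eqI) (simp_all add: L0 calc assms(3))
    show ?thesis
    proof (rule main[of "quad s x1 x2 (- inverse 2) 0 0 0" "quad s x1 x2 0 1 0 0" "\<lambda>z. - 2 * co [False, False] z + \<gamma> * co [True, True] z" "\<lambda>z. co [False, True] z - co [True, False] z"])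
      show "row_relations w \<gamma> s x1 x2 = {L (quad s x1 x2 (- inverse 2) 0 0 0), L (quad s x1 x2 0 1 0 0)}"
        by (simp add: R3 row_relations_def Let_def rel0 rel1)
    next
      fix z assume z: "z \<in> tensor_power s 2"
      show "L z = tscale s (- 2 * co [False, False] z + \<gamma> * co [True, True] z) (L (quad s x1 x2 (- inverse 2) 0 0 0)) \<oplus>\<^bsub>T\<^esub> tscale s (co [False, True] z - co [True, False] z) (L (quad s x1 x2 0 1 0 0))"
        using z by (intro mixed_eqI) (simp_all add: L0 calc algebra_simps assms(3))
    qed simp_all
  next
    case R4
    then have nf: "normal_form s c \<beta> x1 x2 1 0 1 0 1 \<gamma> 0 0 (- 1) 0 0 1"
      using assms by (simp add: row_form_def Let_def)
    note calc = L1 L2 R4 row_cofactor_def co_poly_apply_pCons co_c coord_\<beta> normal_form_coeffs[OF nf]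
      co_quad co_tvec co_tvec_mult all_bool_iff
    have rel0: "tvec s x2 \<otimes>\<^bsub>T\<^esub> tvec s x1 \<ominus>\<^bsub>T\<^esub> tvec s x1 \<otimes>\<^bsub>T\<^esub> tvec s x2 = L (quad s x1 x2 0 1 0 0)"
      by (rule mixed_eqI) (simp_all add: L0 calc)
    have rel1: "tscale s \<gamma> (tvec s x1 \<otimes>\<^bsub>T\<^esub> tvec s x1) \<ominus>\<^bsub>T\<^esub> tscale s 2 (tvec s x2 \<otimes>\<^bsub>T\<^esub> tvec s x2) \<ominus>\<^bsub>T\<^esub> tvec s x1 = L (quad s x1 x2 0 0 0 1)"
      by (rule mixed_eqI) (simp_all add: L0 calc)
    show ?thesis
    proof (rule main[of "quad s x1 x2 0 1 0 0" "quad s x1 x2 0 0 0 1" "\<lambda>z. co [False, True] z - co [True, False] z" "\<lambda>z. co [True, True] z"])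
      show "row_relations w \<gamma> s x1 x2 = {L (quad s x1 x2 0 1 0 0), L (quad s x1 x2 0 0 0 1)}"
        by (simp add: R4 row_relations_def Let_def rel0 rel1)
    next
      fix z assume z: "z \<in> tensor_power s 2"
      show "L z = tscale s (co [False, True] z - co [True, False] z) (L (quad s x1 x2 0 1 0 0)) \<oplus>\<^bsub>T\<^esub> tscale s (co [True, True] z) (L (quad s x1 x2 0 0 0 1))"
        using z by (intro mixed_eqI) (simp_all add: L0 calc algebra_simps)
    qed simp_all
  next
    case R5
    then have nf: "normal_form s c \<beta> x1 x2 0 0 1 1 1 0 0 0 1 (- 1) 1 0"
      using assms by (simp add: row_form_def Let_def)
    note calc = L1 L2 R5 row_cofactor_def co_poly_apply_pCons co_c coord_\<beta> normal_form_coeffs[OF nf]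
      co_quad co_tvec co_tvec_mult all_bool_iff
    have rel0: "tvec s x1 \<otimes>\<^bsub>T\<^esub> tvec s x1 \<ominus>\<^bsub>T\<^esub> tvec s x2 \<otimes>\<^bsub>T\<^esub> tvec s x1 \<oplus>\<^bsub>T\<^esub> tvec s x1 \<otimes>\<^bsub>T\<^esub> tvec s x2 \<oplus>\<^bsub>T\<^esub> tvec s x1 = L (quad s x1 x2 0 1 0 0)"
      by (rule mixed_eqI) (simp_all add: L0 calc)
    show ?thesis
    proof (rule main[of "quad s x1 x2 0 1 0 0" "quad s x1 x2 0 1 0 0" "\<lambda>z. co [False, True] z - co [True, False] z" "\<lambda>z. 0"])
      show "row_relations w \<gamma> s x1 x2 = {L (quad s x1 x2 0 1 0 0), L (quad s x1 x2 0 1 0 0)}"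
        by (simp add: R5 row_relations_def Let_def rel0)
    next
      fix z assume z: "z \<in> tensor_power s 2"
      show "L z = tscale s (co [False, True] z - co [True, False] z) (L (quad s x1 x2 0 1 0 0)) \<oplus>\<^bsub>T\<^esub> tscale s 0 (L (quad s x1 x2 0 1 0 0))"
        using z by (intro mixed_eqI) (simp_all add: L0 calc algebra_simps)
    qed simp_all
  next
    case R6
    then have nf: "normal_form s c \<beta> x1 x2 0 0 \<gamma> 0 (inverse \<gamma>) 0 0 0 1 (- \<gamma>) 1 0"
      using assms by (simp add: row_form_def Let_def)
    have "\<gamma> \<noteq> 0" using assms(2) R6 by (simp add: row_parameter_def)
    note calc = L1 L2 R6 row_cofactor_def co_poly_apply_pCons co_c coord_\<beta> normal_form_coeffs[OF nf]
      co_quad co_tvec co_tvec_mult all_bool_iff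
    have rel0: "\<ominus>\<^bsub>T\<^esub> tscale s \<gamma> (tvec s x2 \<otimes>\<^bsub>T\<^esub> tvec s x1) \<oplus>\<^bsub>T\<^esub> tvec s x1 \<otimes>\<^bsub>T\<^esub> tvec s x2 \<oplus>\<^bsub>T\<^esub> tscale s \<gamma> (tvec s x1) = L (quad s x1 x2 0 1 0 0)"
      by (rule mixed_eqI) (simp_all add: L0 calc \<open>\<gamma> \<noteq> 0\<close>)
    \<comment> \<open>The coefficient of x21 comes from L x21 = - \<gamma>^(-1) L x12.\<close>
    show ?thesis
    proof (rule main[of "quad s x1 x2 0 1 0 0" "quad s x1 x2 0 1 0 0" "\<lambda>z. co [False, True] z - inverse \<gamma> * co [True, False] z" "\<lambda>z. 0"])
      show "row_relations w \<gamma> s x1 x2 = {L (quad s x1 x2 0 1 0 0), L (quad s x1 x2 0 1 0 0)}"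
        by (simp add: R6 row_relations_def Let_def rel0)
    next
      fix z assume z: "z \<in> tensor_power s 2"
      show "L z = tscale s (co [False, True] z - inverse \<gamma> * co [True, False] z) (L (quad s x1 x2 0 1 0 0)) \<oplus>\<^bsub>T\<^esub> tscale s 0 (L (quad s x1 x2 0 1 0 0))"
        using z by (intro mixed_eqI) (simp_all add: L0 calc algebra_simps \<open>\<gamma> \<noteq> 0\<close>)
    qed simp_all
  next
    case R7
    then have nf: "normal_form s c \<beta> x1 x2 \<gamma> 0 1 0 1 0 0 0 1 (- 1) 1 0"
      using assms by (simp add: row_form_def Let_def)
    note calc = L1 L2 R7 row_cofactor_def co_poly_apply_pCons co_c coord_\<beta> normal_form_coeffs[OF nf]
      co_quad co_tvec co_tvec_mult all_bool_iff
    have rel0: "tscale s (1 + \<gamma>) (tvec s x2 \<otimes>\<^bsub>T\<^esub> tvec s x1 \<ominus>\<^bsub>T\<^esub> tvec s x1 \<otimes>\<^bsub>T\<^esub> tvec s x2) \<ominus>\<^bsub>T\<^esub> tvec s x1 = L (quad s x1 x2 0 0 1 0)"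
      by (rule mixed_eqI) (simp_all add: L0 calc)
    show ?thesis
    proof (rule main[of "quad s x1 x2 0 0 1 0" "quad s x1 x2 0 0 1 0" "\<lambda>z. co [True, False] z - co [False, True] z" "\<lambda>z. 0"])
      show "row_relations w \<gamma> s x1 x2 = {L (quad s x1 x2 0 0 1 0), L (quad s x1 x2 0 0 1 0)}"
        by (simp add: R7 row_relations_def Let_def rel0)
    next
      fix z assume z: "z \<in> tensor_power s 2"
      show "L z = tscale s (co [True, False] z - co [False, True] z) (L (quad s x1 x2 0 0 1 0)) \<oplus>\<^bsub>T\<^esub> tscale s 0 (L (quad s x1 x2 0 0 1 0))"
        using z by (intro mixed_eqI) (simp_all add: L0 calc algebra_simps)
    qed simp_all
  next
    case R8
    then have nf: "normal_form s c \<beta> x1 x2 1 0 1 0 1 \<gamma> 0 0 1 (- 1) 1 0"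
      using assms by (simp add: row_form_def Let_def)
    note calc = L1 L2 R8 row_cofactor_def co_poly_apply_pCons co_c coord_\<beta> normal_form_coeffs[OF nf]
      co_quad co_tvec co_tvec_mult all_bool_iff
    have rel0: "tscale s 2 (tvec s x2 \<otimes>\<^bsub>T\<^esub> tvec s x1 \<ominus>\<^bsub>T\<^esub> tvec s x1 \<otimes>\<^bsub>T\<^esub> tvec s x2) \<ominus>\<^bsub>T\<^esub> tvec s x1 = L (quad s x1 x2 0 0 1 0)"
      by (rule mixed_eqI) (simp_all add: L0 calc)
    show ?thesis
    proof (rule main[of "quad s x1 x2 0 0 1 0" "quad s x1 x2 0 0 1 0" "\<lambda>z. co [True, False] z - co [False, True] z" "\<lambda>z. 0"])
      show "row_relations w \<gamma> s x1 x2 = {L (quad s x1 x2 0 0 1 0), L (quad s x1 x2 0 0 1 0)}"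
        by (simp add: R8 row_relations_def Let_def rel0)
    next
      fix z assume z: "z \<in> tensor_power s 2"
      show "L z = tscale s (co [True, False] z - co [False, True] z) (L (quad s x1 x2 0 0 1 0)) \<oplus>\<^bsub>T\<^esub> tscale s 0 (L (quad s x1 x2 0 0 1 0))"
        using z by (intro mixed_eqI) (simp_all add: L0 calc algebra_simps)
    qed simp_all
  qed
qed

end

section \<open>Distinctness of the rows\<close>

lemma (in vector_space) basis_pairI:
  assumes "\<And>v. \<exists>a b. v = scale a y1 + scale b y2"
    and "\<And>a b. scale a y1 + scale b y2 = 0 \<Longrightarrow> a = 0 \<and> b = 0"
  shows "basis_pair scale y1 y2"
proof -
  have neq: "y1 \<noteq> y2" using assms(2)[of 1 "- 1"] by auto
  have "y1 \<notin> span {y2}"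
  proof
    assume "y1 \<in> span {y2}"
    then obtain k where "y1 = scale k y2" by (auto simp: span_singleton)
    then show False using assms(2)[of 1 "- k"] by simp
  qed
  moreover have "y2 \<noteq> 0" using assms(2)[of 0 1] by auto
  ultimately have "independent {y1, y2}" using neq by (simp add: independent_insert)
  moreover have "v \<in> span {y1, y2}" for v
    using assms(1)[of v] by (auto intro!: span_add span_scale intro: span_base)
  ultimately show ?thesis using neq by (auto simp: basis_pair_def)
qed

text \<open>The basis is bound inside, so a conclusion reached after a change of basis is already a
  statement about the original \<open>c\<close> and \<beta>.\<close>

definition has_row_form ::
    "('k::field \<Rightarrow> 'v::ab_group_add \<Rightarrow> 'v) \<Rightarrow> (('v, 'k) tensor \<Rightarrow> ('v, 'k) tensor)
      \<Rightarrow> (('v, 'k) tensor \<Rightarrow> 'v) \<Rightarrow> bool" where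
  "has_row_form s c \<beta> \<longleftrightarrow>
     (\<exists>w \<gamma> y1 y2. basis_pair s y1 y2 \<and> row_parameter w \<gamma> \<and> row_form w \<gamma> s c \<beta> y1 y2)"

text \<open>The kernels of c + 1 and (c + 1)^2 coincide on the tensor square. No basis is mentioned,
  so the property persists under every change of basis.\<close>

definition semisimple_at_minus_one ::
    "('k::field \<Rightarrow> 'v::ab_group_add \<Rightarrow> 'v) \<Rightarrow> (('v, 'k) tensor \<Rightarrow> ('v, 'k) tensor) \<Rightarrow> bool" where
  "semisimple_at_minus_one s c \<longleftrightarrow>
     (\<forall>z \<in> tensor_power s 2. c (c z \<oplus>\<^bsub>tensor_algebra s\<^esub> z) = \<ominus>\<^bsub>tensor_algebra s\<^esub> (c z \<oplus>\<^bsub>tensor_algebra s\<^esub> z)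
        \<longrightarrow> c z \<oplus>\<^bsub>tensor_algebra s\<^esub> z = \<zero>\<^bsub>tensor_algebra s\<^esub>)"

context planar_maps
begin

lemma basis_pair_change:
  assumes "\<kappa> \<noteq> 0" "\<mu> \<noteq> 0"
  shows "basis_pair s (s \<kappa> x1) (s \<mu> x2 + s \<nu> x1)"
proof (rule basis_pairI)
  fix v
  have "v = s ((coord False v - coord True v * \<nu> / \<mu>) / \<kappa>) (s \<kappa> x1) + s (coord True v / \<mu>) (s \<mu> x2 + s \<nu> x1)"
    using assms by (simp add: vector_eq_iff coord_add coord_scale field_simps)
  then show "\<exists>a b. v = s a (s \<kappa> x1) + s b (s \<mu> x2 + s \<nu> x1)" by blast
next
  fix a b assume "s a (s \<kappa> x1) + s b (s \<mu> x2 + s \<nu> x1) = 0"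
  then show "a = 0 \<and> b = 0"
    using assms by (auto simp: vector_eq_iff coord_add coord_scale)
qed

lemma planar_maps_change: "\<kappa> \<noteq> 0 \<Longrightarrow> \<mu> \<noteq> 0 \<Longrightarrow> planar_maps s (s \<kappa> x1) (s \<mu> x2 + s \<nu> x1) c \<beta>"
  using lin_c lin_\<beta> basis_pair_change
  by (simp add: planar_maps_def planar_maps_axioms_def planar_def planar_axioms_def vector_space_axioms)

text \<open>The scalars a, q, t, m are invariant and leave only two coincidences: rows 1, 2, 8, and
  row 5 against row 7 with \<gamma> = 0. In the first, p is only rescaled and singles out row 2, and
  then d11 is only rescaled and separates row 8 from row 1. In the second, p = p' = 0 forces \<nu> =
  0, so r is only rescaled.\<close>

lemma row_form_unique:
  assumes w: "row_form w \<gamma> s c \<beta> x1 x2" "row_parameter w \<gamma>"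
    and y: "basis_pair s y1 y2"
    and w': "row_form w' \<gamma>' s c \<beta> y1 y2" "row_parameter w' \<gamma>'"
    and char: "(2::'k) \<noteq> 0"
  shows "w' = w"
proof -
  interpret P: planar_maps s y1 y2 c \<beta>
    using lin_c lin_\<beta> y
    by (simp add: planar_maps_def planar_maps_axioms_def planar_def planar_axioms_def vector_space_axioms)
  have im: "coord True (\<beta> z) = 0" if "z \<in> tensor_power s 2" for z
    using w(1) that unfolding row_form_def Let_def
    by (cases w) (simp_all add: coord_\<beta> normal_form_coeffs)
  \<comment> \<open>In every row the first basis vector is a value of \<beta>, hence
    \<open>y1\<close> lies on the line of \<open>x1\<close>. This is what makes the change of basis
    triangular.\<close>
  have "\<beta> (tvec s y2 \<otimes>\<^bsub>T\<^esub> tvec s y1) = y1 \<or> \<beta> (tvec s y2 \<otimes>\<^bsub>T\<^esub> tvec s y2) = y1"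
    using w'(1) unfolding row_form_def Let_def normal_form_def
    by (cases w') auto
  then have y1T: "coord True y1 = 0" using im tvec_mult_power by metis
  define \<kappa> \<mu> \<nu> where "\<kappa> = coord False y1" and "\<mu> = coord True y2" and "\<nu> = coord False y2"
  have y1: "y1 = s \<kappa> x1" using y1T by (simp add: vector_eq_iff coord_scale \<kappa>_def)
  have y2: "y2 = s \<mu> x2 + s \<nu> x1" by (simp add: vector_eq_iff coord_scale coord_add \<mu>_def \<nu>_def)
  have \<kappa>: "\<kappa> \<noteq> 0"
  proof
    assume "\<kappa> = 0"
    then have "y1 = 0" by (simp add: y1)
    then show False by (metis P.coord_zero P.coord_x(1) zero_neq_one)
  qed
  have \<mu>: "\<mu> \<noteq> 0"
  proof
    assume "\<mu> = 0"
    then have "y2 = s (\<nu> / \<kappa>) y1" using \<kappa> by (simp add: y1 y2)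
    then have "P.coord True y2 = 0" by (metis P.coord_scale P.coord_x(2) mult_zero_right)
    then show False by simp
  qed
  \<comment> \<open>The base change formulas with the denominators \<kappa> cleared, specialised to
    d12 = d21 = 0 as in all rows.\<close>
  have compare: "a' = a \<and> q' = q \<and> t' = t \<and> m' = m \<and> \<kappa> * p' = \<mu> * p + \<nu> * (a - q) \<and> \<kappa> * r' = \<mu> * r + \<nu> * (a - t)
     \<and> b12' = \<mu> * b12 \<and> b21' = \<mu> * b21
     \<and> \<kappa>\<^sup>2 * d11' = \<mu>\<^sup>2 * d11 + \<mu> * \<nu> * (p + r) + \<nu>\<^sup>2 * (a - m) - \<nu> * (\<nu> * (t - m) + \<nu> * (q - m))"
    if "normal_form s c \<beta> x1 x2 a p q r t d11 0 0 m b12 b21 e"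
      and "normal_form s c \<beta> y1 y2 a' p' q' r' t' d11' 0 0 m' b12' b21' e'"
    for a p q r t d11 m b12 b21 e a' p' q' r' t' d11' m' b12' b21' e'
  proof -
    note nf = normal_form_change_basis[OF that(1) \<kappa> \<mu> refl refl refl refl refl refl refl refl, of \<nu>]
    show ?thesis
      using P.normal_form_coeffs[OF that(2)] P.normal_form_coeffs[OF nf[folded y1 y2]] \<kappa> by auto
  qed
  \<comment> \<open>The list records a, p, q, r, t, d11, m, b12, b21, e, so that one instance of
    \<open>compare\<close> serves all pairs of rows.\<close>
  define P where "P w \<gamma> = (case w of
      R1 \<Rightarrow> [1, 0, 1, 0, 1, 0, 1, - 1, 1, 0] | R2 \<Rightarrow> [1, - 1, 1, 1, 1, 0, 1, - 1, 1, 0]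
    | R3 \<Rightarrow> [- 1, 0, 1, 0, 1, \<gamma>, 1, - 1, 1, 0] | R4 \<Rightarrow> [1, 0, 1, 0, 1, \<gamma>, - 1, 0, 0, 1]
    | R5 \<Rightarrow> [0, 0, 1, 1, 1, 0, 1, - 1, 1, 0] | R6 \<Rightarrow> [0, 0, \<gamma>, 0, inverse \<gamma>, 0, 1, - \<gamma>, 1, 0]
    | R7 \<Rightarrow> [\<gamma>, 0, 1, 0, 1, 0, 1, - 1, 1, 0] | R8 \<Rightarrow> [1, 0, 1, 0, 1, \<gamma>, 1, - 1, 1, 0])" for w and \<gamma> :: 'k
  have P: "normal_form s c \<beta> u v (P w \<gamma> ! 0) (P w \<gamma> ! 1) (P w \<gamma> ! 2) (P w \<gamma> ! 3) (P w \<gamma> ! 4) (P w \<gamma> ! 5) 0 0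
      (P w \<gamma> ! 6) (P w \<gamma> ! 7) (P w \<gamma> ! 8) (P w \<gamma> ! 9)" if "row_form w \<gamma> s c \<beta> u v" for w \<gamma> u v
    using that unfolding row_form_def Let_def P_def by (cases w) simp_all
  have one: "(1::'k) \<noteq> - 1" "(- 1::'k) \<noteq> 1" using char by (metis add.right_inverse one_add_one)+
  have R8: "\<gamma> \<noteq> 0" if "row_parameter R8 \<gamma>" for \<gamma> :: 'k
    using that by (auto simp: row_parameter_def Let_def)
  note facts = compare[OF P[OF w(1)] P[OF w'(1)]]
  show ?thesis
    using facts one \<kappa> \<mu> w(2) w'(2)
    by (cases w; cases w') (auto simp: P_def row_parameter_def Let_def dest: R8)
qed

end

section \<open>Classification\<close>

context planar_maps
begin

lemma
  assumes "lifted_QLie_algebra s c \<beta>"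
  shows braid_mono: "co w (c1 (c2 (c1 (mono [l, m, n])))) = co w (c2 (c1 (c2 (mono [l, m, n]))))"
    and c_\<beta>1_mono: "co w (c (\<beta>1 (mono [l, m, n]))) = co w (\<beta>2 (c1 (c2 (mono [l, m, n]))))"
    and c_\<beta>2_mono: "co w (c (\<beta>2 (mono [l, m, n]))) = co w (\<beta>1 (c2 (c1 (mono [l, m, n]))))"
    and \<beta>_c_mono: "coord i (\<beta> (c (mono [m, n]))) = - coord i (\<beta> (mono [m, n]))"
  using assms unfolding lifted_QLie_algebra_iff by (simp_all add: coord_minus)

text \<open>The image of \<beta>1 is contained in x1 \<otimes> V and that of \<beta>2 in V \<otimes>
  x1. The two compatibilities therefore force zeros in \<open>c\<close> as soon as one value of
  \<beta> on a basis monomial is nonzero.\<close>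

lemma normal_form_exists:
  assumes L: "lifted_QLie_algebra s c \<beta>"
    and im: "\<And>z. z \<in> tensor_power s 2 \<Longrightarrow> coord True (\<beta> z) = 0"
    and nz: "z0 \<in> tensor_power s 2" "\<beta> z0 \<noteq> 0"
    and char: "(2::'k) \<noteq> 0"
  shows "\<exists>a p q r t d11 d12 d21 m b12 b21 e. normal_form s c \<beta> x1 x2 a p q r t d11 d12 d21 m b12 b21 e
     \<and> (b12 \<noteq> 0 \<or> b21 \<noteq> 0 \<or> e \<noteq> 0)"
proof -
  have BT: "B True k l = 0" for k l using im by (simp add: B_def)
  have "\<exists>k l. B False k l \<noteq> 0"
  proof (rule ccontr)
    assume "\<nexists>k l. B False k l \<noteq> 0"
    then show False using nz BT by (simp add: vector_eq_iff coord_\<beta>)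
  qed
  then obtain k l where kl: "B False k l \<noteq> 0" by blast
  have C1: "C i True False v = 0" for i v
  proof -
    \<comment> \<open>The left side is the coordinate at (i, x2) of c \<beta>1 on the monomial (k,
      l, v), and \<beta>2 has no such coordinate.\<close>
    have "B False k l * C i True False v = 0"
      using c_\<beta>1_mono[OF L, of "[i, True]" k l v]
      by (cases k; cases l; cases v) (simp_all add: co_formulas BT)
    then show ?thesis using kl by simp
  qed
  have C2: "C True j v False = 0" for j v
  proof -
    have "B False k l * C True j v False = 0"
      using c_\<beta>2_mono[OF L, of "[True, j]" v k l]
      by (cases k; cases l; cases v) (simp_all add: co_formulas BT)
    then show ?thesis using kl by simp
  qed
  let ?a = "C False False False False"
  \<comment> \<open>Were \<beta> x11 nonzero, \<beta> c = - \<beta> would give a = -1, while c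
    \<beta>1 = \<beta>2 c1 c2 on x111 would give a = a^2. These clash because 2 is not 0.\<close>
  have "?a * B False False False = - B False False False"
    using \<beta>_c_mono[OF L, of False False False] by (simp add: co_formulas C1 C2 BT)
  moreover have "B False False False * ?a = ?a * ?a * B False False False"
    using c_\<beta>1_mono[OF L, of "[False, False]" False False False] by (simp add: co_formulas C1 C2 BT)
  moreover have "2 * y = 0" if "x * y = - y" "y * x = x * x * y" for x y :: 'k
  proof -
    have "x * (x * y) = x * y" using that(2) by (simp add: ac_simps)
    then have "y = - y" using that(1) by simp
    then show ?thesis by (metis add.right_inverse mult_2)
  qed
  ultimately have "2 * B False False False = 0" by blast
  then have b11: "B False False False = 0" using char by simp
  have nf: "normal_form s c \<beta> x1 x2 ?a (C False False False True) (C True False False True)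
      (C False False True False) (C False True True False)
      (C False False True True) (C False True True True) (C True False True True) (C True True True True)
      (B False False True) (B False True False) (B False True True)"
    unfolding normal_form_iff by (simp add: C1 C2 BT b11)
  have "B False False True \<noteq> 0 \<or> B False True False \<noteq> 0 \<or> B False True True \<noteq> 0"
    using kl b11 by (cases k; cases l) auto
  then show ?thesis using nf by blast
qed

text \<open>The first three equations are \<beta> c = - \<beta> on x12, x21 and x22. The others are
  single coefficients of the two compatibilities on monomials of degree three.\<close>

lemma normal_form_equations:
  assumes L: "lifted_QLie_algebra s c \<beta>"
    and nf: "normal_form s c \<beta> x1 x2 a p q r t d11 d12 d21 m b12 b21 e"
  shows "q * b21 = - b12" "t * b12 = - b21" "d12 * b12 + d21 * b21 + m * e = - e"
    and "b21 * a = t * a * b21" "e * a = r * t * (b12 + b21) + t * t * e"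
    and "b21 * p = p * t * b21 + q * d12 * b21" "b21 * q = q * m * b21"
    and "e * p = d11 * t * b21 + d12 * (r * b12 + t * e) + d21 * d12 * b21 + m * (d11 * b12 + d12 * e)"
    and "e * q = d21 * m * b21 + m * (d21 * b12 + m * e)"
    and "e * a = p * q * (b12 + b21) + q * q * e"
    and "b12 * r = r * q * b12 + t * d21 * b12"
    and "e * r = d11 * q * b12 + d21 * (p * b21 + q * e) + d12 * d21 * b12 + m * (d11 * b21 + d21 * e)"
    and "e * t = d12 * m * b12 + m * (d12 * b21 + m * e)"
proof -
  note C = co_formulas normal_form_coeffs[OF nf]
  note E1 = c_\<beta>1_mono[OF L] and E2 = c_\<beta>2_mono[OF L] and E3 = \<beta>_c_mono[OF L]
  show "q * b21 = - b12" using E3[of False False True] by (simp add: C)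
  show "t * b12 = - b21" using E3[of False True False] by (simp add: C)
  show "d12 * b12 + d21 * b21 + m * e = - e" using E3[of False True True] by (simp add: C)
  show "b21 * a = t * a * b21" using E1[of "[False, False]" True False False] by (simp add: C algebra_simps)
  show "e * a = r * t * (b12 + b21) + t * t * e" using E1[of "[False, False]" True True False] by (simp add: C algebra_simps)
  show "b21 * p = p * t * b21 + q * d12 * b21" using E1[of "[False, False]" True False True] by (simp add: C algebra_simps)
  show "b21 * q = q * m * b21" using E1[of "[True, False]" True False True] by (simp add: C algebra_simps)
  show "e * p = d11 * t * b21 + d12 * (r * b12 + t * e) + d21 * d12 * b21 + m * (d11 * b12 + d12 * e)"
    using E1[of "[False, False]" True True True] by (simp add: C algebra_simps)
  show "e * q = d21 * m * b21 + m * (d21 * b12 + m * e)"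
    using E1[of "[True, False]" True True True] by (simp add: C algebra_simps)
  show "e * a = p * q * (b12 + b21) + q * q * e" using E2[of "[False, False]" False True True] by (simp add: C algebra_simps)
  show "b12 * r = r * q * b12 + t * d21 * b12" using E2[of "[False, False]" True False True] by (simp add: C algebra_simps)
  show "e * r = d11 * q * b12 + d21 * (p * b21 + q * e) + d12 * d21 * b12 + m * (d11 * b21 + d21 * e)"
    using E2[of "[False, False]" True True True] by (simp add: C algebra_simps)
  show "e * t = d12 * m * b12 + m * (d12 * b21 + m * e)"
    using E2[of "[False, True]" True True True] by (simp add: C algebra_simps)
qed

text \<open>Coefficients of x111 in the braid equation, evaluated on the monomials x121, x122, x221
  and x222.\<close>

lemma braid_equations:
  assumes L: "lifted_QLie_algebra s c \<beta>"
    and nf: "normal_form s c \<beta> x1 x2 a p 1 r 1 d 0 0 1 b12 b21 e"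
  shows "p * a * a + a * r = r * a * a + a * p" "p * p * a + p * r + d = d * a * a"
    and "r * r * a + p * r + d = d * a * a" "d * p * a = d * r * a"
proof -
  note C = co_formulas normal_form_coeffs[OF nf]
  note E = braid_mono[OF L, of "[False, False, False]"]
  show "p * a * a + a * r = r * a * a + a * p" using E[of False True False] by (simp add: C algebra_simps)
  show "p * p * a + p * r + d = d * a * a" using E[of False True True] by (simp add: C algebra_simps)
  show "r * r * a + p * r + d = d * a * a" using E[of True True False] by (simp add: C algebra_simps)
  show "d * p * a = d * r * a" using E[of True True True] by (simp add: C algebra_simps)
qed

section \<open>Scaling a normal form to a row of the table\<close>

lemma has_row_formI: "row_form w \<gamma> s c \<beta> x1 x2 \<Longrightarrow> row_parameter w \<gamma> \<Longrightarrow> has_row_form s c \<beta>"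
  using basis unfolding has_row_form_def by blast

lemma row_form_change_basis:
  assumes "normal_form s c \<beta> x1 x2 a p q r t d11 0 0 m b12 b21 e" "\<kappa> \<noteq> 0" "\<mu> \<noteq> 0"
    and "normal_form s c \<beta> (s \<kappa> x1) (s \<mu> x2 + s 0 x1) a (\<mu> * p / \<kappa>) q (\<mu> * r / \<kappa>) t (\<mu>\<^sup>2 * d11 / \<kappa>\<^sup>2) 0 0 m (\<mu> * b12) (\<mu> * b21) (\<mu>\<^sup>2 * e / \<kappa>)
      \<Longrightarrow> row_form w \<gamma> s c \<beta> (s \<kappa> x1) (s \<mu> x2 + s 0 x1)"
    and "row_parameter w \<gamma>"
  shows "has_row_form s c \<beta>"
proof -
  have "normal_form s c \<beta> (s \<kappa> x1) (s \<mu> x2 + s 0 x1) a (\<mu> * p / \<kappa>) q (\<mu> * r / \<kappa>) t (\<mu>\<^sup>2 * d11 / \<kappa>\<^sup>2) 0 0 m (\<mu> * b12) (\<mu> * b21) (\<mu>\<^sup>2 * e / \<kappa>)"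
    by (rule normal_form_change_basis[OF assms(1-3)]) simp_all
  then show ?thesis
    using assms(4,5) basis_pair_change[OF assms(2,3)] unfolding has_row_form_def by blast
qed

text \<open>If d is a nonzero square, \<delta> is a square root of it; otherwise \<delta> = 1. The
  last clause keeps a nonzero d nonzero, as row 8 requires.\<close>

lemma square_class_representative:
  fixes d :: 'k
  obtains \<delta> where "\<delta> \<noteq> 0" "d / \<delta>\<^sup>2 = 0 \<or> d / \<delta>\<^sup>2 = 1 \<or> (\<nexists>x. x\<^sup>2 = d / \<delta>\<^sup>2)" "d = 0 \<or> d / \<delta>\<^sup>2 \<noteq> 0"
proof (cases "\<exists>x. x\<^sup>2 = d")
  case True
  then obtain x where "x\<^sup>2 = d" by blast
  then show ?thesis using that[of "if x = 0 then 1 else x"] by auto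
next
  case False
  then show ?thesis using that[of 1] by auto
qed

lemma has_row_form_R3:
  assumes nf: "normal_form s c \<beta> x1 x2 (- 1) 0 1 0 1 d 0 0 1 (- 1) 1 0"
  shows "has_row_form s c \<beta>"
proof -
  obtain \<delta> where \<delta>: "\<delta> \<noteq> 0" "d / \<delta>\<^sup>2 = 0 \<or> d / \<delta>\<^sup>2 = 1 \<or> (\<nexists>x. x\<^sup>2 = d / \<delta>\<^sup>2)"
    using square_class_representative[of d] by metis
  show ?thesis
    using \<delta> by (intro row_form_change_basis[OF nf, of \<delta> 1 R3 "d / \<delta>\<^sup>2"])
      (auto simp: row_form_def row_parameter_def Let_def)
qed

lemma has_row_form_R1_R8:
  assumes nf: "normal_form s c \<beta> x1 x2 1 0 1 0 1 d 0 0 1 (- 1) 1 0"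
  shows "has_row_form s c \<beta>"
proof (cases "d = 0")
  case True
  then show ?thesis
    using nf by (intro has_row_formI[of R1 0]) (simp_all add: row_form_def row_parameter_def)
next
  case False
  obtain \<delta> where \<delta>: "\<delta> \<noteq> 0" "d / \<delta>\<^sup>2 = 0 \<or> d / \<delta>\<^sup>2 = 1 \<or> (\<nexists>x. x\<^sup>2 = d / \<delta>\<^sup>2)"
    "d = 0 \<or> d / \<delta>\<^sup>2 \<noteq> 0"
    by (rule square_class_representative[of d])
  show ?thesis
    using \<delta> False by (intro row_form_change_basis[OF nf, of \<delta> 1 R8 "d / \<delta>\<^sup>2"])
      (auto simp: row_form_def row_parameter_def Let_def)
qed

lemma has_row_form_R2:
  assumes nf: "normal_form s c \<beta> x1 x2 1 p 1 (- p) 1 0 0 0 1 (- 1) 1 0" and "p \<noteq> 0"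
  shows "has_row_form s c \<beta>"
  \<comment> \<open>Scaling x1 by - p turns the pair p, - p into -1, 1.\<close>
  using assms(2) by (intro row_form_change_basis[OF nf, of "- p" 1 R2 0])
    (simp_all add: row_form_def row_parameter_def)

lemma has_row_form_R5_R7:
  assumes nf: "normal_form s c \<beta> x1 x2 0 0 1 r 1 0 0 0 1 (- 1) 1 0"
  shows "has_row_form s c \<beta>"
proof (cases "r = 0")
  case True
  then show ?thesis
    using nf by (intro has_row_formI[of R7 0]) (simp_all add: row_form_def row_parameter_def)
next
  case False
  then show ?thesis
    \<comment> \<open>Scaling x1 by r makes the x11 coefficient of c x21 equal to 1.\<close>
    by (intro row_form_change_basis[OF nf, of r 1 R5 0]) (simp_all add: row_form_def row_parameter_def)
qed

lemma has_row_form_R4: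
  assumes nf: "normal_form s c \<beta> x1 x2 1 0 1 0 1 d 0 0 (- 1) 0 0 1"
  shows "has_row_form s c \<beta>"
proof -
  obtain \<delta> where \<delta>: "\<delta> \<noteq> 0" "d / \<delta>\<^sup>2 = 0 \<or> d / \<delta>\<^sup>2 = 1 \<or> (\<nexists>x. x\<^sup>2 = d / \<delta>\<^sup>2)"
    using square_class_representative[of d] by metis
  \<comment> \<open>The bracket \<beta> x22 = x1 survives the scaling only if \<kappa> = \<mu>^2,
    which explains the pair \<open>\<delta>\<^sup>2\<close>, \<delta> below.\<close>
  have "\<delta>\<^sup>2 * d / (\<delta>\<^sup>2)\<^sup>2 = d / \<delta>\<^sup>2" using \<delta>(1) by (simp add: power2_eq_square)
  then show ?thesis
    using \<delta> by (intro row_form_change_basis[OF nf, of "\<delta>\<^sup>2" \<delta> R4 "d / \<delta>\<^sup>2"])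
      (auto simp: row_form_def row_parameter_def Let_def)
qed

lemma semisimple_quad:
  assumes "semisimple_at_minus_one s c"
    and "\<forall>i j. co [i, j] (c (c (quad s x1 x2 u v w x) \<oplus>\<^bsub>T\<^esub> quad s x1 x2 u v w x)) =
        - co [i, j] (c (quad s x1 x2 u v w x) \<oplus>\<^bsub>T\<^esub> quad s x1 x2 u v w x)"
  shows "co [i, j] (c (quad s x1 x2 u v w x)) + co [i, j] (quad s x1 x2 u v w x) = 0"
proof -
  let ?z = "quad s x1 x2 u v w x"
  have "c (c ?z \<oplus>\<^bsub>T\<^esub> ?z) = \<ominus>\<^bsub>T\<^esub> (c ?z \<oplus>\<^bsub>T\<^esub> ?z)"
    using assms(2) by (simp add: power2_eq_iff)
  then have "co [i, j] (c ?z \<oplus>\<^bsub>T\<^esub> ?z) = co [i, j] \<zero>\<^bsub>T\<^esub>"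
    using assms(1) quad_power unfolding semisimple_at_minus_one_def by metis
  then show ?thesis by simp
qed

text \<open>With q = 1 the linear equations leave only a, p, r, d free. A shift of x2 by \<nu> x1
  changes p and r by the same multiple of a - 1, so it can remove p when a is not 1, whereas at a =
  1 both p and r stay fixed.\<close>

lemma has_row_form_flip:
  assumes L: "lifted_QLie_algebra s c \<beta>" and S: "semisimple_at_minus_one s c"
    and nf: "normal_form s c \<beta> x1 x2 a p 1 r t d d12 d21 m b12 1 e"
    and char: "(2::'k) \<noteq> 0"
  shows "has_row_form s c \<beta>"
proof -
  note E = normal_form_equations[OF L nf]
  have b12: "b12 = - 1" using E(1) by (metis mult_1 minus_minus)
  have t: "t = 1" using E(2) b12 by simp
  have m: "m = 1" using E(7) by simp
  have d12: "d12 = 0" using E(6) t by simp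
  have d21: "d21 = 0" using E(11) t b12 by simp
  have e: "e = 0"
  proof -
    have "e = - e" using E(3) d12 d21 m by simp
    then have "2 * e = 0" by (metis add.right_inverse mult_2)
    then show ?thesis using char by simp
  qed
  note nf = nf[unfolded b12 t m d12 d21 e]
  note E = braid_equations[OF L nf]
  show ?thesis
  proof (cases "a = 0 \<or> a = 1")
    case True
    then consider "a = 1" | "a = 0" by blast
    then show ?thesis
    proof cases
      case 1
      \<comment> \<open>The first two force p + r = 0; the third then gives d = 0 unless p = 0,
        which separates row 2 from rows 1 and 8.\<close>
      have pr: "p * (p + r) = 0" "r * (p + r) = 0" "d * (p - r) = 0"
        using E 1 by (simp_all add: algebra_simps)
      show ?thesis
      proof (cases "p + r = 0")
        case True
        then have r: "r = - p" by (simp add: add_eq_0_iff)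
        show ?thesis
        proof (cases "p = 0")
          case True
          then show ?thesis using nf r 1 by (intro has_row_form_R1_R8[of d]) simp
        next
          case False
          then have "d = 0" using pr(3) r char by (auto simp flip: mult_2)
          then show ?thesis using nf r 1 False by (intro has_row_form_R2[of p]) simp_all
        qed
      next
        case False
        then have "p = 0" "r = 0" using pr by simp_all
        then show ?thesis using False by simp
      qed
    next
      case 2
      have d: "d = - (p * r)" using E(2) 2 by (simp add: eq_neg_iff_add_eq_0 add.commute)
      interpret N: planar_maps s "s 1 x1" "s 1 x2 + s p x1" c \<beta> by (rule planar_maps_change) simp_all
      \<comment> \<open>At a = 0 the shift \<nu> = p removes p, and it also removes d because d = -
        p r. The difference r - p is what distinguishes rows 5 and 7.\<close>
      have "normal_form s c \<beta> (s 1 x1) (s 1 x2 + s p x1) 0 0 1 (r - p) 1 0 0 0 1 (- 1) 1 0"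
        by (rule normal_form_change_basis[OF nf[unfolded 2]]) (simp_all add: d power2_eq_square algebra_simps)
      then show ?thesis by (rule N.has_row_form_R5_R7)
    qed
  next
    case False
    then have "a * (a - 1) \<noteq> 0" by simp
    moreover have "(p - r) * (a * (a - 1)) = 0" using E(1) by (simp add: algebra_simps)
    ultimately have "a = - 1 \<or> p = r" by simp
    then have r: "r = p"
    proof
      assume a: "a = - 1"
      \<comment> \<open>For z = x12 - x21 one finds c z + z = (p - r) x11. As x11 has eigenvalue a =
        -1, semisimplicity makes this zero.\<close>
      have "co [False, False] (c (quad s x1 x2 0 1 (- 1) 0)) + co [False, False] (quad s x1 x2 0 1 (- 1) 0) = 0"
        by (rule semisimple_quad[OF S]) (simp add: all_bool_iff co_c normal_form_coeffs[OF nf] co_quad a)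
      then show ?thesis by (simp add: co_c normal_form_coeffs[OF nf] co_quad)
    qed simp
    have a1: "1 - a \<noteq> 0" using False by simp
    \<comment> \<open>The shift that solves p + \<nu> (a - 1) = 0; since r = p it removes both
      coefficients.\<close>
    define \<nu> where "\<nu> = p / (1 - a)"
    have \<nu>: "p = \<nu> * (1 - a)" using a1 by (simp add: \<nu>_def)
    interpret N: planar_maps s "s 1 x1" "s 1 x2 + s \<nu> x1" c \<beta> by (rule planar_maps_change) simp_all
    have nf': "normal_form s c \<beta> (s 1 x1) (s 1 x2 + s \<nu> x1) a 0 1 0 1 (d + \<nu>\<^sup>2 * (1 - a)) 0 0 1 (- 1) 1 0"
      by (rule normal_form_change_basis[OF nf]) (simp_all add: r \<nu> power2_eq_square algebra_simps)
    show ?thesis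
    proof (cases "a = - 1")
      case True
      then show ?thesis using nf' by (intro N.has_row_form_R3) simp
    next
      case a: False
      \<comment> \<open>The new x11 coefficient of c x22, multiplied by 1 - a^2, is the braid
        relation. It vanishes unless a = -1, which is why row 3 keeps a parameter there.\<close>
      have "(1 + a) * ((1 - a) * (d + \<nu>\<^sup>2 * (1 - a))) = p * p * a + p * r + d - d * a * a"
        by (simp add: r \<nu> power2_eq_square algebra_simps)
      also have "\<dots> = 0" using E(2) by simp
      finally have "d + \<nu>\<^sup>2 * (1 - a) = 0"
        using a a1 by (simp add: add_eq_0_iff)
      then show ?thesis
        using nf' a False by (intro N.has_row_formI[of R7 a]) (simp_all add: row_form_def row_parameter_def)
    qed
  qed
qed

text \<open>Since q and t = 1/q both differ from 1, the compatibilities contain invertible factors 1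
  - t and 1 - q that kill a, r and p. The mixed coefficients of c x22 follow, and the braid equation
  kills d11.\<close>

lemma has_row_form_R6:
  assumes L: "lifted_QLie_algebra s c \<beta>"
    and nf: "normal_form s c \<beta> x1 x2 a p q r t d11 d12 d21 m b12 1 0" and q: "q \<noteq> 1"
  shows "has_row_form s c \<beta>"
proof -
  note E = normal_form_equations[OF L nf]
  have b12: "b12 = - q" using E(1) by simp
  have tq: "t * q = 1" using E(2) b12 by simp
  then have t: "t = inverse q" by (metis inverse_unique mult.commute)
  have q0: "q \<noteq> 0" "t \<noteq> 0" and t1: "t \<noteq> 1"
    using q tq by auto
  have a: "a = 0" using E(4) t1 by simp
  have m: "m = 1" using E(7) q0 by simp
  have r: "r = 0" using E(5) q q0 b12 by simp
  have p: "p = 0" using E(10) q q0 b12 by simp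
  have d12: "d12 = 0" using E(6) p q0 by simp
  have d21: "d21 = 0" using E(11) r q0 b12 by simp
  note nf = nf[unfolded a m r p d12 d21]
  have "d11 * (q * q) = 0"
    using braid_mono[OF L, of "[False, False, False]" False True True]
    by (auto simp: co_formulas normal_form_coeffs[OF nf])
  then have "d11 = 0" using q0 by simp
  then show ?thesis
    using nf q q0 by (intro has_row_formI[of R6 q]) (simp_all add: row_form_def row_parameter_def t b12)
qed

text \<open>The test tensor z = u x11 + w x21 + x22 is chosen so that c z + z is a multiple of the
  antisymmetric tensor x12 - x21, on which \<open>c\<close> acts by -1. Semisimplicity then gives d'
  = 0.\<close>

lemma has_row_form_R4_semisimple:
  assumes S: "semisimple_at_minus_one s c"
    and nf: "normal_form s c \<beta> x1 x2 1 0 1 0 1 d 0 d' (- 1) 0 0 1"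
    and char: "(2::'k) \<noteq> 0"
  shows "has_row_form s c \<beta>"
proof -
  let ?u = "- (d / 2)" and ?w = "- (d' / 2)"
  have "(4::'k) = 2 * 2" by simp
  then have "(4::'k) \<noteq> 0" using char by (metis mult_eq_0_iff)
  have "co [False, True] (c (quad s x1 x2 ?u 0 ?w 1)) + co [False, True] (quad s x1 x2 ?u 0 ?w 1) = 0"
    using char \<open>(4::'k) \<noteq> 0\<close> by (intro semisimple_quad[OF S])
      (simp add: all_bool_iff co_c normal_form_coeffs[OF nf] co_quad field_simps)
  then have "d' = 0" using char by (simp add: co_c normal_form_coeffs[OF nf] co_quad)
  then show ?thesis using nf by (intro has_row_form_R4) simp
qed

lemma has_row_form_R4_general:
  assumes L: "lifted_QLie_algebra s c \<beta>" and S: "semisimple_at_minus_one s c"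
    and nf: "normal_form s c \<beta> x1 x2 a p q r t d11 d12 d21 m 0 0 e" and e: "e \<noteq> 0"
    and char: "(2::'k) \<noteq> 0"
  shows "has_row_form s c \<beta>"
proof -
  note E = normal_form_equations[OF L nf]
  have m: "m = - 1" using E(3) e by (simp add: minus_mult_commute) (metis minus_mult_left mult_1 mult_right_cancel)
  have q: "q = 1" using E(9) e m by simp
  have t: "t = 1" using E(13) e m by simp
  have a: "a = 1" using E(10) e q by simp
  have p: "p = 0" using E(8) e m t by simp
  have r: "r = 0" using E(12) e m q by simp
  note nf = nf[unfolded m q t a p r]
  \<comment> \<open>As t - m = 2, this shift removes d12. Scaling x1 by e then normalises \<beta>
    x22 to x1.\<close>
  define \<nu> where "\<nu> = - d12 / 2"
  have d12: "d12 = - (2 * \<nu>)" using char by (simp add: \<nu>_def)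
  interpret N: planar_maps s "s e x1" "s 1 x2 + s \<nu> x1" c \<beta> by (rule planar_maps_change) (simp_all add: e)
  obtain d d' where nf': "normal_form s c \<beta> (s e x1) (s 1 x2 + s \<nu> x1) 1 0 1 0 1 d 0 d' (- 1) 0 0 1"
  proof
    show "normal_form s c \<beta> (s e x1) (s 1 x2 + s \<nu> x1) 1 0 1 0 1
       ((d11 + \<nu>\<^sup>2 * 2 - e * \<nu> * (0 + (d21 + \<nu> * 2) / e)) / e\<^sup>2) 0 ((d21 + \<nu> * 2) / e) (- 1) 0 0 1"
      by (rule normal_form_change_basis[OF nf]) (simp_all add: e d12)
  qed
  then show ?thesis by (rule N.has_row_form_R4_semisimple[OF S _ char])
qed

text \<open>The relation q b21 = - b12 shows that b21 = 0 entails b12 = 0, so the bracket is then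
  concentrated on x22. Otherwise x2 is scaled to make b21 = 1, and the value of q decides.\<close>

lemma lifted_has_row_form:
  assumes L: "lifted_QLie_algebra s c \<beta>" and S: "semisimple_at_minus_one s c"
    and im: "\<And>z. z \<in> tensor_power s 2 \<Longrightarrow> coord True (\<beta> z) = 0"
    and nz: "z0 \<in> tensor_power s 2" "\<beta> z0 \<noteq> 0"
    and char: "(2::'k) \<noteq> 0"
  shows "has_row_form s c \<beta>"
proof -
  obtain a p q r t d11 d12 d21 m b12 b21 e
    where nf: "normal_form s c \<beta> x1 x2 a p q r t d11 d12 d21 m b12 b21 e"
      and b: "b12 \<noteq> 0 \<or> b21 \<noteq> 0 \<or> e \<noteq> 0"
    using normal_form_exists[OF L im nz char] by blast
  note E = normal_form_equations[OF L nf]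
  show ?thesis
  proof (cases "b21 = 0")
    case True
    then have "b12 = 0" using E(1) by simp
    then show ?thesis using nf b True has_row_form_R4_general[OF L S _ _ char] by auto
  next
    case b21: False
    have \<mu>: "1 / b21 \<noteq> 0" using b21 by simp
    show ?thesis
    proof (cases "q = 1")
      case True
      interpret N: planar_maps s "s 1 x1" "s (1 / b21) x2 + s 0 x1" c \<beta>
        by (rule planar_maps_change) (simp_all add: b21)
      have b: "1 = (1 / b21) * b21" using b21 by simp
      show ?thesis
        by (rule N.has_row_form_flip[OF L S _ char])
           (rule normal_form_change_basis[OF nf[unfolded True] one_neq_zero \<mu> refl refl refl refl refl refl b refl])
    next
      case False
      have b: "1 = (1 / b21) * b21" using b21 by simp
      have b12: "b12 = - (q * b21)" using E(1) by simp
      \<comment> \<open>The shift that removes e; it exists because b12 + b21 = b21 (1 - q) is not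
        zero.\<close>
      define \<nu> where "\<nu> = - (e / b21) / (b21 * (1 - q))"
      interpret N: planar_maps s "s 1 x1" "s (1 / b21) x2 + s \<nu> x1" c \<beta>
        by (rule planar_maps_change) (simp_all add: b21)
      have e: "0 = ((1 / b21)\<^sup>2 * e + (1 / b21) * \<nu> * (b12 + b21)) / 1"
      proof -
        have "b12 + b21 = b21 * (1 - q)" by (simp add: b12 algebra_simps)
        then show ?thesis using b21 False by (simp add: \<nu>_def power2_eq_square)
      qed
      show ?thesis
        by (rule N.has_row_form_R6[OF L _ False])
           (rule normal_form_change_basis[OF nf one_neq_zero \<mu> refl refl refl refl refl refl b e])
    qed
  qed
qed

end

section \<open>Transport along isomorphisms\<close>

text \<open>The tensor square of \<open>g\<close> carries the monomials of one basis to those of the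
  other, so both spaces have the same structure constants.\<close>

lemma row_form_transport:
  assumes "planar_maps s u1 u2 c \<beta>" "planar_maps s' y1 y2 c' \<beta>'"
    and morph: "lifted_QLie_morphism s c \<beta> s' c' \<beta>' g"
    and gu: "g u1 = y1" "g u2 = y2"
    and row: "row_form w \<gamma> s' c' \<beta>' y1 y2"
  shows "row_form w \<gamma> s c \<beta> u1 u2"
proof -
  interpret U: planar_maps s u1 u2 c \<beta> by fact
  interpret W: planar_maps s' y1 y2 c' \<beta>' by fact
  interpret planar_pair s u1 u2 s' y1 y2 ..
  interpret g: Vector_Spaces.linear s s' g using morph by (simp add: lifted_QLie_morphism_def)
  let ?D = "degree_one_map s s' g"
  let ?gg = "tensor_map s s' 1 1 ?D ?D"
  have D_tvec: "?D (tvec s v) = tvec s' (g v)" for v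
    by (simp add: degree_one_map_def)
  have D: "tensor_linear s s' 1 ?D"
    unfolding tensor_linear_def
  proof (intro conjI ballI allI)
    fix z z' assume "z \<in> tensor_power s 1" "z' \<in> tensor_power s 1"
    then obtain v v' where "z = tvec s v" "z' = tvec s v'" using U.power1_eq_tvec by blast
    then show "?D (z \<oplus>\<^bsub>U.T\<^esub> z') = ?D z \<oplus>\<^bsub>W.T\<^esub> ?D z'"
      by (simp add: D_tvec g.add W.tvec_add flip: U.tvec_add)
  next
    fix a z assume "z \<in> tensor_power s 1"
    then obtain v where "z = tvec s v" using U.power1_eq_tvec by blast
    then show "?D (tscale s a z) = tscale s' a (?D z)"
      by (simp add: D_tvec g.scale W.tvec_scale flip: U.tvec_scale)
  qed (simp add: degree_one_map_def)
  have gg_lin: "tensor_linear s s' 2 ?gg"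
    using tensor_map_spec(1)[OF D D] unfolding nat_sums .
  have gg_mono: "?gg (U.mono [i, j]) = W.mono [i, j]" for i j
  proof -
    have "g (U.vec i) = W.vec i" for i by (cases i) (simp_all add: gu)
    then show ?thesis
      using tensor_map_spec(2)[OF D D, of "tvec s (U.vec i)" "tvec s (U.vec j)"]
      by (simp add: U.mono_tvec W.mono_tvec D_tvec)
  qed
  have gg_words: "W.words (?gg z) = U.words z" if z: "z \<in> tensor_power s 2" for z
  proof -
    have "W.words (?gg z) = (\<Sum>w\<in>words_of_length 2. scal (U.co w z) * Poly_Mapping.single w 1)"
      unfolding linear_words[OF gg_lin z] sum_words_2 gg_mono W.words_mono ..
    also have "\<dots> = U.words z"
      using U.homog_expand[OF U.power_homog[OF z]] by (simp add: U.co_def)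
    finally show ?thesis .
  qed
  have gg_c: "c' (?gg z) = ?gg (c z)" and gg_\<beta>: "g (\<beta> z) = \<beta>' (?gg z)" if "z \<in> tensor_power s 2" for z
    using morph that by (simp_all add: lifted_QLie_morphism_def Let_def)
  have mono2: "U.mono [k, l] \<in> tensor_power s 2" for k l by simp
  have C: "W.C i j k l = U.C i j k l" for i j k l
  proof -
    have "W.C i j k l = W.co [i, j] (?gg (c (U.mono [k, l])))"
      unfolding W.C_def gg_c[OF mono2, symmetric] gg_mono ..
    then show ?thesis
      using gg_words[OF U.c_power[OF mono2]] by (simp add: W.co_def U.co_def U.C_def)
  qed
  have coord_g: "W.coord i (g v) = U.coord i v" for i v
  proof -
    have "g v = s' (U.coord False v) y1 + s' (U.coord True v) y2"
      using arg_cong[OF U.coord_expand[of v], of g] by (simp add: g.add g.scale gu)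
    then show ?thesis by (cases i) (simp_all add: W.coord_add W.coord_scale)
  qed
  have B: "W.B i k l = U.B i k l" for i k l
    unfolding W.B_def U.B_def gg_mono[symmetric] gg_\<beta>[OF mono2, symmetric] coord_g ..
  show ?thesis
    using row unfolding row_form_def Let_def U.normal_form_iff W.normal_form_iff C B .
qed

lemma (in vector_space) basis_pair_of_image_vector:
  assumes "dim (UNIV :: 'b set) = 2" "dim V = 1" "x1 \<in> V" "x1 \<noteq> 0"
  obtains x2 where "basis_pair scale x1 x2" "\<And>v. v \<in> V \<Longrightarrow> \<exists>k. v = scale k x1"
proof -
  have "independent {x1}" using assms(4) by simp
  then obtain A where A: "{x1} \<subseteq> A" "independent A" "span A = UNIV"
    using maximal_independent_subset_extend[of "{x1}" UNIV] by (metis subset_UNIV top.extremum_uniqueI)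
  then have "card A = 2" using dim_eq_card[of A UNIV] assms(1) by simp
  then obtain x2 where "A = {x1, x2}" "x1 \<noteq> x2"
    using A(1) by (auto simp: card_2_iff)
  then have "basis_pair scale x1 x2" using A by (simp add: basis_pair_def)
  moreover have "\<exists>k. v = scale k x1" if v: "v \<in> V" for v
  proof -
    obtain D where "V \<subseteq> span D" "card D = 1" using basis_exists[of V] assms(2) by metis
    then obtain b where b: "V \<subseteq> span {b}" by (auto simp: card_1_singleton_iff)
    obtain k l where kl: "x1 = scale k b" "v = scale l b"
      using b v assms(3) unfolding span_singleton by blast
    then have "k \<noteq> 0" using assms(4) by auto
    then have "v = scale (l / k) x1" by (simp add: kl)
    then show ?thesis by blast
  qed
  ultimately show ?thesis using that by blast
qed

theorem theorem4p4:
  fixes s :: "'k::field \<Rightarrow> 'v::ab_group_add \<Rightarrow> 'v"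
  assumes "vector_space s"
    and "CHAR('k) \<noteq> 2"
  shows
    "(\<forall>c \<beta> f h.
        lifted_QLie_algebra s c \<beta> \<and>
        vector_space.dim s (UNIV :: 'v set) = 2 \<and>
        (\<exists>z \<in> tensor_power s 2. \<beta> z \<noteq> 0) \<and>
        is_minimal_polynomial s c f \<and> f = [:1, 1:] * h \<and> poly h (- 1) \<noteq> 0 \<and>
        vector_space.dim s (\<beta> ` tensor_power s 2) = 1
        \<longrightarrow>
        (\<exists>r. as_in_row r s c \<beta> \<and>
           (\<forall>r' (s' :: 'k \<Rightarrow> 'w::ab_group_add \<Rightarrow> 'w) c' \<beta>'.
              lifted_QLie_algebra s' c' \<beta>' \<and> lifted_QLie_isomorphic s c \<beta> s' c' \<beta>' \<and>
              as_in_row r' s' c' \<beta>' \<longrightarrow> r' = r)))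
     \<and>
     (\<forall>c \<beta> x1 x2 r \<gamma>.
        linear_T2_T2 s c \<and> linear_T2_V s \<beta> \<and> basis_pair s x1 x2 \<and> row_parameter r \<gamma> \<and>
        row_braiding r \<gamma> s x1 x2 c \<and> row_bracket r \<gamma> s x1 x2 \<beta>
        \<longrightarrow> lifted_QLie_algebra s c \<beta>)"
proof -
  interpret vector_space s by fact
  have char: "(2::'k) \<noteq> 0"
  proof
    assume "(2::'k) = 0"
    then have "of_nat 2 = (0::'k)" by simp
    then have "CHAR('k) dvd 2" by (simp only: of_nat_eq_0_iff_char_dvd)
    moreover have "CHAR('k) \<noteq> 1" by simp
    ultimately show False using assms(2) prime_nat_iff[of 2] by (metis two_is_prime_nat)
  qed
  have planar_maps: "planar_maps s x1 x2 c \<beta>"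
    if "linear_T2_T2 s c" "linear_T2_V s \<beta>" "basis_pair s x1 x2" for c \<beta> x1 x2
    using that by (simp add: planar_maps_def planar_maps_axioms_def planar_def planar_axioms_def vector_space_axioms)
  have classification: "\<exists>r. as_in_row r s c \<beta> \<and>
       (\<forall>r' (s' :: 'k \<Rightarrow> 'w \<Rightarrow> 'w) c' \<beta>'.
          lifted_QLie_algebra s' c' \<beta>' \<and> lifted_QLie_isomorphic s c \<beta> s' c' \<beta>' \<and>
          as_in_row r' s' c' \<beta>' \<longrightarrow> r' = r)"
    if L: "lifted_QLie_algebra s c \<beta>" and dims: "dim (UNIV :: 'v set) = 2" "dim (\<beta> ` tensor_power s 2) = 1"
      and nz: "\<exists>z \<in> tensor_power s 2. \<beta> z \<noteq> 0"
      and f: "is_minimal_polynomial s c ([:1, 1:] * h)" "poly h (- 1) \<noteq> 0"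
    for c \<beta> h
  proof -
    have lin: "linear_T2_T2 s c" "linear_T2_V s \<beta>"
      using L by (simp_all add: lifted_QLie_algebra_def braided_vector_space_def)
    obtain z0 where z0: "z0 \<in> tensor_power s 2" "\<beta> z0 \<noteq> 0" using nz by blast
    \<comment> \<open>Any nonzero value of \<beta> spans its one-dimensional image.\<close>
    define x1 where "x1 = \<beta> z0"
    obtain x2 where x: "basis_pair s x1 x2" and im: "\<And>v. v \<in> \<beta> ` tensor_power s 2 \<Longrightarrow> \<exists>k. v = s k x1"
      using basis_pair_of_image_vector[OF dims, of x1] z0 unfolding x1_def by blast
    interpret X: planar_maps s x1 x2 c \<beta> by (rule planar_maps[OF lin x])
    have "X.coord True (\<beta> z) = 0" if "z \<in> tensor_power s 2" for z
    proof -
      obtain k where "\<beta> z = s k x1" using im \<open>z \<in> tensor_power s 2\<close> by blast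
      then show ?thesis by (simp add: X.coord_scale)
    qed
    moreover have "semisimple_at_minus_one s c"
      unfolding semisimple_at_minus_one_def
      using X.eigen_minus_one_semisimple[OF f _ refl] by blast
    ultimately have "has_row_form s c \<beta>"
      using X.lifted_has_row_form[OF L _ _ z0 char] by blast
    then obtain w \<gamma> y1 y2 where y: "basis_pair s y1 y2" and w: "row_parameter w \<gamma>" "row_form w \<gamma> s c \<beta> y1 y2"
      unfolding has_row_form_def by blast
    interpret Y: planar_maps s y1 y2 c \<beta> by (rule planar_maps[OF lin y])
    have "as_in_row w s c \<beta>"
      unfolding as_in_row_def
      using y w Y.row_form_iff Y.row_form_minimal_polynomial[OF w(2,1) char] Y.row_form_U_Q[OF w(2,1) char] by blast
    moreover have "r' = w"
      if L': "lifted_QLie_algebra s' c' \<beta>'" and iso: "lifted_QLie_isomorphic s c \<beta> s' c' \<beta>'"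
        and r': "as_in_row r' s' c' \<beta>'"
      for r' and s' :: "'k \<Rightarrow> 'w \<Rightarrow> 'w" and c' \<beta>'
    proof -
      obtain v1 v2 \<gamma>' where v: "basis_pair s' v1 v2" "row_parameter r' \<gamma>'"
        "row_braiding r' \<gamma>' s' v1 v2 c'" "row_bracket r' \<gamma>' s' v1 v2 \<beta>'"
        using r' unfolding as_in_row_def by blast
      interpret W: planar_maps s' v1 v2 c' \<beta>'
        using L' v(1)
        by (simp add: planar_maps_def planar_maps_axioms_def planar_def planar_axioms_def
            lifted_QLie_algebra_def braided_vector_space_def)
      obtain g where g: "bij g" "lifted_QLie_morphism s c \<beta> s' c' \<beta>' g"
        using iso unfolding lifted_QLie_isomorphic_def by blast
      interpret g: Vector_Spaces.linear s s' g using g(2) by (simp add: lifted_QLie_morphism_def)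
      \<comment> \<open>The row basis of the second space is pulled back to the first, so that both
        rows are realised on one space and \<open>row_form_unique\<close> applies.\<close>
      define u1 u2 where "u1 = inv_into UNIV g v1" and "u2 = inv_into UNIV g v2"
      have gu: "g u1 = v1" "g u2 = v2"
        unfolding u1_def u2_def using g(1) by (simp_all add: bij_is_surj surj_f_inv_f)
      have u: "basis_pair s u1 u2"
      proof (rule basis_pairI)
        fix v
        have "g v = g (s (W.coord False (g v)) u1 + s (W.coord True (g v)) u2)"
          using W.coord_expand[of "g v"] by (simp add: g.add g.scale gu)
        then show "\<exists>a b. v = s a u1 + s b u2" using g(1) by (metis bij_is_inj injD)
      next
        fix a b assume "s a u1 + s b u2 = 0"
        then have "s' a v1 + s' b v2 = 0"
          using g.add[of "s a u1" "s b u2"] by (simp add: g.scale g.zero gu)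
        then have "W.coord i (s' a v1 + s' b v2) = 0" for i by simp
        from this[of False] this[of True] show "a = 0 \<and> b = 0"
          by (simp add: W.coord_add W.coord_scale)
      qed
      have "row_form r' \<gamma>' s' c' \<beta>' v1 v2" using v(3,4) W.row_form_iff by blast
      then have "row_form r' \<gamma>' s c \<beta> u1 u2"
        using row_form_transport[OF planar_maps[OF lin u] W.planar_maps_axioms g(2) gu] by blast
      then show ?thesis
        using Y.row_form_unique[OF w(2,1) u _ v(2) char] by blast
    qed
    ultimately show ?thesis by blast
  qed
  have converse: "lifted_QLie_algebra s c \<beta>"
    if "linear_T2_T2 s c" "linear_T2_V s \<beta>" "basis_pair s x1 x2" "row_parameter r \<gamma>"
      "row_braiding r \<gamma> s x1 x2 c" "row_bracket r \<gamma> s x1 x2 \<beta>"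
    for c \<beta> x1 x2 r \<gamma>
  proof -
    interpret X: planar_maps s x1 x2 c \<beta> by (rule planar_maps[OF that(1-3)])
    show ?thesis using that X.row_form_iff X.row_form_lifted_QLie_algebra by blast
  qed
  show ?thesis
  proof (intro conjI allI impI; (elim conjE)?)
    fix c \<beta> f h
    assume "lifted_QLie_algebra s c \<beta>" "dim (UNIV :: 'v set) = 2" "\<exists>z \<in> tensor_power s 2. \<beta> z \<noteq> 0"
      "is_minimal_polynomial s c f" "f = [:1, 1:] * h" "poly h (- 1) \<noteq> 0" "dim (\<beta> ` tensor_power s 2) = 1"
    then show "\<exists>r. as_in_row r s c \<beta> \<and>
       (\<forall>r' (s' :: 'k \<Rightarrow> 'w \<Rightarrow> 'w) c' \<beta>'.
          lifted_QLie_algebra s' c' \<beta>' \<and> lifted_QLie_isomorphic s c \<beta> s' c' \<beta>' \<and>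
          as_in_row r' s' c' \<beta>' \<longrightarrow> r' = r)"
      using classification[of c \<beta> h] by blast
  next
    fix c \<beta> x1 x2 r \<gamma>
    assume "linear_T2_T2 s c" "linear_T2_V s \<beta>" "basis_pair s x1 x2" "row_parameter r \<gamma>"
      "row_braiding r \<gamma> s x1 x2 c" "row_bracket r \<gamma> s x1 x2 \<beta>"
    then show "lifted_QLie_algebra s c \<beta>" by (rule converse)
  qed
qed

end
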